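(* Fix $d\ge 1$, $0<\varepsilon<1$, $B>0$, and a real random variable $\xi$ satisfying the anti-concentration condition (there are constants $0<c_1<c_2$, $c_3>0$ with $\mathbb{P}(c_1\le|\xi-\xi'|\le c_2)\ge c_3$, $\xi'$ an independent copy of $\xi$). Then there exist constants $C,n_0>0$ depending only on $B,\varepsilon,d,c_1,c_2,c_3$ such that the following holds for all $n\ge n_0$ and all $\beta>0$. Let $A=(a_{ij})_{1\le i,j\le n}$ have entries in $\mathbb{R}^d$ and suppose $$\sup_{a\in\mathbb{R}^d}\mathbb{P}_{\mathbf{x},\mathbf{y}}\Big(\Big\|\sum_{i,j\le n}a_{ij}x_iy_j-a\Big\|_2\le\beta\Big)\ge n^{-B},$$ where $x_1,\dots,x_n,y_1,\dots,y_n$ are iid copies of $\xi$. Then there exist a nonzero integer $k$ with $|k|\le n^C$, indices $i_1,\dots,i_r\in\{1,\dots,n\}$ with $r\le C$, and a set $I\subset\{1,\dots,n\}$ with $|I|\ge n-2n^{\varepsilon}$, such that for each $i\in I$ there exist integers $k_{ii_1},\dots,k_{ii_r}$ of absolute value at most $n^C$ with $$\mathbb{P}_{\mathbf{y}}\Big(\Big\|\sum_{j=1}^n y_j\Big(k\,a_{ij}+\sum_{l=1}^r k_{ii_l}a_{i_lj}\Big)\Big\|_2\le\beta n^{C}\Big)\ge n^{-C},$$ where $y_1,\dots,y_n$ are iid copies of $\xi$. *)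

theory Defs
  imports "HOL-Probability.Probability"
begin

text \<open>A real random variable is represented by its law \<open>\<mu>\<close> (a \<^const>\<open>real_distribution\<close>).
  This lets constants be quantified before the random variable without depending on the
  type of its sample space.\<close>

definition anti_concentrated :: "real \<Rightarrow> real \<Rightarrow> real \<Rightarrow> real measure \<Rightarrow> bool" where
  "anti_concentrated c1 c2 c3 \<mu> \<longleftrightarrow>
     \<P>((u, v) in \<mu> \<Otimes>\<^sub>M \<mu>. c1 \<le> \<bar>u - v\<bar> \<and> \<bar>u - v\<bar> \<le> c2) \<ge> c3"

definition iid_copies :: "real measure \<Rightarrow> nat \<Rightarrow> (nat \<Rightarrow> real) measure" where
  "iid_copies \<mu> n = (\<Pi>\<^sub>M i\<in>{1..n}. \<mu>)"

end

theory Submission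
  imports Defs "HOL-Real_Asymp.Real_Asymp"
begin

text \<open>
  For fixed \<open>y\<close> the bilinear form is a linear form in \<open>x\<close> with coefficients
  \<open>v i = (\<Sum>j. y j *\<^sub>R A i j)\<close>, so the heart of the matter is an inverse Littlewood--Offord theorem
  for vectors \<open>v i\<close>; the set of \<open>y\<close> for which it applies has polynomial measure, and pigeonholing over
  the polynomially many structures (and averaging over \<open>i\<close>, which costs the factor \<open>2\<close> in \<open>2 n\<^sup>\<epsilon>\<close>) gives
  the theorem. No symmetrization in \<open>y\<close> takes place, hence the final small ball is centred at \<open>0\<close>.

  The inverse theorem for vectors. After Gaussian smoothing and a convexity argument that replaces the symmetrized
  variable by one fixed increment \<open>\<eta>\<close>, concentration says that
  \<open>\<integral> exp (- c (\<Sum>i. 1 - cos \<langle>t, u i\<rangle>)) d\<gamma>(t)\<close> is at least polynomially small, where \<open>\<gamma>\<close> is the Gaussian measure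
  and \<open>u i\<close> is a multiple of \<open>v i\<close>. By convexity of \<open>exp\<close> a block of \<open>N\<close> indices may be replaced by one of
  its members with weight \<open>N\<close>. A Fejer kernel majorizes the resulting factor, and so many of the walks \<open>\<Sum>j. U j *\<^sub>R u (ws ! j)\<close>,
  \<open>0 \<le> U j < k\<close>, end in one ball. If a new generator has no multiple below \<open>m\<close> close to a short integer combination
  of the previous ones, the number of such walks drops by a factor of about \<open>m\<close>; this bounds any greedy choice of
  generators. A first greedy run bounds the rank and, after discarding generators, yields a set \<open>T\<close> that is
  independent at a much larger scale than the one at which almost all \<open>u i\<close> are rational combinations of \<open>T\<close>.
  A second run bounds the least common denominator of almost all of these rational combinations.
\<close>

section \<open>Gaussian smoothing\<close>

text \<open>A standard Gaussian vector given by its coordinates, so that the product rules for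
  \<open>PiM\<close> apply; \<open>pairing t w\<close> stands for its inner product with
  \<open>w\<close>.\<close>

definition gauss :: "('a::euclidean_space \<Rightarrow> real) measure" where
  "gauss = (\<Pi>\<^sub>M b\<in>Basis. std_normal_distribution)"

definition pairing :: "('a::euclidean_space \<Rightarrow> real) \<Rightarrow> 'a \<Rightarrow> real" where
  "pairing t w = (\<Sum>b\<in>Basis. t b * (w \<bullet> b))"

interpretation std_normal: real_distribution std_normal_distribution
  by (rule real_dist_normal_dist)

interpretation gauss: prob_space "gauss :: ('a::euclidean_space \<Rightarrow> real) measure"
  unfolding gauss_def by (intro prob_space_PiM) (rule std_normal.prob_space_axioms)

lemma pairing_measurable [measurable]: "(\<lambda>t. pairing t w) \<in> borel_measurable gauss"
  unfolding pairing_def gauss_def by measurable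

lemma pairing_diff: "pairing t (x - y) = pairing t x - pairing t y"
  by (simp add: pairing_def inner_diff_left right_diff_distrib sum_subtractf)

lemma pairing_scaleR: "pairing t (c *\<^sub>R x) = c * pairing t x"
  by (simp add: pairing_def sum_distrib_left mult_ac)

lemma pairing_sum: "pairing t (\<Sum>i\<in>I. f i) = (\<Sum>i\<in>I. pairing t (f i))"
  unfolding pairing_def by (subst sum.swap) (simp add: inner_sum_left sum_distrib_left)

text \<open>The Fourier transform of a Gaussian is Gaussian. This serves twice: to replace the
  indicator of a ball by an average of cosines, and in \<open>integral_prod_Fejer\<close> to return
  from cosines to distances.\<close>

lemma integral_gauss_cos: "(\<integral>t. cos (pairing t w) \<partial>gauss) = exp (- (norm w)\<^sup>2 / 2)"
proof -
  interpret product_sigma_finite "\<lambda>_::'a. std_normal_distribution"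
    by standard
  have int1: "integrable std_normal_distribution (\<lambda>x. iexp (c * x))" for c
    by (intro std_normal.integrable_iexp) auto
  have eq: "iexp (pairing t w) = (\<Prod>b\<in>Basis. iexp ((w \<bullet> b) * t b))" for t
    by (simp add: pairing_def exp_sum sum_distrib_left mult_ac)
  have "(\<integral>t. iexp (pairing t w) \<partial>gauss) = (\<Prod>b\<in>Basis. char std_normal_distribution (w \<bullet> b))"
    unfolding eq gauss_def char_def by (rule product_integral_prod) (use int1 in auto)
  also have "\<dots> = of_real (\<Prod>b\<in>Basis. exp (- (w \<bullet> b)\<^sup>2 / 2))"
    by (simp add: char_std_normal_distribution)
  also have "(\<Prod>b\<in>Basis. exp (- (w \<bullet> b)\<^sup>2 / 2)) = exp (- (norm w)\<^sup>2 / 2)"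
    unfolding power2_norm_eq_inner euclidean_inner [of w w]
    by (simp add: exp_sum [symmetric] sum_negf sum_divide_distrib [symmetric] power2_eq_square)
  finally have *: "(\<integral>t. iexp (pairing t w) \<partial>gauss) = of_real (exp (- (norm w)\<^sup>2 / 2))" .
  have "integrable gauss (\<lambda>t. iexp (pairing t w))"
    unfolding eq gauss_def by (rule product_integrable_prod) (use int1 in auto)
  from integral_Re [OF this] * show ?thesis
    by (simp add: Re_exp)
qed

text \<open>An inequality of Esseen type. On the unit ball, \<open>exp (1/2)\<close> times the
  Gaussian weight of \<open>S x\<close> is at least 1; that weight is an average of cosines over
  \<open>t\<close>, and after Fubini independence turns the expectation over \<open>x\<close> into a
  product of characteristic functions. The centre \<open>a\<close> contributes only a phase.\<close>

lemma prob_ball_le_integral_char: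
  fixes v :: "nat \<Rightarrow> 'a::euclidean_space"
  assumes "real_distribution \<mu>" and [simp]: "finite I"
  shows "\<P>(x in (\<Pi>\<^sub>M i\<in>I. \<mu>). norm ((\<Sum>i\<in>I. x i *\<^sub>R v i) - a) \<le> 1)
     \<le> exp (1/2) * (\<integral>t. (\<Prod>i\<in>I. cmod (char \<mu> (pairing t (v i)))) \<partial>gauss)"
proof -
  interpret mu: real_distribution \<mu> by fact
  interpret product_sigma_finite "\<lambda>_::nat. \<mu>"
    by standard
  define M where "M = (\<Pi>\<^sub>M i\<in>I. \<mu>)"
  interpret M: prob_space M
    unfolding M_def by (intro prob_space_PiM) (rule mu.prob_space_axioms)
  interpret P: pair_prob_space M "gauss :: ('a \<Rightarrow> real) measure" ..
  define S where "S x = (\<Sum>i\<in>I. x i *\<^sub>R v i) - a" for x :: "nat \<Rightarrow> real"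
  have comp[measurable]: "(\<lambda>x. x i) \<in> borel_measurable M" if "i \<in> I" for i
    using that unfolding M_def by (metis measurable_component_singleton mu.M_is_borel
      measurable_cong_sets mu.events_eq_borel)
  have [measurable]: "S \<in> borel_measurable M"
    unfolding S_def by (intro borel_measurable_diff borel_measurable_sum borel_measurable_scaleR) auto
  have pS: "pairing t (S x) = (\<Sum>i\<in>I. x i * pairing t (v i)) - pairing t a" for t x
    by (simp add: S_def pairing_diff pairing_sum pairing_scaleR)
  have meas: "(\<lambda>(x, t). cos (pairing t (S x))) \<in> borel_measurable (M \<Otimes>\<^sub>M gauss)"
    unfolding pS by measurable
  have int: "integrable (M \<Otimes>\<^sub>M gauss) (\<lambda>(x, t). cos (pairing t (S x)))"
    by (rule P.integrable_const_bound [where B = 1]) (use meas in \<open>auto intro!: AE_I2 simp: split_def\<close>)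
  have char_int: "integrable \<mu> (\<lambda>x. iexp (s * x))" for s
    by (intro mu.integrable_iexp) auto
  have inner_le: "(\<integral>x. cos (pairing t (S x)) \<partial>M) \<le> (\<Prod>i\<in>I. cmod (char \<mu> (pairing t (v i))))" for t
  proof -
    let ?f = "\<lambda>x. iexp (- pairing t a) * (\<Prod>i\<in>I. iexp (pairing t (v i) * x i))"
    have eq: "iexp (pairing t (S x)) = ?f x" for x
      by (simp add: pS exp_sum [symmetric] exp_add [symmetric] sum_distrib_left mult_ac
          right_diff_distrib)
    have i0: "integrable M (\<lambda>x. \<Prod>i\<in>I. iexp (pairing t (v i) * x i))"
      unfolding M_def by (rule product_integrable_prod) (use char_int in auto)
    then have i1: "integrable M ?f"
      by (rule integrable_mult_right)
    have "cos (pairing t (S x)) = Re (?f x)" for x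
      unfolding eq [symmetric] by (simp add: Re_exp)
    then have "(\<integral>x. cos (pairing t (S x)) \<partial>M) = Re (\<integral>x. ?f x \<partial>M)"
      by (simp only: integral_Re [OF i1])
    also have "(\<integral>x. ?f x \<partial>M) = iexp (- pairing t a) * (\<Prod>i\<in>I. char \<mu> (pairing t (v i)))"
      unfolding M_def char_def
      by (simp only: integral_mult_right_zero)
        (subst product_integral_prod, use char_int in auto)
    also have "Re \<dots> \<le> cmod \<dots>"
      by (rule complex_Re_le_cmod)
    also have "\<dots> = (\<Prod>i\<in>I. cmod (char \<mu> (pairing t (v i))))"
      by (simp add: norm_mult prod_norm)
    finally show ?thesis .
  qed
  have [measurable]: "char \<mu> \<in> borel_measurable borel"
    by (intro borel_measurable_continuous_onI continuous_at_imp_continuous_on ballI mu.isCont_char)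
  have iprod: "integrable gauss (\<lambda>t. \<Prod>i\<in>I. cmod (char \<mu> (pairing t (v i))))"
    by (rule gauss.integrable_const_bound [where B = 1])
      (auto intro!: AE_I2 prod_le_1 simp: prod_norm [symmetric] mu.cmod_char_le_1 abs_prod)
  have iexp: "integrable M (\<lambda>x. exp (1/2) * exp (- (norm (S x))\<^sup>2 / 2))"
    by (rule M.integrable_const_bound [where B = "exp (1/2)"]) (auto intro!: AE_I2)
  have "M.prob {x \<in> space M. norm (S x) \<le> 1} = (\<integral>x. indicator {x \<in> space M. norm (S x) \<le> 1} x \<partial>M)"
    by (simp add: Int_absorb1)
  also have "\<dots> \<le> (\<integral>x. exp (1/2) * exp (- (norm (S x))\<^sup>2 / 2) \<partial>M)"
  proof (rule integral_mono [OF _ iexp])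
    show "integrable M (indicator {x \<in> space M. norm (S x) \<le> 1} :: _ \<Rightarrow> real)"
      by (intro integrable_real_indicator) (auto simp: M.emeasure_eq_measure)
    fix x assume "x \<in> space M"
    have "1 \<le> exp (1/2) * exp (- (norm (S x))\<^sup>2 / 2)" if "norm (S x) \<le> 1"
      using that power_mono [OF that, of 2] by (simp add: exp_add [symmetric])
    then show "indicator {x \<in> space M. norm (S x) \<le> 1} x \<le> exp (1/2) * exp (- (norm (S x))\<^sup>2 / 2)"
      by (auto simp: indicator_def)
  qed
  also have "\<dots> = exp (1/2) * (\<integral>x. (\<integral>t. cos (pairing t (S x)) \<partial>gauss) \<partial>M)"
    by (simp add: integral_gauss_cos)
  also have "(\<integral>x. (\<integral>t. cos (pairing t (S x)) \<partial>gauss) \<partial>M) = (\<integral>t. (\<integral>x. cos (pairing t (S x)) \<partial>M) \<partial>gauss)"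
    using P.Fubini_integral [OF int] by simp
  also have "\<dots> \<le> (\<integral>t. (\<Prod>i\<in>I. cmod (char \<mu> (pairing t (v i)))) \<partial>gauss)"
    using P.integrable_snd [OF int] by (intro integral_mono iprod inner_le)
  finally show ?thesis
    by (simp add: M_def S_def)
qed

section \<open>Symmetrization and a common increment\<close>

text \<open>The squared modulus of the characteristic function is the mean of
  \<open>cos (s * (x - x'))\<close> for an independent copy \<open>x'\<close>. Bounding the cosine
  by 1 off \<open>G\<close>, and then \<open>1 - y\<close> by \<open>exp (- y)\<close>, gives the
  square of the right side; hence the factor 1/2.\<close>

lemma cmod_char_le_exp_symmetrized:
  assumes "real_distribution \<mu>" and [measurable]: "G \<in> sets (\<mu> \<Otimes>\<^sub>M \<mu>)"
  shows "cmod (char \<mu> s) \<le>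
    exp (- (1/2) * (\<integral>z. indicator G z * (1 - cos (s * (fst z - snd z))) \<partial>(\<mu> \<Otimes>\<^sub>M \<mu>)))"
proof -
  interpret mu: real_distribution \<mu> by fact
  interpret P: pair_prob_space \<mu> \<mu> ..
  let ?N = "\<mu> \<Otimes>\<^sub>M \<mu>"
  let ?h = "\<lambda>z. 1 - cos (s * (fst z - snd z))"
  have [measurable]: "fst \<in> borel_measurable ?N" "snd \<in> borel_measurable ?N"
    using measurable_fst [of \<mu> \<mu>] measurable_snd [of \<mu> \<mu>]
    by (simp_all cong: measurable_cong_sets)
  have bd: "\<bar>1 - cos x\<bar> \<le> 2" "\<bar>cos x\<bar> \<le> 2" for x :: real
    using cos_ge_minus_one [of x] cos_le_one [of x] by linarith+
  have bounded: "integrable ?N f" if [measurable]: "f \<in> borel_measurable ?N" and "\<And>z. \<bar>f z\<bar> \<le> 2" for f :: "_ \<Rightarrow> real"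
    by (rule P.integrable_const_bound [where B = 2]) (use that in auto)
  have icc: "integrable ?N (\<lambda>z. cos (s * fst z) * cos (s * snd z))"
    and iss: "integrable ?N (\<lambda>z. sin (s * fst z) * sin (s * snd z))"
    by (rule bounded; auto simp: abs_mult intro!: order_trans [OF mult_le_one])+
  have "integrable \<mu> (\<lambda>x. iexp (s * x))"
    by (intro mu.integrable_iexp) auto
  from integral_Re [OF this] integral_Im [OF this]
  have ReIm: "Re (char \<mu> s) = (\<integral>x. cos (s * x) \<partial>\<mu>)" "Im (char \<mu> s) = (\<integral>x. sin (s * x) \<partial>\<mu>)"
    by (simp_all add: char_def Re_exp Im_exp)
  have prod_c: "(\<integral>z. cos (s * fst z) * cos (s * snd z) \<partial>?N) = (\<integral>x. cos (s * x) \<partial>\<mu>)\<^sup>2"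
    using P.integral_fst' [OF icc] by (simp add: power2_eq_square)
  have prod_s: "(\<integral>z. sin (s * fst z) * sin (s * snd z) \<partial>?N) = (\<integral>x. sin (s * x) \<partial>\<mu>)\<^sup>2"
    using P.integral_fst' [OF iss] by (simp add: power2_eq_square)
  have "(cmod (char \<mu> s))\<^sup>2 = (\<integral>z. cos (s * fst z) * cos (s * snd z) + sin (s * fst z) * sin (s * snd z) \<partial>?N)"
    unfolding cmod_power2 ReIm using icc iss by (simp add: prod_c prod_s)
  also have "\<dots> = (\<integral>z. cos (s * (fst z - snd z)) \<partial>?N)"
    by (simp add: cos_diff right_diff_distrib)
  also have "\<dots> \<le> (\<integral>z. 1 - indicator G z * ?h z \<partial>?N)"
    by (intro integral_mono bounded) (auto simp: indicator_def bd)
  also have "\<dots> = 1 - (\<integral>z. indicator G z * ?h z \<partial>?N)"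
    by (subst Bochner_Integration.integral_diff)
      (auto intro!: bounded simp: P.prob_space indicator_def bd)
  also have "\<dots> \<le> exp (- (\<integral>z. indicator G z * ?h z \<partial>?N))"
    using exp_ge_add_one_self [of "- (\<integral>z. indicator G z * ?h z \<partial>?N)"] by simp
  also have "\<dots> = (exp (- (1/2) * (\<integral>z. indicator G z * ?h z \<partial>?N)))\<^sup>2"
    by (simp add: exp_double [symmetric])
  finally show ?thesis
    by (rule power2_le_imp_le) simp
qed

text \<open>The exponents of all factors are averages over the same law of increments, so Jensen's
  inequality takes them out of the exponential jointly. After Fubini, some increment does at least
  as well as the mean. Halving \<open>Q\<close> makes a weak inequality under the integral
  sufficient for the contradiction.\<close>

lemma exists_common_increment:
  fixes v :: "nat \<Rightarrow> 'a::euclidean_space"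
  assumes mu: "real_distribution \<mu>" and ac: "anti_concentrated c1 c2 c3 \<mu>" and "0 < c3"
    and [simp]: "finite I" and "0 < Q"
    and Q: "Q \<le> (\<integral>t. (\<Prod>i\<in>I. cmod (char \<mu> (pairing t (v i)))) \<partial>gauss)"
  shows "\<exists>\<eta>. c1 \<le> \<bar>\<eta>\<bar> \<and> \<bar>\<eta>\<bar> \<le> c2 \<and>
     Q / 2 \<le> (\<integral>t. exp (- (c3/2) * (\<Sum>i\<in>I. 1 - cos (pairing t (\<eta> *\<^sub>R v i)))) \<partial>gauss)"
proof (rule ccontr)
  assume neg: "\<not> ?thesis"
  interpret mu: real_distribution \<mu> by fact
  interpret P: pair_prob_space \<mu> \<mu> ..
  define N where "N = \<mu> \<Otimes>\<^sub>M \<mu>"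
  interpret N: prob_space N
    unfolding N_def by (rule P.P.prob_space_axioms)
  interpret PN: pair_prob_space N "gauss :: ('a \<Rightarrow> real) measure" ..
  define G where "G = {z \<in> space N. c1 \<le> \<bar>fst z - snd z\<bar> \<and> \<bar>fst z - snd z\<bar> \<le> c2}"
  have [measurable]: "fst \<in> borel_measurable N" "snd \<in> borel_measurable N"
    using measurable_fst [of \<mu> \<mu>] measurable_snd [of \<mu> \<mu>]
    by (simp_all add: N_def cong: measurable_cong_sets)
  have [measurable]: "G \<in> sets N"
    unfolding G_def by measurable
  define p where "p = N.prob G"
  have p: "c3 \<le> p" "p \<le> 1"
    using ac by (simp_all add: anti_concentrated_def p_def G_def N_def split_def)
  define c where "c = c3 / 2"
  define h where "h z t = (\<Sum>i\<in>I. 1 - cos (pairing t ((fst z - snd z) *\<^sub>R v i)))"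
    for z :: "real \<times> real" and t
  have h_eq: "h z t = (\<Sum>i\<in>I. 1 - cos (pairing t (v i) * (fst z - snd z)))" for z t
    by (simp add: h_def pairing_scaleR mult_ac)
  have h0: "0 \<le> h z t" for z t
    unfolding h_def by (intro sum_nonneg) auto
  have h_le: "h z t \<le> 2 * real (card I)" for z t
  proof -
    have "h z t \<le> (\<Sum>i\<in>I. 2)"
      unfolding h_def by (intro sum_mono) (metis cos_ge_minus_one diff_left_mono diff_minus_eq_add one_add_one)
    then show ?thesis by simp
  qed
  have mh[measurable]: "(\<lambda>z. h z t) \<in> borel_measurable N" for t
    unfolding h_eq by measurable
  have mh2: "(\<lambda>(z, t). h z t) \<in> borel_measurable (N \<Otimes>\<^sub>M gauss)"
    unfolding h_eq split_def by measurable
  have iG: "integrable N (\<lambda>z. indicator G z * f z)"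
    if [measurable]: "f \<in> borel_measurable N" and "\<And>z. \<bar>f z\<bar> \<le> b" for f :: "_ \<Rightarrow> real" and b
    by (rule N.integrable_const_bound [where B = "\<bar>b\<bar>"])
      (auto intro!: AE_I2 simp: indicator_def intro: order_trans [OF that(2)])
  have prod_le: "(\<Prod>i\<in>I. cmod (char \<mu> (pairing t (v i)))) \<le> (1/p) * (\<integral>z. indicator G z * exp (- c * h z t) \<partial>N)" for t
  proof -
    \<comment> \<open>Jensen's inequality for the law conditioned on \<open>G\<close>: \<open>exp\<close> lies above its tangent at the mean \<open>m\<close>.\<close>
    define m where "m = (\<integral>z. indicator G z * h z t \<partial>N) / p"
    have int: "integrable N (\<lambda>z. indicator G z * h z t)"
      by (rule iG [of _ "2 * real (card I)"]) (use h0 h_le in auto)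
    have m0: "0 \<le> m"
      unfolding m_def using p \<open>0 < c3\<close> h0 by (intro divide_nonneg_nonneg Bochner_Integration.integral_nonneg) auto
    have bd: "\<bar>1 - cos x\<bar> \<le> 2" for x :: real
      using cos_ge_minus_one [of x] cos_le_one [of x] by linarith
    have "(\<Prod>i\<in>I. cmod (char \<mu> (pairing t (v i)))) \<le>
        (\<Prod>i\<in>I. exp (- (1/2) * (\<integral>z. indicator G z * (1 - cos (pairing t (v i) * (fst z - snd z))) \<partial>N)))"
      unfolding N_def by (intro prod_mono conjI norm_ge_zero cmod_char_le_exp_symmetrized mu)
        (use \<open>G \<in> sets N\<close> in \<open>simp only: N_def\<close>)
    also have "\<dots> = exp (- (1/2) * (\<Sum>i\<in>I. (\<integral>z. indicator G z * (1 - cos (pairing t (v i) * (fst z - snd z))) \<partial>N)))"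
      by (simp only: exp_sum [symmetric] sum_distrib_left \<open>finite I\<close>)
    also have "(\<Sum>i\<in>I. (\<integral>z. indicator G z * (1 - cos (pairing t (v i) * (fst z - snd z))) \<partial>N))
       = (\<integral>z. (\<Sum>i\<in>I. indicator G z * (1 - cos (pairing t (v i) * (fst z - snd z)))) \<partial>N)"
      by (subst Bochner_Integration.integral_sum) (auto intro!: iG [of _ 2] bd)
    also have "\<dots> = p * m"
      using p \<open>0 < c3\<close> by (simp add: m_def h_eq sum_distrib_left)
    \<comment> \<open>Here anti-concentration enters: \<open>G\<close> has measure \<open>p\<close>,
      which is at least \<open>c3\<close>, and so \<open>c\<close> is \<open>c3 / 2\<close>.\<close>
    also have "exp (- (1/2) * (p * m)) \<le> exp (- c * m)"
      using mult_right_mono [OF p(1) m0] by (simp add: c_def)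
    \<comment> \<open>The linear term integrates to 0 over \<open>G\<close>, because
      \<open>m\<close> is the mean of \<open>h\<close> there.\<close>
    also have "\<dots> = (1/p) * (\<integral>z. indicator G z * (exp (- c * m) * (1 - c * (h z t - m))) \<partial>N)"
    proof -
      have "(\<integral>z. indicator G z * (exp (- c * m) * (1 - c * (h z t - m))) \<partial>N)
        = (\<integral>z. exp (- c * m) * (1 + c * m) * indicator G z - exp (- c * m) * c * (indicator G z * h z t) \<partial>N)"
        by (rule Bochner_Integration.integral_cong) (auto simp: algebra_simps)
      also have "\<dots> = exp (- c * m) * (1 + c * m) * p - exp (- c * m) * c * (p * m)"
        using int p \<open>0 < c3\<close> N.emeasure_eq_measure[of G]
        by (subst Bochner_Integration.integral_diff)
           (auto simp: p_def [symmetric] m_def Int_absorb1 sets.sets_into_space intro!: integrable_mult_right integrable_real_indicator)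
      also have "\<dots> = exp (- c * m) * p"
        by (simp add: algebra_simps)
      finally show ?thesis
        using p \<open>0 < c3\<close> by simp
    qed
    also have "\<dots> \<le> (1/p) * (\<integral>z. indicator G z * exp (- c * h z t) \<partial>N)"
    proof (rule mult_left_mono [OF integral_mono])
      show "integrable N (\<lambda>z. indicator G z * (exp (- c * m) * (1 - c * (h z t - m))))"
      proof (rule iG)
        show "\<bar>exp (- c * m) * (1 - c * (h z t - m))\<bar> \<le> exp (- c * m) * (1 + c * (2 * real (card I) + m))" for z
        proof -
          have "\<bar>c * (h z t - m)\<bar> \<le> c * (2 * real (card I) + m)"
            unfolding abs_mult using h0 [of z t] h_le [of z t] m0 \<open>0 < c3\<close>
            by (intro mult_mono) (auto simp: c_def)
          then have "\<bar>1 - c * (h z t - m)\<bar> \<le> 1 + c * (2 * real (card I) + m)"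
            by linarith
          then show ?thesis
            by (simp add: abs_mult)
        qed
      qed simp
      show "integrable N (\<lambda>z. indicator G z * exp (- c * h z t))"
        by (rule iG [of _ 1]) (use h0 \<open>0 < c3\<close> in \<open>auto simp: c_def\<close>)
      show "indicator G z * (exp (- c * m) * (1 - c * (h z t - m))) \<le> indicator G z * exp (- c * h z t)" for z
      proof -
        have "exp (- c * m) * (1 - c * (h z t - m)) \<le> exp (- c * m) * exp (- (c * (h z t - m)))"
          using exp_ge_add_one_self [of "- (c * (h z t - m))"] by (intro mult_left_mono) auto
        also have "\<dots> = exp (- c * h z t)"
          by (simp add: exp_add [symmetric] algebra_simps)
        finally show ?thesis
          by (simp add: indicator_def)
      qed
    qed (use p \<open>0 < c3\<close> in auto)
    finally show ?thesis .
  qed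
  have [measurable]: "char \<mu> \<in> borel_measurable borel"
    by (intro borel_measurable_continuous_onI continuous_at_imp_continuous_on ballI mu.isCont_char)
  have iprod: "integrable gauss (\<lambda>t. \<Prod>i\<in>I. cmod (char \<mu> (pairing t (v i))))"
    by (rule gauss.integrable_const_bound [where B = 1])
      (auto intro!: AE_I2 prod_le_1 simp: prod_norm [symmetric] mu.cmod_char_le_1 abs_prod)
  have meas: "(\<lambda>(z, t). indicator G z * exp (- c * h z t)) \<in> borel_measurable (N \<Otimes>\<^sub>M gauss)"
    using mh2 unfolding split_def by measurable
  have int: "integrable (N \<Otimes>\<^sub>M gauss) (\<lambda>(z, t). indicator G z * exp (- c * h z t))"
    by (rule PN.integrable_const_bound [where B = 1])
      (use meas h0 \<open>0 < c3\<close> in \<open>auto intro!: AE_I2 simp: indicator_def split_def c_def\<close>)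
  have "Q \<le> (\<integral>t. (1/p) * (\<integral>z. indicator G z * exp (- c * h z t) \<partial>N) \<partial>gauss)"
    using Q by (rule order_trans)
      (intro integral_mono iprod prod_le integrable_mult_right PN.integrable_snd [OF int])
  also have "\<dots> = (1/p) * (\<integral>z. (\<integral>t. indicator G z * exp (- c * h z t) \<partial>gauss) \<partial>N)"
    using PN.Fubini_integral [OF int] by simp
  also have "\<dots> \<le> (1/p) * (\<integral>z. indicator G z * (Q / 2) \<partial>N)"
  proof (rule mult_left_mono [OF integral_mono])
    show "integrable N (\<lambda>z. \<integral>t. indicator G z * exp (- c * h z t) \<partial>gauss)"
      using PN.integrable_fst [OF int] .
    show "integrable N (\<lambda>z. indicator G z * (Q / 2))"
      by (rule iG [of _ "\<bar>Q / 2\<bar>"]) auto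
    show "(\<integral>t. indicator G z * exp (- c * h z t) \<partial>gauss) \<le> indicator G z * (Q / 2)" for z
    proof (cases "z \<in> G")
      case True
      then have "\<not> Q / 2 \<le> (\<integral>t. exp (- c * h z t) \<partial>gauss)"
        using neg unfolding c_def h_def G_def by auto
      then show ?thesis by (simp add: True)
    qed simp
  qed (use p \<open>0 < c3\<close> in auto)
  also have "\<dots> = Q / 2"
    using p \<open>0 < c3\<close> by (simp add: p_def [symmetric] Int_absorb1 sets.sets_into_space)
  finally show False
    using \<open>0 < Q\<close> by simp
qed

section \<open>Greedy selection of generators\<close>

text \<open>What remains of the concentration integral once blocks are collapsed to the members of
  \<open>ws\<close>, each with weight \<open>L\<close>, and all other factors are bounded by 1. A
  list, because every generator is judged against those chosen before it.\<close>

definition conc :: "real \<Rightarrow> (nat \<Rightarrow> 'a::euclidean_space) \<Rightarrow> nat list \<Rightarrow> real" where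
  "conc L u ws = (\<integral>t. (\<Prod>j<length ws. exp (- L * (1 - cos (pairing t (u (ws ! j)))))) \<partial>gauss)"

lemma exp_energy_bounds:
  assumes "0 \<le> L"
  shows "0 \<le> exp (- L * (1 - cos (x::real)))" "exp (- L * (1 - cos x)) \<le> 1"
  using assms by (auto simp: mult_nonneg_nonneg)

text \<open>The product is \<open>exp\<close> of the mean of the numbers
  \<open>- (c * N) * g i\<close>, and \<open>exp\<close> is convex.\<close>

lemma prod_exp_le_average:
  fixes g :: "'i \<Rightarrow> real"
  assumes "finite J" "card J = N" "0 < N"
  shows "(\<Prod>i\<in>J. exp (- c * g i)) \<le> (\<Sum>i\<in>J. exp (- (c * real N) * g i)) / real N"
proof -
  have "exp (\<Sum>i\<in>J. (1 / real N) *\<^sub>R (- (c * real N) * g i)) \<le> (\<Sum>i\<in>J. (1 / real N) * exp (- (c * real N) * g i))"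
    using assms by (intro convex_on_sum [OF _ _ exp_convex]) auto
  then show ?thesis
    using assms by (simp add: exp_sum [symmetric] sum_divide_distrib)
qed

lemma prod_lessThan_append:
  "(\<Prod>j<length (ws @ [i]). f ((ws @ [i]) ! j)) = (\<Prod>j<length ws. f (ws ! j)) * (f i :: 'b::comm_monoid_mult)"
  by (simp add: nth_append)

lemma integrable_prod_exp_energy:
  assumes "0 \<le> L" "0 \<le> c"
  shows "integrable gauss (\<lambda>t. (\<Prod>j<s. exp (- L * (1 - cos (pairing t (w j))))) *
      (\<Prod>i\<in>W. exp (- c * (1 - cos (pairing t (u i))))))"
  by (rule gauss.integrable_const_bound [where B = 1])
    (auto intro!: AE_I2 prod_le_1 mult_le_one prod_nonneg mult_nonneg_nonneg simp: abs_mult abs_prod assms)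

text \<open>By \<open>prod_exp_le_average\<close> the block \<open>J\<close> is dominated by the
  average of its members, each with the weight of the whole block; some member reaches that average
  under the integral.\<close>

lemma greedy_step:
  fixes u :: "nat \<Rightarrow> 'a::euclidean_space"
  assumes "finite W" "J \<subseteq> W" "card J = N" "0 < N" "0 \<le> c"
    and Q: "Q \<le> (\<integral>t. (\<Prod>j<length ws. exp (- (c * real N) * (1 - cos (pairing t (u (ws ! j)))))) *
      (\<Prod>i\<in>W. exp (- c * (1 - cos (pairing t (u i))))) \<partial>gauss)"
  shows "\<exists>i\<in>J. Q \<le> (\<integral>t. (\<Prod>j<length (ws @ [i]). exp (- (c * real N) * (1 - cos (pairing t (u ((ws @ [i]) ! j)))))) *
      (\<Prod>i\<in>W - J. exp (- c * (1 - cos (pairing t (u i))))) \<partial>gauss)"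
proof (rule ccontr)
  define F where "F ws t = (\<Prod>j<length ws. exp (- (c * real N) * (1 - cos (pairing t (u (ws ! j))))))" for ws t
  define H where "H W t = (\<Prod>i\<in>W. exp (- c * (1 - cos (pairing t (u i)))))" for W t
  assume "\<not> ?thesis"
  then have less: "(\<integral>t. F (ws @ [i]) t * H (W - J) t \<partial>gauss) < Q" if "i \<in> J" for i
    using that by (auto simp: F_def H_def not_le)
  have int: "integrable gauss (\<lambda>t. F ws t * H W t)" for ws W
    unfolding F_def H_def using assms by (intro integrable_prod_exp_energy) auto
  have nonneg: "0 \<le> F ws t" "0 \<le> H W t" for ws t W
    unfolding F_def H_def by (auto intro!: prod_nonneg)
  have finJ: "finite J" "J \<noteq> {}"
    using assms finite_subset by auto
  have FA: "F (ws @ [i]) t = F ws t * exp (- (c * real N) * (1 - cos (pairing t (u i))))" for i t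
    unfolding F_def by (rule prod_lessThan_append)
  have HW: "H W t = H (W - J) t * (\<Prod>i\<in>J. exp (- c * (1 - cos (pairing t (u i)))))" for t
    unfolding H_def by (rule prod.subset_diff) (use assms in auto)
  have "Q \<le> (\<integral>t. F ws t * H W t \<partial>gauss)"
    using Q by (simp add: F_def H_def)
  also have "\<dots> \<le> (\<integral>t. (\<Sum>i\<in>J. F (ws @ [i]) t * H (W - J) t) / real N \<partial>gauss)"
  proof (rule integral_mono [OF int])
    show "integrable gauss (\<lambda>t. (\<Sum>i\<in>J. F (ws @ [i]) t * H (W - J) t) / real N)"
      by (intro integrable_divide_zero Bochner_Integration.integrable_sum int)
    fix t
    have "F ws t * H W t \<le> F ws t * (H (W - J) t * ((\<Sum>i\<in>J. exp (- (c * real N) * (1 - cos (pairing t (u i))))) / real N))"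
      unfolding HW using finJ assms
      by (intro mult_left_mono prod_exp_le_average nonneg) auto
    also have "\<dots> = (\<Sum>i\<in>J. F (ws @ [i]) t * H (W - J) t) / real N"
      unfolding FA by (simp add: sum_distrib_left sum_distrib_right mult_ac)
    finally show "F ws t * H W t \<le> (\<Sum>i\<in>J. F (ws @ [i]) t * H (W - J) t) / real N" .
  qed
  also have "\<dots> = (\<Sum>i\<in>J. (\<integral>t. F (ws @ [i]) t * H (W - J) t \<partial>gauss)) / real N"
    using int by (simp add: Bochner_Integration.integral_sum)
  also have "\<dots> < (\<Sum>i\<in>J. Q) / real N"
    using less finJ assms by (intro divide_strict_right_mono sum_strict_mono) auto
  also have "\<dots> = Q"
    using assms by simp
  finally show False by simp
qed

text \<open>\<open>Bad\<close> is left abstract because the two greedy runs use different criteria.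
  The induction on \<open>S\<close> also tracks the set \<open>X\<close> of indices consumed so far,
  at most \<open>N\<close> per generator. A run either produces \<open>S\<close> generators or stops
  earlier, when few bad indices are left.\<close>

lemma greedy_selection:
  fixes u :: "nat \<Rightarrow> 'a::euclidean_space"
  assumes "finite V" "0 < N" "0 \<le> c"
    and Q: "Q \<le> (\<integral>t. exp (- c * (\<Sum>i\<in>V. 1 - cos (pairing t (u i)))) \<partial>gauss)"
  shows "\<exists>ws. set ws \<subseteq> V \<and> (\<forall>j<length ws. Bad (take j ws) (ws ! j)) \<and> Q \<le> conc (c * real N) u ws \<and>
    (length ws = S \<or> length ws < S \<and> card {i \<in> V. Bad ws i} \<le> (length ws + 1) * N)"
proof -
  define G where "G ws W = (\<integral>t. (\<Prod>j<length ws. exp (- (c * real N) * (1 - cos (pairing t (u (ws ! j)))))) *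
      (\<Prod>i\<in>W. exp (- c * (1 - cos (pairing t (u i))))) \<partial>gauss)" for ws W
  have "\<exists>ws X. set ws \<subseteq> V \<and> X \<subseteq> V \<and> card X \<le> length ws * N \<and>
     (\<forall>j<length ws. Bad (take j ws) (ws ! j)) \<and> Q \<le> G ws (V - X) \<and>
    (length ws = S \<or> length ws < S \<and> card {i \<in> V. Bad ws i} \<le> (length ws + 1) * N)"
  proof (induction S)
    case 0
    show ?case
      using Q assms by (intro exI [of _ "[]"] exI [of _ "{}"])
        (auto simp: G_def sum_distrib_left exp_sum [symmetric])
  next
    case (Suc S)
    then obtain ws X where ws: "set ws \<subseteq> V" "X \<subseteq> V" "card X \<le> length ws * N"
      "\<forall>j<length ws. Bad (take j ws) (ws ! j)" "Q \<le> G ws (V - X)"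
      and alt: "length ws = S \<or> length ws < S \<and> card {i \<in> V. Bad ws i} \<le> (length ws + 1) * N"
      by blast
    show ?case
    proof (cases "card {i \<in> V. Bad ws i} \<le> (length ws + 1) * N")
      case True
      then show ?thesis
        using ws alt by (intro exI [of _ ws] exI [of _ X]) auto
    next
      case False
      then have len: "length ws = S" using alt by auto
      let ?B = "{i \<in> V. Bad ws i} - X"
      \<comment> \<open>The blocks in \<open>X\<close> cover at most \<open>length ws * N\<close>
        indices, so more than \<open>(length ws + 1) * N\<close> bad indices leave a full fresh
        block.\<close>
      have "card {i \<in> V. Bad ws i} - card X \<le> card ?B"
        by (rule diff_card_le_card_Diff) (use assms ws finite_subset in auto)
      then have "N \<le> card ?B"
        using False ws by simp
      then obtain J where J: "J \<subseteq> ?B" "card J = N" "finite J"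
        by (rule obtain_subset_with_card_n)
      have "\<exists>i\<in>J. Q \<le> G (ws @ [i]) (V - X - J)"
        unfolding G_def by (rule greedy_step) (use ws J assms in \<open>auto simp: G_def\<close>)
      then obtain i where i: "i \<in> J" "Q \<le> G (ws @ [i]) (V - X - J)"
        by blast
      have "card (X \<union> J) \<le> card X + card J"
        by (rule card_Un_le)
      moreover have "V - X - J = V - (X \<union> J)" by auto
      ultimately show ?thesis
        using i J ws len
        by (intro exI [of _ "ws @ [i]"] exI [of _ "X \<union> J"])
          (auto simp: nth_append less_Suc_eq)
    qed
  qed
  then obtain ws X where ws: "set ws \<subseteq> V" "\<forall>j<length ws. Bad (take j ws) (ws ! j)" "Q \<le> G ws (V - X)"
      "length ws = S \<or> length ws < S \<and> card {i \<in> V. Bad ws i} \<le> (length ws + 1) * N"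
    by blast
  have "G ws (V - X) \<le> conc (c * real N) u ws"
    unfolding G_def conc_def
  proof (rule integral_mono)
    show "integrable gauss (\<lambda>t. \<Prod>j<length ws. exp (- (c * real N) * (1 - cos (pairing t (u (ws ! j))))))"
      using integrable_prod_exp_energy [where L = "c * real N" and c = c and s = "length ws"
          and w = "\<lambda>j. u (ws ! j)" and W = "{}"] assms by simp
    show "(\<Prod>j<length ws. exp (- (c * real N) * (1 - cos (pairing t (u (ws ! j)))))) *
        (\<Prod>i\<in>V - X. exp (- c * (1 - cos (pairing t (u i)))))
      \<le> (\<Prod>j<length ws. exp (- (c * real N) * (1 - cos (pairing t (u (ws ! j))))))" for t
      by (intro mult_right_le_one_le prod_nonneg prod_le_1) (use assms in auto)
  qed (rule integrable_prod_exp_energy, use assms in auto)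
  with ws show ?thesis
    by (intro exI [of _ ws]) auto
qed

lemma conc_take:
  assumes "0 \<le> L" "j \<le> length ws"
  shows "conc L u ws \<le> conc L u (take j ws)"
  unfolding conc_def
proof (rule integral_mono)
  have int: "integrable gauss (\<lambda>t. \<Prod>j<length ws. exp (- L * (1 - cos (pairing t (u (ws ! j))))))" for ws
    using integrable_prod_exp_energy [where L = L and c = L and s = "length ws" and w = "\<lambda>j. u (ws ! j)" and W = "{}"] assms by simp
  show "integrable gauss (\<lambda>t. \<Prod>j<length ws. exp (- L * (1 - cos (pairing t (u (ws ! j))))))"
    and "integrable gauss (\<lambda>t. \<Prod>ja<length (take j ws). exp (- L * (1 - cos (pairing t (u (take j ws ! ja))))))"
    by (rule int)+
  fix t
  let ?f = "\<lambda>j. exp (- L * (1 - cos (pairing t (u (ws ! j)))))"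
  have "(\<Prod>j<length ws. ?f j) = (\<Prod>j\<in>{..<length ws} - {..<j}. ?f j) * (\<Prod>j<j. ?f j)"
    by (rule prod.subset_diff) (use assms in auto)
  also have "\<dots> \<le> (\<Prod>j<j. ?f j)"
    by (intro mult_left_le_one_le prod_nonneg prod_le_1) (use assms in auto)
  finally show "(\<Prod>j<length ws. ?f j) \<le> (\<Prod>ja<length (take j ws). exp (- L * (1 - cos (pairing t (u (take j ws ! ja))))))"
    using assms by (simp add: min_absorb2)
qed

section \<open>Majorization by the Fejer kernel\<close>

text \<open>If \<open>1 - cos \<theta>\<close> is at most \<open>1 / (8 k^2)\<close>, then
  \<open>iexp \<theta>\<close> is within \<open>1 / (2 k)\<close> of 1, so all \<open>k\<close>
  summands are within 1/2 of 1 and the kernel is at least 1/4; the factor 4 lifts it to 1. Otherwise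
  the exponential itself is below the error term.\<close>

lemma exp_energy_le_Fejer:
  fixes \<theta> L :: real
  assumes "0 < k" "0 \<le> L"
  shows "exp (- L * (1 - cos \<theta>)) \<le> 4 * (cmod (\<Sum>j<k. iexp (real j * \<theta>)) / real k)\<^sup>2 + exp (- L / (8 * (real k)\<^sup>2))"
proof (cases "1 - cos \<theta> \<le> 1 / (8 * (real k)\<^sup>2)")
  case True
  define \<delta> where "\<delta> = cmod (iexp \<theta> - 1)"
  have "\<delta>\<^sup>2 = (cos \<theta> - 1)\<^sup>2 + (sin \<theta>)\<^sup>2"
    by (simp add: \<delta>_def cmod_power2 Re_exp Im_exp)
  also have "\<dots> = 2 * (1 - cos \<theta>)"
    using sin_cos_squared_add [of \<theta>] by (simp add: power2_eq_square algebra_simps)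
  also have "\<dots> \<le> (1 / (2 * real k))\<^sup>2"
    using True by (simp add: power2_eq_square field_simps)
  finally have \<delta>: "\<delta> \<le> 1 / (2 * real k)"
    by (rule power2_le_imp_le) simp
  have step: "cmod (iexp (real j * \<theta>) - 1) \<le> real j * \<delta>" for j
  proof (induction j)
    case (Suc j)
    have "iexp (real (Suc j) * \<theta>) - 1 = iexp (real j * \<theta>) * (iexp \<theta> - 1) + (iexp (real j * \<theta>) - 1)"
      by (simp add: algebra_simps exp_add)
    then have "cmod (iexp (real (Suc j) * \<theta>) - 1) \<le> cmod (iexp (real j * \<theta>) * (iexp \<theta> - 1)) + cmod (iexp (real j * \<theta>) - 1)"
      by (metis norm_triangle_ineq)
    also have "cmod (iexp (real j * \<theta>) * (iexp \<theta> - 1)) = \<delta>"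
      by (simp add: norm_mult \<delta>_def)
    finally show ?case
      using Suc by (simp add: algebra_simps)
  qed simp
  have "cmod ((\<Sum>j<k. iexp (real j * \<theta>)) - of_nat k) = cmod (\<Sum>j<k. iexp (real j * \<theta>) - 1)"
    by (simp add: sum_subtractf)
  also have "\<dots> \<le> (\<Sum>j<k. 1 / 2)"
  proof (rule sum_norm_le)
    fix j assume "j \<in> {..<k}"
    then have "real j * \<delta> \<le> real k * (1 / (2 * real k))"
      using \<delta> by (intro mult_mono) (auto simp: \<delta>_def)
    then show "cmod (iexp (real j * \<theta>) - 1) \<le> 1 / 2"
      using step [of j] assms by simp
  qed
  finally have "real k / 2 \<le> cmod (\<Sum>j<k. iexp (real j * \<theta>))"
    using norm_triangle_ineq2 [of "of_nat k" "\<Sum>j<k. iexp (real j * \<theta>)"] by (simp add: norm_minus_commute)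
  then have "1 / 2 \<le> cmod (\<Sum>j<k. iexp (real j * \<theta>)) / real k"
    using assms by (simp add: field_simps)
  then have "(1 / 2)\<^sup>2 \<le> (cmod (\<Sum>j<k. iexp (real j * \<theta>)) / real k)\<^sup>2"
    by (rule power_mono) simp
  moreover have "exp (- L * (1 - cos \<theta>)) \<le> 1"
    using assms exp_energy_bounds by blast
  moreover have "0 \<le> exp (- L / (8 * (real k)\<^sup>2))" by simp
  moreover have "(1 / 2 :: real)\<^sup>2 = 1 / 4" by (simp add: power2_eq_square)
  ultimately show ?thesis by linarith
next
  case False
  then have "L * (1 / (8 * (real k)\<^sup>2)) \<le> L * (1 - cos \<theta>)"
    using assms by (intro mult_left_mono) auto
  then have "exp (- L * (1 - cos \<theta>)) \<le> exp (- L / (8 * (real k)\<^sup>2))"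
    by simp
  then show ?thesis
    by (simp add: add_increasing)
qed

text \<open>A new error \<open>e\<close> is multiplied by a product of earlier \<open>a j\<close>,
  at most a power of \<open>C\<close>, while the old error does not grow because \<open>b s\<close>
  is at most 1.\<close>

lemma prod_le_prod_add_error:
  fixes a b :: "nat \<Rightarrow> real"
  assumes "\<And>j. 0 \<le> b j" "\<And>j. b j \<le> 1" "\<And>j. 0 \<le> a j" "\<And>j. a j \<le> C" "\<And>j. b j \<le> a j + e" "1 \<le> C" "0 \<le> e"
  shows "(\<Prod>j<s. b j) \<le> (\<Prod>j<s. a j) + real s * e * C ^ s"
proof (induction s)
  case (Suc s)
  have P: "0 \<le> (\<Prod>j<s. a j)" "(\<Prod>j<s. a j) \<le> C ^ s"
    using assms prod_mono [of "{..<s}" a "\<lambda>_. C"] by (auto intro!: prod_nonneg)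
  have "(\<Prod>j<Suc s. b j) \<le> ((\<Prod>j<s. a j) + real s * e * C ^ s) * b s"
    using Suc assms by (simp add: mult_right_mono)
  also have "\<dots> \<le> (\<Prod>j<s. a j) * (a s + e) + real s * e * C ^ s * 1"
    unfolding distrib_right using assms P by (intro add_mono mult_left_mono) auto
  also have "\<dots> \<le> (\<Prod>j<Suc s. a j) + (C ^ s * e + real s * e * C ^ s)"
    using P assms by (simp add: distrib_left mult_right_mono)
  also have "C ^ s * e + real s * e * C ^ s = real (Suc s) * e * C ^ s"
    by (simp add: algebra_simps)
  also have "\<dots> \<le> real (Suc s) * e * C ^ Suc s"
    using assms by (intro mult_left_mono power_increasing) auto
  finally show ?case by simp
qed simp

section \<open>Walks ending in a ball\<close>

definition walk :: "(nat \<Rightarrow> 'a::real_vector) \<Rightarrow> nat \<Rightarrow> (nat \<Rightarrow> nat) \<Rightarrow> 'a" where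
  "walk w s U = (\<Sum>j<s. real (U j) *\<^sub>R w j)"

abbreviation grid :: "nat \<Rightarrow> nat \<Rightarrow> (nat \<Rightarrow> nat) set" where
  "grid s k \<equiv> PiE {..<s} (\<lambda>_. {..<k})"

lemma cmod_sum_iexp_power2:
  "(cmod (\<Sum>U\<in>A. iexp (a U)))\<^sup>2 = (\<Sum>U\<in>A. \<Sum>V\<in>A. cos (a U - a V))"
  unfolding cmod_power2 by (simp add: Re_exp Im_exp power2_eq_square sum_product cos_diff sum.distrib)

lemma finite_grid [simp]: "finite (grid s k)"
  by (intro finite_PiE) auto

text \<open>Expanding the product gives an exponential sum over walks. Its squared modulus is a sum
  over pairs of walks, and Gaussian integration turns each pair into a weight depending on the
  distance of the endpoints.\<close>

lemma integral_prod_Fejer: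
  fixes w :: "nat \<Rightarrow> 'a::euclidean_space"
  shows "(\<integral>t. (\<Prod>j<s. (cmod (\<Sum>i<k. iexp (real i * pairing t (w j))) / real k)\<^sup>2) \<partial>gauss)
    = (\<Sum>U\<in>grid s k. \<Sum>V\<in>grid s k. exp (- (norm (walk w s U - walk w s V))\<^sup>2 / 2)) / (real k ^ s)\<^sup>2"
proof -
  have "(\<Prod>j<s. (cmod (\<Sum>i<k. iexp (real i * pairing t (w j))) / real k)\<^sup>2)
      = (\<Sum>U\<in>grid s k. \<Sum>V\<in>grid s k. cos (pairing t (walk w s U - walk w s V))) / (real k ^ s)\<^sup>2" for t
  proof -
    have "(\<Prod>j<s. (\<Sum>i<k. iexp (real i * pairing t (w j)))) = (\<Sum>U\<in>grid s k. \<Prod>j<s. iexp (real (U j) * pairing t (w j)))"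
      by (rule prod_sum_PiE) auto
    also have "\<dots> = (\<Sum>U\<in>grid s k. iexp (pairing t (walk w s U)))"
      by (simp add: walk_def pairing_sum pairing_scaleR exp_sum [symmetric] sum_distrib_left)
    finally have eq: "(\<Prod>j<s. (\<Sum>i<k. iexp (real i * pairing t (w j)))) = \<dots>" .
    have "(\<Prod>j<s. (cmod (\<Sum>i<k. iexp (real i * pairing t (w j))) / real k)\<^sup>2)
      = ((\<Prod>j<s. cmod (\<Sum>i<k. iexp (real i * pairing t (w j)))) / real k ^ s)\<^sup>2"
      by (simp only: prod_power_distrib [symmetric] prod_dividef prod_constant card_lessThan)
    also have "(\<Prod>j<s. cmod (\<Sum>i<k. iexp (real i * pairing t (w j))))
      = cmod (\<Sum>U\<in>grid s k. iexp (pairing t (walk w s U)))"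
      unfolding eq [symmetric] by (simp only: prod_norm)
    finally show ?thesis
      by (simp only: power_divide cmod_sum_iexp_power2 pairing_diff)
  qed
  moreover have int: "integrable gauss (\<lambda>t. cos (pairing t w))" for w :: 'a
    by (rule gauss.integrable_const_bound [where B = 1]) auto
  ultimately show ?thesis
    by (simp add: integral_gauss_cos Bochner_Integration.integral_sum)
qed

text \<open>Pairs of walks whose endpoints are further apart than \<open>R\<close> weigh at most
  \<open>exp (- R^2 / 2)\<close> each, so if every ball around an endpoint held few walks, the
  double sum of \<open>integral_prod_Fejer\<close> would be too small. The hypothesis on the error
  term lets the majorization cost at most half of \<open>Q\<close>; the power of 4 comes from the
  factor 4 in the majorant.\<close>

lemma card_walk_ball_ge:
  fixes w :: "nat \<Rightarrow> 'a::euclidean_space"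
  assumes "0 < k" "0 \<le> L" "0 \<le> R"
    and Q: "Q \<le> (\<integral>t. (\<Prod>j<s. exp (- L * (1 - cos (pairing t (w j))))) \<partial>gauss)"
    and err: "real s * exp (- L / (8 * (real k)\<^sup>2)) * 4 ^ s \<le> Q / 2"
  shows "\<exists>z. real k ^ s * (Q / (2 * 4 ^ s) - exp (- R\<^sup>2 / 2)) \<le> real (card {U \<in> grid s k. norm (walk w s U - z) \<le> R})"
proof -
  define F where "F t j = (cmod (\<Sum>i<k. iexp (real i * pairing t (w j))) / real k)\<^sup>2" for t j
  define e where "e = exp (- L / (8 * (real k)\<^sup>2))"
  have F: "0 \<le> F t j" "F t j \<le> 1" for t j
  proof -
    have "cmod (\<Sum>i<k. iexp (real i * pairing t (w j))) \<le> (\<Sum>i<k. 1)"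
      by (rule sum_norm_le) simp
    then have "cmod (\<Sum>i<k. iexp (real i * pairing t (w j))) / real k \<le> 1"
      using assms by simp
    then show "F t j \<le> 1"
      unfolding F_def by (intro power_le_one) auto
  qed (simp add: F_def)
  have [measurable]: "(\<lambda>t. F t j) \<in> borel_measurable gauss" for j
    unfolding F_def by measurable
  have intF: "integrable gauss (\<lambda>t. \<Prod>j<s. F t j)"
    by (rule gauss.integrable_const_bound [where B = 1])
      (use F in \<open>auto intro!: AE_I2 prod_le_1 simp: abs_prod\<close>)
  have intE: "integrable gauss (\<lambda>t. \<Prod>j<s. exp (- L * (1 - cos (pairing t (w j)))))"
    using integrable_prod_exp_energy [where L = L and c = L and W = "{}"] assms by simp
  have intF': "integrable gauss (\<lambda>t. 4 ^ s * (\<Prod>j<s. F t j) + real s * e * 4 ^ s)"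
    using intF by simp
  have "Q \<le> (\<integral>t. (\<Prod>j<s. exp (- L * (1 - cos (pairing t (w j))))) \<partial>gauss)"
    by (rule Q)
  also have "\<dots> \<le> (\<integral>t. 4 ^ s * (\<Prod>j<s. F t j) + real s * e * 4 ^ s \<partial>gauss)"
  proof (rule integral_mono [OF intE intF'])
    show "(\<Prod>j<s. exp (- L * (1 - cos (pairing t (w j))))) \<le> 4 ^ s * (\<Prod>j<s. F t j) + real s * e * 4 ^ s" for t
    proof -
      have "(\<Prod>j<s. exp (- L * (1 - cos (pairing t (w j))))) \<le> (\<Prod>j<s. 4 * F t j) + real s * e * 4 ^ s"
      proof (rule prod_le_prod_add_error)
        show "exp (- L * (1 - cos (pairing t (w j)))) \<le> 4 * F t j + e" for j
          unfolding F_def e_def by (rule exp_energy_le_Fejer) fact+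
      qed (use F exp_energy_bounds [OF \<open>0 \<le> L\<close>] in \<open>auto simp: e_def\<close>)
      then show ?thesis
        by (simp add: prod.distrib)
    qed
  qed
  also have "\<dots> = 4 ^ s * (\<integral>t. (\<Prod>j<s. F t j) \<partial>gauss) + real s * e * 4 ^ s"
    using intF by (simp add: gauss.prob_space)
  finally have "Q / 2 \<le> 4 ^ s * (\<integral>t. (\<Prod>j<s. F t j) \<partial>gauss)"
    using err by (simp add: e_def)
  then have lower: "Q / (2 * 4 ^ s) \<le> (\<integral>t. (\<Prod>j<s. F t j) \<partial>gauss)"
    by (simp add: field_simps)
  define N where "N z = real (card {U \<in> grid s k. norm (walk w s U - z) \<le> R})" for z
  have inner: "(\<Sum>V\<in>grid s k. exp (- (norm (walk w s V - walk w s U))\<^sup>2 / 2)) \<le> N (walk w s U) + real k ^ s * exp (- R\<^sup>2 / 2)" for U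
  proof -
    have "exp (- (norm (walk w s V - walk w s U))\<^sup>2 / 2) \<le>
        (if norm (walk w s V - walk w s U) \<le> R then 1 else 0) + exp (- R\<^sup>2 / 2)" for V
    proof (cases "norm (walk w s V - walk w s U) \<le> R")
      case False
      have "R\<^sup>2 \<le> (norm (walk w s V - walk w s U))\<^sup>2"
        using False \<open>0 \<le> R\<close> by (intro power_mono) auto
      with False show ?thesis by simp
    qed (simp add: add_increasing2)
    then have "(\<Sum>V\<in>grid s k. exp (- (norm (walk w s V - walk w s U))\<^sup>2 / 2)) \<le>
      (\<Sum>V\<in>grid s k. (if norm (walk w s V - walk w s U) \<le> R then 1 else 0) + exp (- R\<^sup>2 / 2))"
      by (rule sum_mono)
    also have "\<dots> = N (walk w s U) + real k ^ s * exp (- R\<^sup>2 / 2)"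
      by (simp add: sum.distrib N_def card_PiE sum.If_cases Int_def)
    finally show ?thesis .
  qed
  show ?thesis
  proof (rule ccontr)
    assume "\<not> ?thesis"
    then have less: "N z < real k ^ s * (Q / (2 * 4 ^ s) - exp (- R\<^sup>2 / 2))" for z
      by (auto simp: N_def not_le)
    have ne: "grid s k \<noteq> {}"
      using assms by (simp add: PiE_eq_empty_iff lessThan_empty_iff)
    have "(\<Sum>U\<in>grid s k. \<Sum>V\<in>grid s k. exp (- (norm (walk w s V - walk w s U))\<^sup>2 / 2))
      < (\<Sum>U\<in>grid s k. real k ^ s * (Q / (2 * 4 ^ s)))"
    proof (rule sum_strict_mono)
      show "(\<Sum>V\<in>grid s k. exp (- (norm (walk w s V - walk w s U))\<^sup>2 / 2)) < real k ^ s * (Q / (2 * 4 ^ s))" for U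
        using inner [of U] less [of "walk w s U"] by (simp add: right_diff_distrib)
    qed (use ne in auto)
    also have "\<dots> = (real k ^ s)\<^sup>2 * (Q / (2 * 4 ^ s))"
      by (simp add: card_PiE power2_eq_square)
    finally have "(\<integral>t. (\<Prod>j<s. F t j) \<partial>gauss) < Q / (2 * 4 ^ s)"
      using \<open>0 < k\<close> unfolding F_def integral_prod_Fejer
      by (simp add: divide_less_eq mult.commute norm_minus_commute)
    with lower show False by simp
  qed
qed

text \<open>Division by \<open>m\<close> is injective on a set with gaps at least
  \<open>m\<close>.\<close>

lemma card_spaced_le:
  fixes P :: "nat set"
  assumes "P \<subseteq> {..<k}" "0 < m" and sp: "\<And>x y. x \<in> P \<Longrightarrow> y \<in> P \<Longrightarrow> x < y \<Longrightarrow> m \<le> y - x"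
  shows "real (card P) \<le> real k / real m + 1"
proof -
  have "inj_on (\<lambda>x. x div m) P"
  proof (rule linorder_inj_onI)
    fix x y assume "x < y" "x \<in> P" "y \<in> P"
    then have "x + m \<le> y" using sp [of x y] by simp
    then have "(x + m) div m \<le> y div m" by (rule div_le_mono)
    then show "x div m \<noteq> y div m" using \<open>0 < m\<close> by simp
  qed auto
  moreover have "(\<lambda>x. x div m) ` P \<subseteq> {..k div m}"
    using assms by (auto intro!: div_le_mono)
  ultimately have "card P \<le> card {..k div m}"
    by (intro card_inj_on_le) auto
  then have "real (card P) \<le> real (k div m) + 1"
    by simp
  also have "real (k div m) \<le> real k / real m"
    by (rule of_nat_div_le_of_nat)
  finally show ?thesis by simp
qed

text \<open>Induction on the number of steps. Endpoints in one ball differ by at most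
  \<open>2 * R\<close>, so the last coordinates that occur are spaced by \<open>m s\<close>; fixing
  the last coordinate leaves shorter walks that end in a translated ball, hence the arbitrary centre
  \<open>z\<close>.\<close>

lemma card_walk_ball_le:
  fixes w :: "nat \<Rightarrow> 'a::real_normed_vector"
  assumes "\<And>j. j < s \<Longrightarrow> 0 < m j"
    and "\<And>j U V. j < s \<Longrightarrow> U \<in> grid (Suc j) k \<Longrightarrow> V \<in> grid (Suc j) k \<Longrightarrow>
      norm (walk w (Suc j) U - walk w (Suc j) V) \<le> 2 * R \<Longrightarrow> V j < U j \<Longrightarrow> m j \<le> U j - V j"
  shows "real (card {U \<in> grid s k. norm (walk w s U - z) \<le> R}) \<le> (\<Prod>j<s. real k / real (m j) + 1)"
  using assms
proof (induction s arbitrary: z)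
  case 0
  have "card {U \<in> grid 0 k. norm (walk w 0 U - z) \<le> R} \<le> card (grid 0 k)"
    by (intro card_mono) auto
  then show ?case by simp
next
  case (Suc s)
  let ?A = "{U \<in> grid (Suc s) k. norm (walk w (Suc s) U - z) \<le> R}"
  define P where "P = (\<lambda>U. U s) ` ?A"
  define B where "B = (\<Prod>j<s. real k / real (m j) + 1)"
  have [simp]: "finite ?A" by simp
  have P: "real (card P) \<le> real k / real (m s) + 1"
  proof (rule card_spaced_le)
    fix x y assume "x \<in> P" "y \<in> P" "x < y"
    then obtain U V where UV: "U \<in> ?A" "V \<in> ?A" "x = U s" "y = V s"
      by (auto simp: P_def)
    have "norm (walk w (Suc s) V - walk w (Suc s) U) \<le> 2 * R"
      using UV norm_triangle_ineq4 [of "walk w (Suc s) V - z" "walk w (Suc s) U - z"] by auto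
    then show "m s \<le> y - x"
      using Suc.prems(2) [of s V U] UV \<open>x < y\<close> by auto
  qed (use Suc.prems in \<open>auto simp: P_def PiE_iff\<close>)
  have fibre: "real (card {U \<in> ?A. U s = p}) \<le> B" for p
  proof -
    have "inj_on (\<lambda>U. restrict U {..<s}) {U \<in> ?A. U s = p}"
    proof (rule inj_onI, rule ext)
      fix U V i assume UV: "U \<in> {U \<in> ?A. U s = p}" "V \<in> {U \<in> ?A. U s = p}"
        and eq: "restrict U {..<s} = restrict V {..<s}"
      consider "i < s" | "i = s" | "i > s" by linarith
      then show "U i = V i"
      proof cases
        case 1 then show ?thesis using fun_cong [OF eq, of i] by simp
      next
        case 3 then show ?thesis using UV by (auto simp: PiE_iff extensional_def)
      qed (use UV in auto)
    qed
    moreover have "(\<lambda>U. restrict U {..<s}) ` {U \<in> ?A. U s = p}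
      \<subseteq> {U \<in> grid s k. norm (walk w s U - (z - real p *\<^sub>R w s)) \<le> R}"
      by (auto simp: walk_def PiE_iff algebra_simps)
    ultimately have "card {U \<in> ?A. U s = p} \<le> card {U \<in> grid s k. norm (walk w s U - (z - real p *\<^sub>R w s)) \<le> R}"
      by (intro card_inj_on_le [where f = "\<lambda>U. restrict U {..<s}"]) auto
    also have "real \<dots> \<le> B"
      unfolding B_def by (rule Suc.IH) (use Suc.prems in auto)
    finally show ?thesis by simp
  qed
  have "?A = (\<Union>p\<in>P. {U \<in> ?A. U s = p})"
    by (auto simp: P_def)
  then have "card ?A \<le> (\<Sum>p\<in>P. card {U \<in> ?A. U s = p})"
    using card_UN_le [of P "\<lambda>p. {U \<in> ?A. U s = p}"] by (simp add: P_def)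
  then have "real (card ?A) \<le> real (\<Sum>p\<in>P. card {U \<in> ?A. U s = p})"
    by (simp only: of_nat_le_iff)
  also have "\<dots> = (\<Sum>p\<in>P. real (card {U \<in> ?A. U s = p}))"
    by (rule of_nat_sum)
  also have "\<dots> \<le> (\<Sum>p\<in>P. B)"
    by (intro sum_mono fibre)
  also have "\<dots> \<le> (real k / real (m s) + 1) * B"
    using P by (simp add: B_def mult_right_mono prod_nonneg)
  finally show ?case
    by (simp add: B_def mult.commute)
qed

section \<open>Integer dependence at a scale\<close>

text \<open>One number bounds the multiplier, the coefficients and the error, so that with scales
  that are powers of \<open>n\<close> only exponents have to be compared.\<close>

definition dependent_at :: "(nat \<Rightarrow> 'a::real_normed_vector) \<Rightarrow> nat set \<Rightarrow> nat \<Rightarrow> nat \<Rightarrow> bool" where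
  "dependent_at u T H i \<longleftrightarrow> (\<exists>(a::int) (b::nat \<Rightarrow> int). a \<noteq> 0 \<and> \<bar>a\<bar> \<le> int H \<and> (\<forall>t\<in>T. \<bar>b t\<bar> \<le> int H) \<and>
     norm (of_int a *\<^sub>R u i - (\<Sum>t\<in>T. of_int (b t) *\<^sub>R u t)) \<le> real H)"

text \<open>This concerns relations within \<open>T\<close> itself. It turns an approximate relation
  with short integer coefficients into the exact vanishing of all coefficients, after which
  divisibility can be used.\<close>

definition independent_at :: "(nat \<Rightarrow> 'a::real_normed_vector) \<Rightarrow> nat set \<Rightarrow> nat \<Rightarrow> bool" where
  "independent_at u T H \<longleftrightarrow> (\<forall>b::nat \<Rightarrow> int. (\<forall>t\<in>T. \<bar>b t\<bar> \<le> int H) \<longrightarrow>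
     norm (\<Sum>t\<in>T. of_int (b t) *\<^sub>R u t) \<le> real H \<longrightarrow> (\<forall>t\<in>T. b t = 0))"

lemma dependent_at_mono:
  assumes "dependent_at u T H i" "H \<le> H'"
  shows "dependent_at u T H' i"
proof -
  have "int H \<le> int H'" "real H \<le> real H'" using assms by auto
  then show ?thesis
    using assms(1) unfolding dependent_at_def by (meson order_trans)
qed

text \<open>Consequently a run that selects indices independent of the earlier ones never repeats an
  index.\<close>

lemma dependent_at_member:
  assumes "finite T" "i \<in> T" "1 \<le> H"
  shows "dependent_at u T H i"
  unfolding dependent_at_def
proof (intro exI conjI ballI)
  let ?b = "\<lambda>t. if t = i then 1 else 0 :: int"
  have "(\<Sum>t\<in>T. of_int (?b t) *\<^sub>R u t) = (\<Sum>t\<in>T. if t = i then u t else 0)"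
    by (rule sum.cong) auto
  then show "norm (of_int 1 *\<^sub>R u i - (\<Sum>t\<in>T. of_int (?b t) *\<^sub>R u t)) \<le> real H"
    using assms by simp
qed (use assms in auto)

lemma abs_diff_mult_le:
  fixes x y p q :: int
  assumes "\<bar>x\<bar> \<le> A" "\<bar>y\<bar> \<le> A" "\<bar>p\<bar> \<le> B" "\<bar>q\<bar> \<le> B"
  shows "\<bar>x * p - q * y\<bar> \<le> 2 * A * B"
proof -
  have "\<bar>x * p - q * y\<bar> \<le> \<bar>x\<bar> * \<bar>p\<bar> + \<bar>q\<bar> * \<bar>y\<bar>"
    by (simp add: abs_mult [symmetric] abs_triangle_ineq4)
  also have "\<dots> \<le> A * B + B * A"
    using assms by (intro add_mono mult_mono) auto
  finally show ?thesis by simp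
qed

text \<open>Cross-multiplication: \<open>c x\<close> times the relation for \<open>u i\<close> and
  \<open>b x\<close> times the relation \<open>c\<close> combine so that \<open>u x\<close> cancels.
  The new multiplier \<open>c x * a\<close> is nonzero.\<close>

lemma dependent_at_eliminate:
  assumes "finite T" "x \<in> T" and dep: "dependent_at u T H i"
    and c: "\<forall>t\<in>T. \<bar>c t\<bar> \<le> int H1" "norm (\<Sum>t\<in>T. of_int (c t) *\<^sub>R u t) \<le> real H1" "c x \<noteq> 0"
  shows "dependent_at u (T - {x}) (2 * H * H1) i"
proof -
  obtain a b where ab: "a \<noteq> 0" "\<bar>a\<bar> \<le> int H" "\<forall>t\<in>T. \<bar>b t\<bar> \<le> int H"
     "norm (of_int a *\<^sub>R u i - (\<Sum>t\<in>T. of_int (b t) *\<^sub>R u t)) \<le> real H"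
    using dep unfolding dependent_at_def by blast
  let ?d = "\<lambda>t. c x * b t - b x * c t"
  have "(\<Sum>t\<in>T. of_int (?d t) *\<^sub>R u t) = of_int (?d x) *\<^sub>R u x + (\<Sum>t\<in>T - {x}. of_int (?d t) *\<^sub>R u t)"
    by (rule sum.remove) (use assms in auto)
  then have drop: "(\<Sum>t\<in>T - {x}. of_int (?d t) *\<^sub>R u t) = (\<Sum>t\<in>T. of_int (?d t) *\<^sub>R u t)"
    by simp
  have eq: "of_int (c x * a) *\<^sub>R u i - (\<Sum>t\<in>T - {x}. of_int (?d t) *\<^sub>R u t) =
    of_int (c x) *\<^sub>R (of_int a *\<^sub>R u i - (\<Sum>t\<in>T. of_int (b t) *\<^sub>R u t)) + of_int (b x) *\<^sub>R (\<Sum>t\<in>T. of_int (c t) *\<^sub>R u t)"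
    unfolding drop by (simp add: algebra_simps scaleR_sum_right sum_subtractf)
  have cx: "\<bar>real_of_int (c x)\<bar> \<le> real H1" "\<bar>real_of_int (b x)\<bar> \<le> real H"
    using c ab \<open>x \<in> T\<close> by (metis of_int_abs of_int_le_iff of_int_of_nat_eq)+
  have "norm (of_int (c x * a) *\<^sub>R u i - (\<Sum>t\<in>T - {x}. of_int (?d t) *\<^sub>R u t)) \<le>
     \<bar>of_int (c x)\<bar> * norm (of_int a *\<^sub>R u i - (\<Sum>t\<in>T. of_int (b t) *\<^sub>R u t)) + \<bar>of_int (b x)\<bar> * norm (\<Sum>t\<in>T. of_int (c t) *\<^sub>R u t)"
    unfolding eq by (rule order_trans [OF norm_triangle_ineq]) simp
  also have "\<dots> \<le> real H1 * real H + real H * real H1"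
    using cx ab c by (intro add_mono mult_mono) auto
  finally have n: "norm (of_int (c x * a) *\<^sub>R u i - (\<Sum>t\<in>T - {x}. of_int (?d t) *\<^sub>R u t)) \<le> real (2 * H * H1)"
    by simp
  have "\<bar>c x * a\<bar> \<le> int H1 * int H"
    unfolding abs_mult using ab c \<open>x \<in> T\<close> by (intro mult_mono) auto
  also have "\<dots> \<le> int (2 * H * H1)"
    by simp
  finally have 1: "\<bar>c x * a\<bar> \<le> int (2 * H * H1)" .
  have 2: "\<bar>?d t\<bar> \<le> int (2 * H * H1)" if "t \<in> T - {x}" for t
    using abs_diff_mult_le [of "c x" "int H1" "c t" "b t" "int H" "b x"] ab c that \<open>x \<in> T\<close> by (simp add: mult_ac)
  show ?thesis
    unfolding dependent_at_def using n 1 2 ab(1) c(3)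
    by (intro exI [of _ "c x * a"] exI [of _ ?d]) auto
qed

text \<open>Either \<open>T\<close> is independent at the larger scale, or a relation eliminates one
  generator at the price of multiplying the exponent by \<open>3 * K\<close>. This ends after at
  most \<open>card T\<close> eliminations, since the empty set is independent at every
  scale.\<close>

lemma rank_reduction:
  assumes "finite T" "2 \<le> n" "1 \<le> K" "1 \<le> e" "\<forall>i\<in>G. dependent_at u T (n ^ e) i"
  shows "\<exists>T' e'. T' \<subseteq> T \<and> e \<le> e' \<and> e' \<le> (3 * K) ^ card T * e \<and>
    (\<forall>i\<in>G. dependent_at u T' (n ^ e') i) \<and> independent_at u T' (n ^ (K * e'))"
  using assms
proof (induction "card T" arbitrary: T e)
  case 0
  then have "independent_at u T (n ^ (K * e))"
    by (auto simp: independent_at_def)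
  then show ?case
    using 0 by (intro exI [of _ T] exI [of _ e]) auto
next
  case (Suc N)
  show ?case
  proof (cases "independent_at u T (n ^ (K * e))")
    case True
    have "e \<le> (3 * K) ^ card T * e"
      using Suc.prems by simp
    then show ?thesis
      using True Suc.prems by (intro exI [of _ T] exI [of _ e]) auto
  next
    case False
    then obtain c x where c: "\<forall>t\<in>T. \<bar>c t\<bar> \<le> int (n ^ (K * e))"
      "norm (\<Sum>t\<in>T. of_int (c t) *\<^sub>R u t) \<le> real (n ^ (K * e))" and x: "x \<in> T" "c x \<noteq> 0"
      unfolding independent_at_def by blast
    define e1 where "e1 = 3 * K * e"
    \<comment> \<open>The factor 2 is absorbed by one power of \<open>n\<close>; since
      \<open>K\<close> and \<open>e\<close> are at least 1, the three exponents 1, \<open>e\<close>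
      and \<open>K * e\<close> are each at most \<open>K * e\<close>.\<close>
    have "2 * n ^ e * n ^ (K * e) \<le> n ^ 1 * n ^ e * n ^ (K * e)"
      using Suc.prems by (intro mult_le_mono) auto
    also have "\<dots> = n ^ (1 + e + K * e)"
      by (simp add: power_add)
    also have "\<dots> \<le> n ^ e1"
    proof (rule power_increasing)
      have "1 * 1 \<le> K * e" "1 * e \<le> K * e" using Suc.prems by (intro mult_le_mono; simp)+
      then show "1 + e + K * e \<le> e1" unfolding e1_def by linarith
    qed (use Suc.prems in auto)
    finally have le: "2 * n ^ e * n ^ (K * e) \<le> n ^ e1" .
    have "\<forall>i\<in>G. dependent_at u (T - {x}) (n ^ e1) i"
    proof
      fix i assume "i \<in> G"
      then have "dependent_at u (T - {x}) (2 * n ^ e * n ^ (K * e)) i"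
        using Suc.prems x c by (intro dependent_at_eliminate) auto
      then show "dependent_at u (T - {x}) (n ^ e1) i"
        using le by (rule dependent_at_mono)
    qed
    moreover have "1 \<le> e1" using Suc.prems by (simp add: e1_def)
    moreover have "N = card (T - {x})"
      using Suc x by (simp add: card_Diff_singleton)
    ultimately obtain T' e' where T': "T' \<subseteq> T - {x}" "e1 \<le> e'" "e' \<le> (3 * K) ^ card (T - {x}) * e1"
      "\<forall>i\<in>G. dependent_at u T' (n ^ e') i" "independent_at u T' (n ^ (K * e'))"
      using Suc.hyps(1) [of "T - {x}" e1] Suc.prems by auto
    have "(3 * K) ^ card (T - {x}) * e1 = (3 * K) ^ card T * e"
      using Suc.hyps(2) Suc.prems(1) x by (simp add: e1_def card_Diff_singleton flip: Suc.hyps(2))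
    moreover have "1 * e \<le> 3 * K * e"
      using Suc.prems by (intro mult_le_mono1) simp
    then have "e \<le> e1" by (simp add: e1_def)
    ultimately show ?thesis
      using T' by (intro exI [of _ T'] exI [of _ e']) auto
  qed
qed

section \<open>Counting walks along a greedy run\<close>

text \<open>The two counts of walks in one ball are compared. The condition on \<open>R\<close>
  makes the Gaussian tail at most half of the main term \<open>Q / (2 * 4 ^ s)\<close>, which leaves
  \<open>Q / (4 * 4 ^ s)\<close>.\<close>

lemma walk_count_bound:
  fixes u :: "nat \<Rightarrow> 'a::euclidean_space"
  assumes "0 < k" "0 \<le> L" "0 \<le> R" and Q: "Q \<le> conc L u ws"
    and err: "real (length ws) * exp (- L / (8 * (real k)\<^sup>2)) * 4 ^ length ws \<le> Q / 2"
    and errR: "exp (- R\<^sup>2 / 2) \<le> Q / (4 * 4 ^ length ws)"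
    and "\<And>j. j < length ws \<Longrightarrow> 0 < m j"
    and "\<And>j U V. j < length ws \<Longrightarrow> U \<in> grid (Suc j) k \<Longrightarrow> V \<in> grid (Suc j) k \<Longrightarrow>
      norm (walk (\<lambda>j. u (ws ! j)) (Suc j) U - walk (\<lambda>j. u (ws ! j)) (Suc j) V) \<le> 2 * R \<Longrightarrow> V j < U j \<Longrightarrow> m j \<le> U j - V j"
  shows "real k ^ length ws * Q \<le> 4 * 4 ^ length ws * (\<Prod>j<length ws. real k / real (m j) + 1)"
proof -
  let ?s = "length ws"
  obtain z where "real k ^ ?s * (Q / (2 * 4 ^ ?s) - exp (- R\<^sup>2 / 2)) \<le>
      real (card {U \<in> grid ?s k. norm (walk (\<lambda>j. u (ws ! j)) ?s U - z) \<le> R})"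
    using card_walk_ball_ge [where k = k and L = L and R = R and Q = Q and s = ?s and w = "\<lambda>j. u (ws ! j)"] assms unfolding conc_def by blast
  also have "\<dots> \<le> (\<Prod>j<?s. real k / real (m j) + 1)"
    by (rule card_walk_ball_le) (use assms in auto)
  finally have "real k ^ ?s * (Q / (2 * 4 ^ ?s) - exp (- R\<^sup>2 / 2)) \<le> (\<Prod>j<?s. real k / real (m j) + 1)" .
  moreover have "real k ^ ?s * (Q / (4 * 4 ^ ?s)) \<le> real k ^ ?s * (Q / (2 * 4 ^ ?s) - exp (- R\<^sup>2 / 2))"
    using errR by (intro mult_left_mono) (auto simp: field_simps)
  ultimately show ?thesis
    by (simp add: field_simps)
qed

text \<open>\<open>k\<close> is the side length of the boxes of walks, \<open>N\<close> the size of the blocks replaced by one generator, and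
  \<open>S\<close> a number of generators that no greedy run can reach.\<close>
locale concentrated_family =
  fixes u :: "nat \<Rightarrow> 'a::euclidean_space" and n k B q N S :: nat and c :: real
  assumes n: "16 \<le> n" and k64: "64 \<le> k" and kn: "k \<le> n" and nk: "n \<le> k ^ q"
    and c: "0 \<le> c" and N: "0 < N"
    and S: "4 * n ^ B < 8 ^ S" and Sn: "S + 3 \<le> n"
    and err: "real S * exp (- (c * real N) / (8 * (real k)\<^sup>2)) * 4 ^ S \<le> 1 / (2 * real n ^ B)"
    and errR: "exp (- (real n)\<^sup>2 / 2) \<le> 1 / (4 * 4 ^ S * real n ^ B)"
    and conc: "1 / real n ^ B \<le> (\<integral>t. exp (- c * (\<Sum>i\<in>{1..n}. 1 - cos (pairing t (u i)))) \<partial>gauss)"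
begin

text \<open>Comparing the counts gives \<open>P \<le> 4 * 8 ^ s * n ^ B\<close> for the product
  \<open>P\<close> of the capped spacings. As every spacing is at least 64, \<open>8 ^ s\<close> is
  at most the square root of \<open>P\<close>, and so both \<open>s\<close> and \<open>P\<close> are
  bounded. Spacings are capped at \<open>k\<close> because a box of side \<open>k\<close> cannot see
  larger ones.\<close>

lemma prefix_product:
  assumes cw: "1 / real n ^ B \<le> conc (c * real N) u ws" and len: "length ws \<le> S"
    and m: "\<And>j. j < length ws \<Longrightarrow> 64 \<le> m j"
    and sp: "\<And>j U V. j < length ws \<Longrightarrow> U \<in> grid (Suc j) k \<Longrightarrow> V \<in> grid (Suc j) k \<Longrightarrow>
      norm (walk (\<lambda>j. u (ws ! j)) (Suc j) U - walk (\<lambda>j. u (ws ! j)) (Suc j) V) \<le> 2 * real n \<Longrightarrow> V j < U j \<Longrightarrow> m j \<le> U j - V j"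
  shows "(\<Prod>j<length ws. min (m j) k) \<le> n ^ (2 * B + 1)" and "8 ^ length ws \<le> 4 * n ^ B"
proof -
  let ?s = "length ws"
  define P where "P = (\<Prod>j<?s. min (m j) k)"
  define E where "E = exp (- (c * real N) / (8 * (real k)\<^sup>2))"
  have pos: "0 < n" "0 < k" using n k64 by auto
  have "64 ^ ?s = (\<Prod>j<?s. 64 :: nat)" by simp
  also have "\<dots> \<le> P" unfolding P_def by (intro prod_mono) (use m k64 in auto)
  finally have P64: "64 ^ ?s \<le> P" .
  then have P0: "0 < P" by (rule order_less_le_trans [rotated]) simp
  have "real k ^ ?s * (1 / real n ^ B) \<le> 4 * 4 ^ ?s * (\<Prod>j<?s. real k / real (m j) + 1)"
  proof (rule walk_count_bound [where R = "real n" and L = "c * real N"])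
    have "real ?s * E * 4 ^ ?s \<le> real S * E * 4 ^ S"
      using len by (intro mult_mono power_increasing) (auto simp: E_def)
    also have "\<dots> \<le> 1 / real n ^ B / 2"
      using err by (simp add: E_def mult.commute)
    finally show "real ?s * exp (- (c * real N) / (8 * (real k)\<^sup>2)) * 4 ^ ?s \<le> 1 / real n ^ B / 2"
      by (simp only: E_def)
    have "1 / (4 * 4 ^ S * real n ^ B) \<le> 1 / (4 * 4 ^ ?s * real n ^ B)"
      using len pos by (intro divide_left_mono mult_right_mono mult_left_mono power_increasing) auto
    then show "exp (- (real n)\<^sup>2 / 2) \<le> 1 / real n ^ B / (4 * 4 ^ ?s)"
      using errR by (simp add: mult_ac)
    show "0 < m j" if "j < ?s" for j
      using m [OF that] by simp
  qed (use cw sp c pos in auto)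
  \<comment> \<open>The added 1 from rounding costs a factor 2 per step, which with the 4 of the
    majorant makes 8.\<close>
  also have "(\<Prod>j<?s. real k / real (m j) + 1) \<le> (\<Prod>j<?s. 2 * real k / real (min (m j) k))"
  proof (intro prod_mono conjI)
    fix j assume "j \<in> {..<?s}"
    then have mj: "0 < m j" using m [of j] by auto
    have "real k / real (m j) \<le> real k / real (min (m j) k)" "1 \<le> real k / real (min (m j) k)"
      using mj pos by (auto simp: field_simps min_def)
    then show "real k / real (m j) + 1 \<le> 2 * real k / real (min (m j) k)" by simp
  qed auto
  also have "\<dots> = (2 * real k) ^ ?s / real P"
    by (simp add: P_def prod_dividef)
  finally have "real k ^ ?s * (1 / real n ^ B) \<le> 4 * 4 ^ ?s * ((2 * real k) ^ ?s / real P)"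
    by simp
  then have "real k ^ ?s * real P \<le> real k ^ ?s * (4 * (4 ^ ?s * 2 ^ ?s) * real n ^ B)"
    using P0 pos by (simp add: field_simps power_mult_distrib)
  then have "real P \<le> 4 * (4 ^ ?s * 2 ^ ?s) * real n ^ B"
    using pos by simp
  then have "real P \<le> real (4 * 8 ^ ?s * n ^ B)"
    by (simp add: power_mult_distrib [symmetric])
  then have P8: "P \<le> 4 * 8 ^ ?s * n ^ B"
    by (simp only: of_nat_le_iff)
  have sq: "(64::nat) ^ ?s = 8 ^ ?s * 8 ^ ?s"
    by (simp add: power_mult_distrib [symmetric])
  have "8 ^ ?s * 8 ^ ?s \<le> 8 ^ ?s * (4 * n ^ B)"
    using order_trans [OF P64 P8] unfolding sq by (simp only: mult_ac)
  then show "8 ^ ?s \<le> 4 * n ^ B"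
    by simp
  \<comment> \<open>Squaring replaces \<open>8 ^ s\<close> by \<open>64 ^ s\<close>, which is at
    most \<open>P\<close>; one factor \<open>P\<close> then cancels.\<close>
  have "P * P \<le> (4 * 8 ^ ?s * n ^ B) * (4 * 8 ^ ?s * n ^ B)"
    using P8 by (intro mult_le_mono)
  also have "\<dots> = (16 * n ^ B * n ^ B) * 64 ^ ?s"
    unfolding sq by (simp add: mult_ac)
  also have "\<dots> \<le> (16 * n ^ B * n ^ B) * P"
    using P64 by (rule mult_le_mono2)
  finally have "P \<le> 16 * n ^ B * n ^ B"
    using P0 by simp
  also have "\<dots> \<le> n * n ^ B * n ^ B"
    using n by (intro mult_le_mono) auto
  finally show "(\<Prod>j<?s. min (m j) k) \<le> n ^ (2 * B + 1)"
    by (simp add: P_def power_add mult_2)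
qed

text \<open>The first greedy run. For a generator independent of its predecessors, two walks ending
  in one ball must agree in the last coordinate, so the spacing may be taken as \<open>k\<close>.
  The run cannot reach length \<open>S\<close>, because \<open>8 ^ S\<close> exceeds
  \<open>4 * n ^ B\<close>, and \<open>k ^ length ws \<le> n ^ (2 * B + 1)\<close> bounds its length
  through \<open>n \<le> k ^ q\<close>.\<close>

lemma few_generators:
  "\<exists>T\<subseteq>{1..n}. card T \<le> q * (2 * B + 1) \<and> card {i \<in> {1..n}. \<not> dependent_at u T (n\<^sup>2) i} \<le> S * N"
proof -
  let ?Bad = "\<lambda>ws i. \<not> dependent_at u (set ws) (n\<^sup>2) i"
  have nn: "n \<le> n\<^sup>2" "2 * n \<le> n\<^sup>2" using n by (auto simp: power2_eq_square)
  obtain ws where ws: "set ws \<subseteq> {1..n}" "\<forall>j<length ws. ?Bad (take j ws) (ws ! j)" "1 / real n ^ B \<le> conc (c * real N) u ws"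
    and alt: "length ws = S \<or> length ws < S \<and> card {i \<in> {1..n}. ?Bad ws i} \<le> (length ws + 1) * N"
    using greedy_selection [OF _ N c conc, where Bad = ?Bad and S = S] by auto
  have ne: "ws ! l \<noteq> ws ! j" if "l < j" "j < length ws" for l j
  proof
    assume "ws ! l = ws ! j"
    then have "ws ! j \<in> set (take j ws)"
      using that by (auto simp: in_set_conv_nth intro!: exI [of _ l])
    then have "dependent_at u (set (take j ws)) (n\<^sup>2) (ws ! j)"
      using n by (intro dependent_at_member) auto
    then show False using ws that by auto
  qed
  \<comment> \<open>The hypotheses are contradictory: the difference of the two walks would make
    \<open>ws ! j\<close> dependent on its predecessors.\<close>
  have sp: "k \<le> U j - V j" if j: "j < length ws" and U: "U \<in> grid (Suc j) k" and V: "V \<in> grid (Suc j) k"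
    and close: "norm (walk (\<lambda>j. u (ws ! j)) (Suc j) U - walk (\<lambda>j. u (ws ! j)) (Suc j) V) \<le> 2 * real n"
    and less: "V j < U j" for j U V
  proof -
    have bij: "bij_betw (\<lambda>l. ws ! l) {..<j} (set (take j ws))"
    proof (rule bij_betw_imageI)
      show "inj_on (\<lambda>l. ws ! l) {..<j}"
        by (rule linorder_inj_onI) (use ne j in auto)
      show "(\<lambda>l. ws ! l) ` {..<j} = set (take j ws)"
        using j nth_image [of j ws] by (simp add: lessThan_atLeast0)
    qed
    \<comment> \<open>Walks are indexed by positions and \<open>dependent_at\<close> by elements, so
      coefficients are carried over by the inverse of the position map. The sign is reversed because
      the combination stands on the other side of the relation.\<close>
    define b where "b t = (let l = the_inv_into {..<j} (\<lambda>l. ws ! l) t in int (V l) - int (U l))" for t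
    have b: "b (ws ! l) = int (V l) - int (U l)" if "l < j" for l
      unfolding b_def using that bij by (simp add: the_inv_into_f_f bij_betw_def)
    have lt: "U l < k" "V l < k" if "l \<le> j" for l
      using U V that by (auto simp: PiE_iff)
    have "(\<Sum>t\<in>set (take j ws). of_int (b t) *\<^sub>R u t) = (\<Sum>l<j. of_int (b (ws ! l)) *\<^sub>R u (ws ! l))"
      by (rule sum.reindex_bij_betw [OF bij, symmetric])
    also have "\<dots> = (\<Sum>l<j. real (V l) *\<^sub>R u (ws ! l)) - (\<Sum>l<j. real (U l) *\<^sub>R u (ws ! l))"
      by (simp add: b sum_subtractf [symmetric] scaleR_diff_left)
    finally have "of_int (int (U j) - int (V j)) *\<^sub>R u (ws ! j) - (\<Sum>t\<in>set (take j ws). of_int (b t) *\<^sub>R u t)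
      = walk (\<lambda>j. u (ws ! j)) (Suc j) U - walk (\<lambda>j. u (ws ! j)) (Suc j) V"
      by (simp add: walk_def algebra_simps)
    then have "norm (of_int (int (U j) - int (V j)) *\<^sub>R u (ws ! j) - (\<Sum>t\<in>set (take j ws). of_int (b t) *\<^sub>R u t)) \<le> real (2 * n)"
      using close by simp
    also have "\<dots> \<le> real (n\<^sup>2)"
      using nn by (simp only: of_nat_le_iff)
    finally have 1: "norm (of_int (int (U j) - int (V j)) *\<^sub>R u (ws ! j) - (\<Sum>t\<in>set (take j ws). of_int (b t) *\<^sub>R u t)) \<le> real (n\<^sup>2)" .
    have kn2: "int k \<le> int (n\<^sup>2)"
      using kn nn by linarith
    have 2: "\<bar>int (U j) - int (V j)\<bar> \<le> int (n\<^sup>2)"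
      using lt [of j] kn2 by linarith
    have 3: "\<forall>t\<in>set (take j ws). \<bar>b t\<bar> \<le> int (n\<^sup>2)"
    proof
      fix t assume "t \<in> set (take j ws)"
      then obtain l where l: "l < j" "t = ws ! l"
        using bij by (auto simp: bij_betw_def image_iff)
      then show "\<bar>b t\<bar> \<le> int (n\<^sup>2)"
        unfolding l(2) b [OF l(1)] using lt [of l] l(1) kn2 by linarith
    qed
    have "dependent_at u (set (take j ws)) (n\<^sup>2) (ws ! j)"
      unfolding dependent_at_def using 1 2 3 less
      by (intro exI [of _ "int (U j) - int (V j)"] exI [of _ b]) auto
    then show ?thesis using ws j by auto
  qed
  have len: "length ws \<le> S" using alt by auto
  have prod: "(\<Prod>j<length ws. min k k) \<le> n ^ (2 * B + 1)" and "8 ^ length ws \<le> 4 * n ^ B"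
    using prefix_product [OF ws(3) len, where m = "\<lambda>_. k"] sp k64 by blast+
  then have "length ws \<noteq> S" using S by auto
  then have bad: "card {i \<in> {1..n}. ?Bad ws i} \<le> (length ws + 1) * N" and "length ws + 1 \<le> S"
    using alt by auto
  then have "card {i \<in> {1..n}. ?Bad ws i} \<le> S * N"
    by (meson mult_le_mono1 order_trans)
  moreover have "k ^ length ws \<le> k ^ (q * (2 * B + 1))"
  proof -
    have "k ^ length ws \<le> n ^ (2 * B + 1)" using prod by simp
    also have "\<dots> \<le> (k ^ q) ^ (2 * B + 1)"
      using nk by (rule power_mono) simp
    finally show ?thesis by (simp only: power_mult)
  qed
  then have "length ws \<le> q * (2 * B + 1)"
    using k64 by (subst (asm) power_increasing_iff) auto
  then have "card (set ws) \<le> q * (2 * B + 1)"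
    using card_length [of ws] by linarith
  ultimately show ?thesis
    using ws(1) by blast
qed

end

section \<open>Common denominators\<close>

text \<open>The order of the rational vector \<open>b / a\<close> modulo \<open>(1 / D)\<close> times the integer lattice.\<close>
definition rel_order :: "nat set \<Rightarrow> int \<Rightarrow> (nat \<Rightarrow> int) \<Rightarrow> nat \<Rightarrow> nat" where
  "rel_order T a b D = (LEAST m. 0 < m \<and> (\<forall>t\<in>T. a dvd int m * int D * b t))"

lemma rel_order:
  assumes "a \<noteq> 0"
  shows "0 < rel_order T a b D" "t \<in> T \<Longrightarrow> a dvd int (rel_order T a b D) * int D * b t"
proof -
  have "0 < nat \<bar>a\<bar> \<and> (\<forall>t\<in>T. a dvd int (nat \<bar>a\<bar>) * int D * b t)"
    using assms by simp
  from LeastI [of "\<lambda>m. 0 < m \<and> (\<forall>t\<in>T. a dvd int m * int D * b t)", OF this]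
  show "0 < rel_order T a b D" "t \<in> T \<Longrightarrow> a dvd int (rel_order T a b D) * int D * b t"
    unfolding rel_order_def by blast+
qed

lemma rel_order_le:
  assumes "x \<noteq> 0" "\<And>t. t \<in> T \<Longrightarrow> a dvd x * int D * b t"
  shows "rel_order T a b D \<le> nat \<bar>x\<bar>"
  unfolding rel_order_def
proof (rule Least_le, intro conjI ballI)
  fix t assume "t \<in> T"
  then have "a dvd \<bar>x * int D * b t\<bar>" using assms by simp
  then have "a dvd \<bar>\<bar>x\<bar> * int D * b t\<bar>" by (simp add: abs_mult)
  then show "a dvd int (nat \<bar>x\<bar>) * int D * b t" by simp
qed (use assms in auto)

text \<open>For nonzero \<open>a i\<close>, each factor is the least common multiple of
  \<open>D\<close> and the denominator of \<open>b i / a i\<close>, divided by \<open>D\<close>; the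
  result is thus the least common denominator. It is built as a product so that its factors can be
  compared with the spacings of walks.\<close>

definition common_denominator :: "nat set \<Rightarrow> (nat \<Rightarrow> int) \<Rightarrow> (nat \<Rightarrow> nat \<Rightarrow> int) \<Rightarrow> nat list \<Rightarrow> nat" where
  "common_denominator T a b ws = foldl (\<lambda>D i. D * rel_order T (a i) (b i) D) 1 ws"

lemma common_denominator_Nil [simp]: "common_denominator T a b [] = 1"
  by (simp add: common_denominator_def)

lemma common_denominator_snoc:
  "common_denominator T a b (ws @ [i]) =
    common_denominator T a b ws * rel_order T (a i) (b i) (common_denominator T a b ws)"
  by (simp add: common_denominator_def)

lemma common_denominator_dvd:
  assumes "\<And>i. i \<in> set ws \<Longrightarrow> a i \<noteq> 0" "i \<in> set ws" "t \<in> T"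
  shows "a i dvd int (common_denominator T a b ws) * b i t"
  using assms
proof (induction ws rule: rev_induct)
  case (snoc x ws)
  let ?D = "common_denominator T a b ws"
  show ?case
  proof (cases "i \<in> set ws")
    case True
    then have "a i dvd int ?D * b i t" using snoc by simp
    then have "a i dvd int (rel_order T (a x) (b x) ?D) * (int ?D * b i t)" by (rule dvd_mult)
    then show ?thesis by (simp add: common_denominator_snoc mult_ac)
  next
    case False
    then have "i = x" using snoc by simp
    then have "a i dvd int (rel_order T (a i) (b i) ?D) * int ?D * b i t"
      using snoc by (intro rel_order) auto
    then show ?thesis using \<open>i = x\<close> by (simp add: common_denominator_snoc mult_ac)
  qed
qed simp

lemma common_denominator_pos:
  assumes "\<And>i. i \<in> set ws \<Longrightarrow> a i \<noteq> 0"
  shows "0 < common_denominator T a b ws"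
  using assms
  by (induction ws rule: rev_induct) (auto simp: common_denominator_snoc rel_order)

text \<open>These factors are the spacings in the second greedy run; capped at \<open>k\<close>,
  their product is controlled by \<open>prefix_product\<close>.\<close>

lemma common_denominator_take:
  assumes "j \<le> length ws"
  shows "common_denominator T a b (take j ws) =
    (\<Prod>l<j. rel_order T (a (ws ! l)) (b (ws ! l)) (common_denominator T a b (take l ws)))"
  using assms
  by (induction j) (auto simp: take_Suc_conv_app_nth common_denominator_snoc)

text \<open>\<open>M\<close> times the relation is divided by \<open>a\<close>: the quotients
  \<open>g t\<close> are integers by divisibility, and since \<open>a\<close> has absolute value at
  least 1 neither the coefficients nor the error grow.\<close>

lemma clear_denominator:
  fixes u :: "nat \<Rightarrow> 'a::real_normed_vector" and a :: int
  assumes "a \<noteq> 0" and b: "\<And>t. t \<in> T \<Longrightarrow> \<bar>b t\<bar> \<le> int h"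
    and ab: "norm (of_int a *\<^sub>R u i - (\<Sum>t\<in>T. of_int (b t) *\<^sub>R u t)) \<le> real h"
    and dvd: "\<And>t. t \<in> T \<Longrightarrow> a dvd int M * b t"
  shows "\<exists>g. (\<forall>t\<in>T. int M * b t = a * g t \<and> \<bar>g t\<bar> \<le> int M * int h) \<and>
    norm (real M *\<^sub>R u i - (\<Sum>t\<in>T. of_int (g t) *\<^sub>R u t)) \<le> real M * real h"
proof -
  define g where "g t = int M * b t div a" for t
  have g: "int M * b t = a * g t" if "t \<in> T" for t
    using dvd [OF that] by (simp add: g_def)
  have gb: "\<bar>g t\<bar> \<le> int M * int h" if "t \<in> T" for t
  proof -
    have "1 * \<bar>g t\<bar> \<le> \<bar>a\<bar> * \<bar>g t\<bar>"
      using \<open>a \<noteq> 0\<close> by (intro mult_right_mono) auto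
    also have "\<dots> = int M * \<bar>b t\<bar>"
      using g [OF that] by (metis abs_mult abs_of_nat)
    also have "\<dots> \<le> int M * int h"
      using b [OF that] by (intro mult_left_mono) auto
    finally show ?thesis by simp
  qed
  let ?r = "real M *\<^sub>R u i - (\<Sum>t\<in>T. of_int (g t) *\<^sub>R u t)"
  have "(\<Sum>t\<in>T. of_int (a * g t) *\<^sub>R u t) = (\<Sum>t\<in>T. of_int (int M * b t) *\<^sub>R u t)"
    using g by (intro sum.cong) simp_all
  then have eq: "of_int a *\<^sub>R ?r = real M *\<^sub>R (of_int a *\<^sub>R u i - (\<Sum>t\<in>T. of_int (b t) *\<^sub>R u t))"
    by (simp add: algebra_simps scaleR_sum_right)
  have "1 * norm ?r \<le> \<bar>real_of_int a\<bar> * norm ?r"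
  proof (rule mult_right_mono)
    have "1 \<le> \<bar>a\<bar>" using \<open>a \<noteq> 0\<close> by auto
    then show "1 \<le> \<bar>real_of_int a\<bar>" by linarith
  qed simp
  also have "\<dots> = norm (of_int a *\<^sub>R ?r)" by simp
  also have "\<dots> \<le> real M * real h"
    unfolding eq using ab by (simp add: mult_left_mono)
  finally show ?thesis
    using g gb by (intro exI [of _ g]) auto
qed

text \<open>Let \<open>A = a (w j)\<close>. In \<open>A * D\<close> times the difference of the
  walks, each earlier \<open>D *\<^sub>R u (w l)\<close> is close to an integer combination of
  \<open>T\<close>, and so is \<open>A *\<^sub>R u (w j)\<close>. The resulting short combination
  vanishes coefficientwise by independence. Modulo \<open>A\<close> only the last step survives, so
  its difference clears the denominator of \<open>b (w j) / A\<close> relative to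
  \<open>D\<close>.\<close>

lemma rel_order_le_difference:
  fixes u :: "nat \<Rightarrow> 'a::real_normed_vector" and w :: "nat \<Rightarrow> nat"
  assumes "finite T" and indep: "independent_at u T H"
    and a: "\<And>l. l \<le> j \<Longrightarrow> a (w l) \<noteq> 0" "\<And>l. l \<le> j \<Longrightarrow> \<bar>a (w l)\<bar> \<le> int h"
    and b: "\<And>l t. l \<le> j \<Longrightarrow> t \<in> T \<Longrightarrow> \<bar>b (w l) t\<bar> \<le> int h"
    and ab: "\<And>l. l \<le> j \<Longrightarrow> norm (of_int (a (w l)) *\<^sub>R u (w l) - (\<Sum>t\<in>T. of_int (b (w l) t) *\<^sub>R u t)) \<le> real h"
    and D: "\<And>l t. l < j \<Longrightarrow> t \<in> T \<Longrightarrow> a (w l) dvd int D * b (w l) t"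
    and U: "U \<in> grid (Suc j) k" and V: "V \<in> grid (Suc j) k" and "k \<le> n" "1 \<le> h"
    and close: "norm (walk (\<lambda>l. u (w l)) (Suc j) U - walk (\<lambda>l. u (w l)) (Suc j) V) \<le> 2 * real n"
    and less: "V j < U j"
    and H: "(j + 3) * n * D * h * h \<le> H"
  shows "rel_order T (a (w j)) (b (w j)) D \<le> U j - V j"
proof -
  define \<delta> where "\<delta> l = int (U l) - int (V l)" for l
  have "\<exists>g. (\<forall>t\<in>T. int D * b (w l) t = a (w l) * g t \<and> \<bar>g t\<bar> \<le> int D * int h) \<and>
      norm (real D *\<^sub>R u (w l) - (\<Sum>t\<in>T. of_int (g t) *\<^sub>R u t)) \<le> real D * real h" if "l < j" for l
    using that a(1) b ab D by (intro clear_denominator) auto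
  then have "\<exists>g. \<forall>l. l < j \<longrightarrow> (\<forall>t\<in>T. int D * b (w l) t = a (w l) * g l t \<and> \<bar>g l t\<bar> \<le> int D * int h) \<and>
      norm (real D *\<^sub>R u (w l) - (\<Sum>t\<in>T. of_int (g l t) *\<^sub>R u t)) \<le> real D * real h"
    by (intro choice) blast
  then obtain g where
    g: "\<And>l t. l < j \<Longrightarrow> t \<in> T \<Longrightarrow> int D * b (w l) t = a (w l) * g l t"
    and gb: "\<And>l t. l < j \<Longrightarrow> t \<in> T \<Longrightarrow> \<bar>g l t\<bar> \<le> int D * int h"
    and gn: "\<And>l. l < j \<Longrightarrow> norm (real D *\<^sub>R u (w l) - (\<Sum>t\<in>T. of_int (g l t) *\<^sub>R u t)) \<le> real D * real h"
    by blast
  define A where "A = a (w j)"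
  have h_pos: "real h \<ge> 1" using \<open>1 \<le> h\<close> by simp
  have \<delta>: "\<bar>\<delta> l\<bar> \<le> int n" "\<bar>real_of_int (\<delta> l)\<bar> \<le> real n" if "l \<le> j" for l
  proof -
    have "U l < k" "V l < k" using U V that by (auto simp: PiE_iff)
    then show "\<bar>\<delta> l\<bar> \<le> int n" unfolding \<delta>_def using \<open>k \<le> n\<close> by linarith
    then show "\<bar>real_of_int (\<delta> l)\<bar> \<le> real n" by (metis of_int_abs of_int_le_iff of_int_of_nat_eq)
  qed
  have A: "\<bar>A\<bar> \<le> int h" "\<bar>real_of_int A\<bar> \<le> real h"
    using a(2) [of j] by (auto simp: A_def)
  define r where "r l = real D *\<^sub>R u (w l) - (\<Sum>t\<in>T. of_int (g l t) *\<^sub>R u t)" for l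
  have r: "norm (r l) \<le> real D * real h" if "l < j" for l
    using gn [OF that] by (simp add: r_def)
  define \<rho> where "\<rho> = of_int A *\<^sub>R u (w j) - (\<Sum>t\<in>T. of_int (b (w j) t) *\<^sub>R u t)"
  have \<rho>: "norm \<rho> \<le> real h" unfolding \<rho>_def A_def using ab by simp
  \<comment> \<open>The coefficients obtained by this substitution; all terms from earlier steps
    carry the factor \<open>A\<close>.\<close>
  define \<beta> where "\<beta> t = (\<Sum>l<j. A * \<delta> l * g l t) + int D * \<delta> j * b (w j) t" for t
  define \<Delta> where "\<Delta> = walk (\<lambda>l. u (w l)) (Suc j) U - walk (\<lambda>l. u (w l)) (Suc j) V"
  have \<Delta>_eq: "\<Delta> = (\<Sum>l<j. of_int (\<delta> l) *\<^sub>R u (w l)) + of_int (\<delta> j) *\<^sub>R u (w j)"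
    by (simp add: \<Delta>_def walk_def \<delta>_def sum_subtractf scaleR_diff_left algebra_simps)
  have "(\<Sum>t\<in>T. of_int (\<beta> t) *\<^sub>R u t) =
     (\<Sum>l<j. of_int (A * \<delta> l) *\<^sub>R (\<Sum>t\<in>T. of_int (g l t) *\<^sub>R u t)) + of_int (int D * \<delta> j) *\<^sub>R (\<Sum>t\<in>T. of_int (b (w j) t) *\<^sub>R u t)"
  proof -
    have "(\<Sum>t\<in>T. of_int (\<beta> t) *\<^sub>R u t) =
      (\<Sum>t\<in>T. (\<Sum>l<j. of_int (A * \<delta> l) *\<^sub>R of_int (g l t) *\<^sub>R u t) + of_int (int D * \<delta> j) *\<^sub>R of_int (b (w j) t) *\<^sub>R u t)"
      by (rule sum.cong) (auto simp: \<beta>_def scaleR_add_left scaleR_sum_left)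
    then show ?thesis
      by (simp add: sum.distrib scaleR_sum_right sum.swap [of _ T])
  qed
  also have "\<dots> = (\<Sum>l<j. of_int (A * \<delta> l) *\<^sub>R (real D *\<^sub>R u (w l) - r l)) + of_int (int D * \<delta> j) *\<^sub>R (of_int A *\<^sub>R u (w j) - \<rho>)"
    by (simp add: r_def \<rho>_def)
  also have "\<dots> = of_int (A * int D) *\<^sub>R \<Delta> - (\<Sum>l<j. of_int (A * \<delta> l) *\<^sub>R r l) - of_int (int D * \<delta> j) *\<^sub>R \<rho>"
    unfolding \<Delta>_eq by (simp add: scaleR_diff_right scaleR_add_right sum_subtractf scaleR_sum_right mult_ac)
  finally have sum_eq: "(\<Sum>t\<in>T. of_int (\<beta> t) *\<^sub>R u t) = \<dots>" .
  have "norm (of_int (A * int D) *\<^sub>R \<Delta>) \<le> real h * real D * (2 * real n)"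
    using A close by (auto simp: \<Delta>_def abs_mult intro!: mult_mono)
  also have "\<dots> \<le> 2 * (real n * real D * real h * real h)"
    using mult_left_mono [OF h_pos, of "real h * real D * (2 * real n)"] by (simp add: mult_ac)
  finally have n1: "norm (of_int (A * int D) *\<^sub>R \<Delta>) \<le> 2 * (real n * real D * real h * real h)" .
  have "norm (\<Sum>l<j. of_int (A * \<delta> l) *\<^sub>R r l) \<le> (\<Sum>l<j. real h * real n * (real D * real h))"
  proof (rule sum_norm_le)
    fix l assume "l \<in> {..<j}"
    then show "norm (of_int (A * \<delta> l) *\<^sub>R r l) \<le> real h * real n * (real D * real h)"
      using A \<delta> [of l] r [of l] by (auto simp: abs_mult intro!: mult_mono)
  qed
  then have n2: "norm (\<Sum>l<j. of_int (A * \<delta> l) *\<^sub>R r l) \<le> real j * (real n * real D * real h * real h)"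
    by (simp add: mult_ac)
  have "norm (of_int (int D * \<delta> j) *\<^sub>R \<rho>) \<le> real D * real n * real h"
    using \<delta> [of j] \<rho> by (auto simp: abs_mult intro!: mult_mono)
  also have "\<dots> \<le> real n * real D * real h * real h"
    using mult_left_mono [OF h_pos, of "real D * real n * real h"] by (simp add: mult_ac)
  finally have n3: "norm (of_int (int D * \<delta> j) *\<^sub>R \<rho>) \<le> real n * real D * real h * real h" .
  \<comment> \<open>Of the \<open>j + 3\<close> units, 2 come from the distance \<open>2 * n\<close>
    of the endpoints, \<open>j\<close> from the errors \<open>r l\<close> and 1 from
    \<open>\<rho>\<close>.\<close>
  have "norm (\<Sum>t\<in>T. of_int (\<beta> t) *\<^sub>R u t) \<le> (real j + 3) * (real n * real D * real h * real h)"
    unfolding sum_eq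
    using n1 n2 n3 norm_triangle_ineq4 [of "of_int (A * int D) *\<^sub>R \<Delta>" "\<Sum>l<j. of_int (A * \<delta> l) *\<^sub>R r l"]
      norm_triangle_ineq4 [of "of_int (A * int D) *\<^sub>R \<Delta> - (\<Sum>l<j. of_int (A * \<delta> l) *\<^sub>R r l)" "of_int (int D * \<delta> j) *\<^sub>R \<rho>"]
    by (simp add: distrib_right)
  also have "\<dots> = real ((j + 3) * n * D * h * h)" by (simp add: mult_ac)
  also have "\<dots> \<le> real H" using H by (simp only: of_nat_le_iff)
  finally have small: "norm (\<Sum>t\<in>T. of_int (\<beta> t) *\<^sub>R u t) \<le> real H" .
  have coeff: "\<bar>\<beta> t\<bar> \<le> int H" if t: "t \<in> T" for t
  proof -
    have "\<bar>\<Sum>l<j. A * \<delta> l * g l t\<bar> \<le> (\<Sum>l<j. \<bar>A * \<delta> l * g l t\<bar>)"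
      by (rule sum_abs)
    also have "\<dots> \<le> (\<Sum>l<j. int h * int n * (int D * int h))"
      using A \<delta> gb t by (intro sum_mono) (auto simp: abs_mult intro!: mult_mono)
    finally have 1: "\<bar>\<Sum>l<j. A * \<delta> l * g l t\<bar> \<le> int j * (int n * int D * int h * int h)"
      by (simp add: mult_ac)
    have "\<bar>int D * \<delta> j * b (w j) t\<bar> \<le> int D * int n * int h"
      using \<delta> [of j] b [of j t] t by (auto simp: abs_mult intro!: mult_mono)
    also have "\<dots> \<le> int n * int D * int h * int h"
      using mult_left_mono [of 1 "int h" "int D * int n * int h"] \<open>1 \<le> h\<close> by (simp add: mult_ac)
    finally have "\<bar>\<beta> t\<bar> \<le> (int j + 1) * (int n * int D * int h * int h)"
      unfolding \<beta>_def using 1 by (simp add: distrib_right)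
    also have "\<dots> \<le> (int j + 3) * (int n * int D * int h * int h)"
      by (intro mult_right_mono) auto
    also have "\<dots> = int ((j + 3) * n * D * h * h)" by (simp add: mult_ac)
    also have "\<dots> \<le> int H" using H by (simp only: of_nat_le_iff)
    finally show ?thesis .
  qed
  have zero: "\<beta> t = 0" if "t \<in> T" for t
    using indep small coeff that unfolding independent_at_def by blast
  have "rel_order T (a (w j)) (b (w j)) D \<le> nat \<bar>\<delta> j\<bar>"
  proof (rule rel_order_le)
    show "\<delta> j \<noteq> 0" using less by (simp add: \<delta>_def)
    fix t assume "t \<in> T"
    have "int D * \<delta> j * b (w j) t = - (\<Sum>l<j. A * \<delta> l * g l t)"
      using zero [OF \<open>t \<in> T\<close>] by (simp add: \<beta>_def)
    also have "A dvd \<dots>"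
      by (auto intro!: dvd_sum simp: mult.assoc)
    finally show "a (w j) dvd \<delta> j * int D * b (w j) t"
      by (simp add: A_def mult_ac)
  qed
  then show ?thesis
    using less by (simp add: \<delta>_def nat_diff_distrib)
qed

text \<open>Unlike in \<open>dependent_at\<close>, the multiplier \<open>M\<close> is prescribed,
  and thus can be the same for all indices.\<close>

definition approximable :: "(nat \<Rightarrow> 'a::real_normed_vector) \<Rightarrow> nat set \<Rightarrow> nat \<Rightarrow> real \<Rightarrow> nat \<Rightarrow> bool" where
  "approximable u T M h i \<longleftrightarrow> (\<exists>\<kappa>::nat \<Rightarrow> int. (\<forall>t\<in>T. real_of_int \<bar>\<kappa> t\<bar> \<le> h) \<and>
     norm (real M *\<^sub>R u i - (\<Sum>t\<in>T. of_int (\<kappa> t) *\<^sub>R u t)) \<le> h)"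

definition rank_bound :: "nat \<Rightarrow> nat \<Rightarrow> nat" where
  "rank_bound B q = q * (2 * B + 1)"

text \<open>The final exponent of \<open>rank_reduction\<close> when it starts at 2 with
  \<open>K = (2 * B + 1) * q + 4\<close> and discards at most \<open>rank_bound B q\<close>
  generators.\<close>

definition exponent_bound :: "nat \<Rightarrow> nat \<Rightarrow> nat" where
  "exponent_bound B q = (3 * ((2 * B + 1) * q + 4)) ^ rank_bound B q * 2"

context concentrated_family
begin

text \<open>The second greedy run. An index is bad if adding it would multiply the common
  denominator by 64 or more. By \<open>rel_order_le_difference\<close> these multipliers are
  spacings of walks, so \<open>prefix_product\<close> limits their product and with it the
  denominator.\<close>

lemma exists_common_multiple:
  assumes T: "T \<subseteq> {1..n}" and G: "G \<subseteq> {1..n}" and e: "1 \<le> e"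
    and dep: "\<forall>i\<in>G. dependent_at u T (n ^ e) i"
    and indep: "independent_at u T (n ^ (((2 * B + 1) * q + 4) * e))"
  shows "\<exists>D. 0 < D \<and> D \<le> n ^ ((2 * B + 1) * (q * e)) \<and>
    card {i \<in> G. \<not> approximable u T (fact 63 * D) (real (fact 63 * D) * real (n ^ e)) i} \<le> S * N"
proof -
  have finT: "finite T" using T finite_subset by auto
  have q: "1 \<le> q" using nk n by (cases q) auto
  let ?P = "\<lambda>i a b. a \<noteq> 0 \<and> \<bar>a\<bar> \<le> int (n ^ e) \<and> (\<forall>t\<in>T. \<bar>b t\<bar> \<le> int (n ^ e)) \<and>
     norm (of_int a *\<^sub>R u i - (\<Sum>t\<in>T. of_int (b t) *\<^sub>R u t)) \<le> real (n ^ e)"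
  have "\<forall>i\<in>G. \<exists>p. ?P i (fst p) (snd p)"
    using dep unfolding dependent_at_def by simp
  then obtain p where p: "\<forall>i\<in>G. ?P i (fst (p i)) (snd (p i))"
    by (rule bchoice [THEN exE])
  define a b where "a i = fst (p i)" and "b i = snd (p i)" for i
  have a: "\<And>i. i \<in> G \<Longrightarrow> a i \<noteq> 0" "\<And>i. i \<in> G \<Longrightarrow> \<bar>a i\<bar> \<le> int (n ^ e)"
    and b: "\<And>i t. i \<in> G \<Longrightarrow> t \<in> T \<Longrightarrow> \<bar>b i t\<bar> \<le> int (n ^ e)"
    and ab: "\<And>i. i \<in> G \<Longrightarrow> norm (of_int (a i) *\<^sub>R u i - (\<Sum>t\<in>T. of_int (b i t) *\<^sub>R u t)) \<le> real (n ^ e)"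
    using p unfolding a_def b_def by blast+
  let ?D = "common_denominator T a b"
  let ?m = "\<lambda>ws i. rel_order T (a i) (b i) (?D ws)"
  \<comment> \<open>Each step loses a factor \<open>8\<close> (\<open>4\<close> from the Fejer majorant, \<open>2\<close> from rounding), so steps of order at least
    \<open>64 = 8\<^sup>2\<close> still gain the square root of the order; smaller orders are absorbed by \<open>fact 63\<close>.\<close>
  let ?Bad = "\<lambda>ws i. i \<in> G \<and> 64 \<le> ?m ws i"
  let ?X = "(2 * B + 1) * (q * e)"
  obtain ws where ws: "set ws \<subseteq> {1..n}" "\<forall>j<length ws. ?Bad (take j ws) (ws ! j)" "1 / real n ^ B \<le> conc (c * real N) u ws"
    and alt: "length ws = S \<or> length ws < S \<and> card {i \<in> {1..n}. ?Bad ws i} \<le> (length ws + 1) * N"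
    using greedy_selection [OF _ N c conc, where Bad = ?Bad and S = S] by auto
  have len: "length ws \<le> S" using alt by auto
  have wsG: "ws ! l \<in> G" if "l < length ws" for l
    using ws that by blast
  have setG: "i \<in> G" if "i \<in> set ws" for i
    using wsG that by (auto simp: in_set_conv_nth)
  \<comment> \<open>Strong induction on the prefix: the bound on the denominators of shorter
    prefixes is what places the relations of the next step within the scale at which
    \<open>T\<close> is independent.\<close>
  have main: "?D (take j ws) \<le> n ^ ?X \<and> 8 ^ j \<le> 4 * n ^ B" if "j \<le> length ws" for j
    using that
  proof (induction j rule: less_induct)
    case (less j)
    let ?ws = "take j ws"
    let ?ml = "\<lambda>l. ?m (take l ws) (ws ! l)"
    have lj: "length ?ws = j" using less.prems by simp
    have "1 / real n ^ B \<le> conc (c * real N) u ?ws"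
      using ws(3) conc_take [of "c * real N" j ws u] c less.prems by simp
    moreover have "64 \<le> ?ml l" if "l < length ?ws" for l
      using ws(2) that by auto
    moreover have "?ml l \<le> U l - V l" if l: "l < length ?ws" and U: "U \<in> grid (Suc l) k" and V: "V \<in> grid (Suc l) k"
      and close: "norm (walk (\<lambda>l. u (?ws ! l)) (Suc l) U - walk (\<lambda>l. u (?ws ! l)) (Suc l) V) \<le> 2 * real n"
      and lt: "V l < U l" for l U V
    proof -
      have llen: "l < length ws" "l < j" using l by auto
      have wsi: "?ws ! i = ws ! i" if "i \<le> l" for i using that llen by simp
      have Dl: "?D (take l ws) \<le> n ^ ?X" using less.IH [of l] llen by simp
      have "rel_order T (a (?ws ! l)) (b (?ws ! l)) (?D (take l ws)) \<le> U l - V l"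
      proof (rule rel_order_le_difference [where h = "n ^ e" and k = k and n = n and w = "\<lambda>l. ?ws ! l"
          and a = a and b = b and j = l and U = U and V = V, OF finT indep])
        show "a (?ws ! i) dvd int (?D (take l ws)) * b (?ws ! i) t" if "i < l" "t \<in> T" for i t
        proof (rule common_denominator_dvd)
          show "?ws ! i \<in> set (take l ws)"
            using that llen by (auto simp: in_set_conv_nth intro!: exI [of _ i])
          show "a x \<noteq> 0" if "x \<in> set (take l ws)" for x
            using that a(1) setG in_set_takeD by metis
        qed fact
        \<comment> \<open>The reason for the exponent in \<open>indep\<close>:
          \<open>(2 * B + 1) * q * e\<close> pays for the denominator, and \<open>4 * e\<close> for
          \<open>l + 3 \<le> n\<close>, for \<open>n\<close> and for two factors
          \<open>n ^ e\<close>.\<close>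
        have "(l + 3) * n * ?D (take l ws) * n ^ e * n ^ e \<le> n * n * n ^ ?X * n ^ e * n ^ e"
          using Dl llen len Sn by (intro mult_le_mono) auto
        also have "\<dots> = n ^ (1 + 1 + ?X + e + e)"
          by (simp only: power_add power_one_right)
        also have "\<dots> \<le> n ^ (((2 * B + 1) * q + 4) * e)"
          using n e by (intro power_increasing) (auto simp: algebra_simps)
        finally show "(l + 3) * n * ?D (take l ws) * n ^ e * n ^ e \<le> n ^ (((2 * B + 1) * q + 4) * e)" .
      qed (use a b ab wsG llen n kn U V close lt in \<open>simp_all add: wsi\<close>)
      then show ?thesis using wsi by simp
    qed
    ultimately have prod: "(\<Prod>l<j. min (?ml l) k) \<le> n ^ (2 * B + 1)" and "8 ^ j \<le> 4 * n ^ B"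
      using prefix_product [of ?ws ?ml] less.prems len unfolding lj by auto
    \<comment> \<open>Undoes the cap at \<open>k\<close>: an order above \<open>k\<close> is still
      at most \<open>n ^ e\<close>, which is at most \<open>k ^ (q * e)\<close>.\<close>
    have ml: "?ml l \<le> min (?ml l) k ^ (q * e)" if "l < j" for l
    proof (cases "?ml l \<le> k")
      case True
      have "?ml l ^ 1 \<le> ?ml l ^ (q * e)"
        using q e rel_order(1) [OF a(1) [OF wsG]] that less.prems by (intro power_increasing) (auto simp: Suc_le_eq)
      then show ?thesis using True by simp
    next
      case False
      have "?ml l \<le> nat \<bar>a (ws ! l)\<bar>"
        using a(1) wsG that less.prems by (intro rel_order_le) auto
      also have "\<dots> \<le> n ^ e"
        using a(2) [of "ws ! l"] wsG that less.prems by (simp add: nat_le_iff)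
      also have "\<dots> \<le> (k ^ q) ^ e"
        using nk by (rule power_mono) simp
      finally show ?thesis using False by (simp add: power_mult)
    qed
    have "?D ?ws = (\<Prod>l<j. ?ml l)"
      using less.prems by (rule common_denominator_take)
    also have "\<dots> \<le> (\<Prod>l<j. min (?ml l) k ^ (q * e))"
      using ml by (intro prod_mono) auto
    also have "\<dots> = (\<Prod>l<j. min (?ml l) k) ^ (q * e)"
      by (rule prod_power_distrib [symmetric])
    also have "\<dots> \<le> (n ^ (2 * B + 1)) ^ (q * e)"
      using prod by (rule power_mono) simp
    also have "\<dots> = n ^ ?X"
      by (simp only: power_mult)
    finally show ?case using \<open>8 ^ j \<le> 4 * n ^ B\<close> by simp
  qed
  have D: "0 < ?D ws" "?D ws \<le> n ^ ?X"
    using main [of "length ws"] a(1) setG by (auto intro!: common_denominator_pos)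
  have "8 ^ length ws \<le> 4 * n ^ B"
    using main [of "length ws"] by simp
  then have "length ws \<noteq> S" using S by auto
  then have bad: "card {i \<in> {1..n}. ?Bad ws i} \<le> (length ws + 1) * N" and "length ws + 1 \<le> S"
    using alt by auto
  then have badS: "card {i \<in> {1..n}. ?Bad ws i} \<le> S * N"
    by (meson mult_le_mono1 order_trans)
  have good: "approximable u T (fact 63 * ?D ws) (real (fact 63 * ?D ws) * real (n ^ e)) i"
    if "i \<in> G" "\<not> ?Bad ws i" for i
  proof -
    let ?M = "fact 63 * ?D ws"
    have dvd: "a i dvd int ?M * b i t" if "t \<in> T" for t
    proof -
      have "?m ws i dvd fact 63"
        using \<open>\<not> ?Bad ws i\<close> \<open>i \<in> G\<close> rel_order(1) [OF a(1) [OF \<open>i \<in> G\<close>]]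
        by (intro dvd_fact) (auto simp: Suc_le_eq)
      then obtain y where y: "fact 63 = ?m ws i * y" by blast
      have "a i dvd int (?m ws i) * int (?D ws) * b i t"
        using a(1) \<open>i \<in> G\<close> that by (intro rel_order) auto
      then have "a i dvd int y * (int (?m ws i) * int (?D ws) * b i t)"
        by (rule dvd_mult)
      moreover have "int ?M * b i t = int y * (int (?m ws i) * int (?D ws) * b i t)"
        unfolding y by (simp add: mult_ac)
      ultimately show ?thesis by (simp only:)
    qed
    obtain g where g: "\<forall>t\<in>T. int ?M * b i t = a i * g t \<and> \<bar>g t\<bar> \<le> int ?M * int (n ^ e)"
      "norm (real ?M *\<^sub>R u i - (\<Sum>t\<in>T. of_int (g t) *\<^sub>R u t)) \<le> real ?M * real (n ^ e)"
      using clear_denominator [OF a(1) b ab dvd] \<open>i \<in> G\<close> by blast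
    have "real_of_int \<bar>g t\<bar> \<le> real ?M * real (n ^ e)" if "t \<in> T" for t
    proof -
      have "\<bar>g t\<bar> \<le> int (?M * n ^ e)" using g that by simp
      then have "real_of_int \<bar>g t\<bar> \<le> real_of_int (int (?M * n ^ e))" by (simp only: of_int_le_iff)
      then show ?thesis by (simp only: of_int_of_nat_eq of_nat_mult of_int_mult)
    qed
    then show ?thesis
      using g unfolding approximable_def by blast
  qed
  have "card {i \<in> G. \<not> approximable u T (fact 63 * ?D ws) (real (fact 63 * ?D ws) * real (n ^ e)) i}
      \<le> card {i \<in> {1..n}. ?Bad ws i}"
    using G good by (intro card_mono) auto
  then show ?thesis
    using D badS by (intro exI [of _ "?D ws"]) auto
qed

text \<open>Each greedy run gives up at most \<open>S * N\<close> indices. Between the runs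
  \<open>rank_reduction\<close> opens the gap between the scale of dependence and that of
  independence which the second run requires.\<close>

lemma inverse_theorem:
  "\<exists>D T. 0 < D \<and> D \<le> n ^ ((2 * B + 1) * (q * exponent_bound B q)) \<and> T \<subseteq> {1..n} \<and> card T \<le> rank_bound B q \<and>
    card {i \<in> {1..n}. \<not> approximable u T (fact 63 * D) (real (fact 63 * D) * real (n ^ exponent_bound B q)) i} \<le> 2 * S * N"
proof -
  let ?K = "(2 * B + 1) * q + 4"
  obtain T0 where T0: "T0 \<subseteq> {1..n}" "card T0 \<le> rank_bound B q"
    and bad0: "card {i \<in> {1..n}. \<not> dependent_at u T0 (n\<^sup>2) i} \<le> S * N"
    using few_generators unfolding rank_bound_def by blast
  define G where "G = {i \<in> {1..n}. dependent_at u T0 (n\<^sup>2) i}"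
  have fin: "finite T0" using T0 finite_subset by auto
  obtain T e where T: "T \<subseteq> T0" "2 \<le> e" "e \<le> (3 * ?K) ^ card T0 * 2"
    "\<forall>i\<in>G. dependent_at u T (n ^ e) i" "independent_at u T (n ^ (?K * e))"
    using rank_reduction [OF fin, of n ?K 2 G u] n by (auto simp: G_def)
  have e: "e \<le> exponent_bound B q"
  proof -
    have "(3 * ?K) ^ card T0 \<le> (3 * ?K) ^ rank_bound B q"
      using T0 by (intro power_increasing) auto
    then show ?thesis using T unfolding exponent_bound_def by linarith
  qed
  have Tn: "T \<subseteq> {1..n}" and Gn: "G \<subseteq> {1..n}"
    using T(1) T0(1) by (auto simp: G_def)
  obtain D where D: "0 < D" "D \<le> n ^ ((2 * B + 1) * (q * e))"
    and bad: "card {i \<in> G. \<not> approximable u T (fact 63 * D) (real (fact 63 * D) * real (n ^ e)) i} \<le> S * N"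
    using exists_common_multiple [OF Tn Gn _ T(4,5)] T(2) by auto
  note D(2)
  also have "n ^ ((2 * B + 1) * (q * e)) \<le> n ^ ((2 * B + 1) * (q * exponent_bound B q))"
    using n e by (intro power_increasing mult_le_mono) auto
  finally have D2: "D \<le> n ^ ((2 * B + 1) * (q * exponent_bound B q))" .
  have mono: "approximable u T (fact 63 * D) (real (fact 63 * D) * real (n ^ exponent_bound B q)) i"
    if "approximable u T (fact 63 * D) (real (fact 63 * D) * real (n ^ e)) i" for i
  proof -
    have "n ^ e \<le> n ^ exponent_bound B q" using n e by (intro power_increasing) auto
    then have "real (fact 63 * D) * real (n ^ e) \<le> real (fact 63 * D) * real (n ^ exponent_bound B q)"
      by (intro mult_left_mono) (simp_all only: of_nat_le_iff of_nat_0_le_iff)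
    then show ?thesis
      using that unfolding approximable_def by (meson order_trans)
  qed
  let ?bad = "{i \<in> G. \<not> approximable u T (fact 63 * D) (real (fact 63 * D) * real (n ^ e)) i}"
  have "card {i \<in> {1..n}. \<not> approximable u T (fact 63 * D) (real (fact 63 * D) * real (n ^ exponent_bound B q)) i}
    \<le> card ({i \<in> {1..n}. \<not> dependent_at u T0 (n\<^sup>2) i} \<union> ?bad)"
    using mono by (intro card_mono) (auto simp: G_def)
  also have "\<dots> \<le> card {i \<in> {1..n}. \<not> dependent_at u T0 (n\<^sup>2) i} + card ?bad"
    by (rule card_Un_le)
  also have "\<dots> \<le> 2 * S * N"
    using bad bad0 by simp
  finally show ?thesis
    using D D2 T T0 card_mono [OF fin T(1)] by (intro exI [of _ D] exI [of _ T]) auto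
qed

end

section \<open>The inverse theorem for vectors\<close>

text \<open>\<open>k\<close> is about \<open>n powr (\<epsilon> / 3)\<close>, a power of
  \<open>n\<close> so that the rank is bounded; \<open>S\<close> is about
  \<open>log 8 (4 * n ^ B)\<close>; and \<open>N\<close> is of order \<open>k^2 * ln n\<close>, as
  the error of the Fejer majorant demands. So \<open>S * N\<close> is of order
  \<open>n powr (2 * \<epsilon> / 3)\<close> times squared logarithms.\<close>

lemma eventually_parameters:
  fixes \<epsilon> c :: real and B :: nat
  assumes \<epsilon>: "0 < \<epsilon>" "\<epsilon> < 1" and c: "0 < c"
  shows "\<exists>q. eventually (\<lambda>n. \<exists>k N S. 16 \<le> n \<and> 64 \<le> k \<and> k \<le> n \<and> n \<le> k ^ q \<and> 0 < N \<and>
      4 * n ^ B < 8 ^ S \<and> S + 3 \<le> n \<and>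
      real S * exp (- (c * real N) / (8 * (real k)\<^sup>2)) * 4 ^ S \<le> 1 / (2 * real n ^ B) \<and>
      exp (- (real n)\<^sup>2 / 2) \<le> 1 / (4 * 4 ^ S * real n ^ B) \<and>
      real (2 * S * N) \<le> real n powr \<epsilon>) sequentially"
proof -
  \<comment> \<open>The rounded \<open>k\<close> is at least \<open>n powr (\<epsilon> / 4)\<close>,
    whence \<open>4 / \<epsilon>\<close>.\<close>
  define q where "q = nat \<lceil>4 / \<epsilon>\<rceil>"
  have q: "4 / \<epsilon> \<le> real q" unfolding q_def by linarith
  \<comment> \<open>The error factor is at most \<open>n powr (- E)\<close>. Against
    \<open>S \<le> n\<close> and \<open>4 ^ S \<le> 32 * n ^ B\<close> this leaves
    \<open>n ^ B\<close> for the target and \<open>n^2\<close> for the constants.\<close>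
  define E where "E = 2 * real B + 3"
  have E: "0 < E" by (simp add: E_def)
  have e1: "eventually (\<lambda>n. 65 \<le> real n powr (\<epsilon>/3)) sequentially"
    using \<epsilon> by real_asymp
  have e2: "eventually (\<lambda>n. real n powr (\<epsilon>/4) \<le> real n powr (\<epsilon>/3) - 1) sequentially"
    using \<epsilon> by real_asymp
  have e3: "eventually (\<lambda>n. 2 * (log 8 (4 * real n powr real B) + 1) * (8 * real n powr (2 * \<epsilon> / 3) * E * ln (real n) / c + 1) \<le> real n powr \<epsilon>) sequentially"
    using \<epsilon> c E by real_asymp
  have e4: "eventually (\<lambda>n. log 8 (4 * real n powr real B) + 4 \<le> real n) sequentially"
    by real_asymp
  have e5: "eventually (\<lambda>n. 128 * real n powr (2 * real B) \<le> exp ((real n)\<^sup>2 / 2)) sequentially"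
    by real_asymp
  have e6: "eventually (\<lambda>n. 16 \<le> n) sequentially"
    by (rule eventually_ge_at_top)
  show ?thesis
  proof (rule exI [of _ q])
    show "eventually (\<lambda>n. \<exists>k N S. 16 \<le> n \<and> 64 \<le> k \<and> k \<le> n \<and> n \<le> k ^ q \<and> 0 < N \<and>
      4 * n ^ B < 8 ^ S \<and> S + 3 \<le> n \<and>
      real S * exp (- (c * real N) / (8 * (real k)\<^sup>2)) * 4 ^ S \<le> 1 / (2 * real n ^ B) \<and>
      exp (- (real n)\<^sup>2 / 2) \<le> 1 / (4 * 4 ^ S * real n ^ B) \<and>
      real (2 * S * N) \<le> real n powr \<epsilon>) sequentially"
      using e1 e2 e3 e4 e5 e6
    proof eventually_elim
      case (elim n)
      have n: "16 \<le> n" "1 \<le> real n" "0 < real n" using elim(6) by auto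
      have powB: "real n powr real B = real n ^ B" using n by (simp add: powr_realpow)
      define k where "k = nat \<lfloor>real n powr (\<epsilon>/3)\<rfloor>"
      have k1: "real k \<le> real n powr (\<epsilon>/3)" "real n powr (\<epsilon>/3) - 1 \<le> real k"
        unfolding k_def using elim(1) by (auto simp: of_nat_nat)
      have k64: "64 \<le> k" using k1 elim(1) by linarith
      have "real n powr (\<epsilon>/3) \<le> real n powr 1"
        using \<epsilon> n by (intro powr_mono) auto
      then have kn: "k \<le> n" using k1 n by simp
      have "real n = real n powr 1" using n by simp
      also have "\<dots> \<le> real n powr (\<epsilon>/4 * real q)"
      proof (rule powr_mono)
        have "\<epsilon>/4 * (4/\<epsilon>) \<le> \<epsilon>/4 * real q" using q \<epsilon> by (intro mult_left_mono) auto
        then show "1 \<le> \<epsilon>/4 * real q" using \<epsilon> by simp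
      qed (use n in auto)
      also have "\<dots> = (real n powr (\<epsilon>/4)) ^ q"
        unfolding powr_powr [symmetric] using n by (subst powr_realpow) auto
      also have "\<dots> \<le> real k ^ q"
        using k1 elim(2) by (intro power_mono) auto
      finally have nk: "n \<le> k ^ q" by (metis of_nat_le_iff of_nat_power)
      define x where "x = log 8 (4 * real n ^ B)"
      have x0: "0 \<le> x" unfolding x_def using n by (simp add: mult_ge1_I)
      have x8: "8 powr x = 4 * real n ^ B" unfolding x_def using n by simp
      define S where "S = nat \<lfloor>x\<rfloor> + 1"
      have S1: "x < real S" "real S \<le> x + 1" unfolding S_def using x0 by linarith+
      have "8 powr x < 8 powr real S" using S1 by simp
      then have "real (4 * n ^ B) < real (8 ^ S)" unfolding x8 by (simp add: powr_realpow)
      then have S8: "4 * n ^ B < 8 ^ S" by (simp only: of_nat_less_iff)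
      have "8 powr real S \<le> 8 powr (x + 1)" using S1 by simp
      then have "8 ^ S \<le> 32 * real n ^ B" by (simp add: powr_add x8 powr_realpow)
      moreover have "(4::real) ^ S \<le> 8 ^ S" by (rule power_mono) auto
      ultimately have S4: "4 ^ S \<le> 32 * real n ^ B" by linarith
      have Sn: "S + 3 \<le> n" using S1 elim(4) unfolding powB x_def [symmetric] by linarith
      define y where "y = 8 * (real k)\<^sup>2 * E * ln (real n) / c"
      have k2: "(real k)\<^sup>2 \<le> real n powr (2 * \<epsilon> / 3)"
      proof -
        have "(real k)\<^sup>2 \<le> (real n powr (\<epsilon>/3))\<^sup>2" using k1 by (intro power_mono) auto
        also have "\<dots> = real n powr (2 * \<epsilon> / 3)" by (simp add: power2_eq_square powr_add [symmetric])
        finally show ?thesis .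
      qed
      have lnn: "0 < ln (real n)" using n by simp
      have y0: "0 < y" unfolding y_def using k64 E c lnn by simp
      define N where "N = nat \<lceil>y\<rceil>"
      have N1: "y \<le> real N" "real N \<le> y + 1" "0 < N" unfolding N_def using y0 by linarith+
      have "E * ln (real n) = c * y / (8 * (real k)\<^sup>2)"
        unfolding y_def using k64 c by simp
      also have "\<dots> \<le> c * real N / (8 * (real k)\<^sup>2)"
        using N1 c by (intro divide_right_mono mult_left_mono) auto
      finally have "exp (- (c * real N) / (8 * (real k)\<^sup>2)) \<le> exp (- (E * ln (real n)))" by simp
      also have "\<dots> = 1 / (real n ^ B * real n ^ B * real n ^ 3)"
      proof -
        have "exp (E * ln (real n)) = real n powr (real (B + B + 3))"
          using n by (simp add: powr_def E_def)
        also have "\<dots> = real n ^ B * real n ^ B * real n ^ 3"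
          using powr_realpow [OF n(3), of "B + B + 3"] by (simp only: power_add)
        finally show ?thesis by (simp add: exp_minus field_simps)
      qed
      finally have ex: "exp (- (c * real N) / (8 * (real k)\<^sup>2)) \<le> 1 / (real n ^ B * real n ^ B * real n ^ 3)" .
      have "real S * exp (- (c * real N) / (8 * (real k)\<^sup>2)) * 4 ^ S
          \<le> real n * (1 / (real n ^ B * real n ^ B * real n ^ 3)) * (32 * real n ^ B)"
        using Sn ex S4 by (intro mult_mono) auto
      also have "\<dots> = 32 / (real n ^ B * (real n)\<^sup>2)"
        using n by (simp add: field_simps power2_eq_square power3_eq_cube)
      also have "\<dots> \<le> 1 / (2 * real n ^ B)"
      proof -
        have "16\<^sup>2 \<le> (real n)\<^sup>2" using n by (intro power_mono) auto
        then have "64 \<le> (real n)\<^sup>2" by simp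
        then show ?thesis using n by (simp add: field_simps)
      qed
      finally have err: "real S * exp (- (c * real N) / (8 * (real k)\<^sup>2)) * 4 ^ S \<le> 1 / (2 * real n ^ B)" .
      have "4 * 4 ^ S * real n ^ B \<le> 4 * (32 * real n ^ B) * real n ^ B"
        using S4 by (intro mult_right_mono mult_left_mono) auto
      also have "\<dots> = 128 * real n powr (2 * real B)"
      proof -
        have "2 * real B = real (B + B)" by simp
        then have "real n powr (2 * real B) = real n ^ B * real n ^ B"
          using powr_realpow [OF n(3), of "B + B"] by (simp only: power_add)
        then show ?thesis by simp
      qed
      also have "\<dots> \<le> exp ((real n)\<^sup>2 / 2)" by (rule elim(5))
      finally have "1 / exp ((real n)\<^sup>2 / 2) \<le> 1 / (4 * 4 ^ S * real n ^ B)"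
        using n by (intro divide_left_mono) auto
      then have errR: "exp (- (real n)\<^sup>2 / 2) \<le> 1 / (4 * 4 ^ S * real n ^ B)"
        by (simp add: exp_minus field_simps)
      have "real (2 * S * N) \<le> 2 * (x + 1) * (8 * real n powr (2 * \<epsilon> / 3) * E * ln (real n) / c + 1)"
      proof -
        have "y \<le> 8 * real n powr (2 * \<epsilon> / 3) * E * ln (real n) / c"
          unfolding y_def using k2 E c lnn by (intro divide_right_mono mult_right_mono mult_left_mono) auto
        then have "real N \<le> 8 * real n powr (2 * \<epsilon> / 3) * E * ln (real n) / c + 1" using N1 by linarith
        then have "2 * real S * real N \<le> 2 * (x + 1) * (8 * real n powr (2 * \<epsilon> / 3) * E * ln (real n) / c + 1)"
          using S1 x0 by (intro mult_mono) auto
        then show ?thesis by simp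
      qed
      also have "\<dots> \<le> real n powr \<epsilon>"
        using elim(3) unfolding powB x_def [symmetric] .
      finally have fin: "real (2 * S * N) \<le> real n powr \<epsilon>" .
      show ?case
        using n k64 kn nk N1 S8 Sn err errR fin by blast
    qed
  qed
qed

section \<open>Pigeonholing over structures\<close>

text \<open>Two pigeonholes with an averaging in between. Some \<open>\<tau>\<close> works on a set
  \<open>\<Omega> \<tau>\<close> of measure at least \<open>\<delta> / Z\<close>. At each of its
  points at most \<open>L\<close> indices fail, so at most \<open>2 * L\<close> indices fail on more
  than half of it. For any other index, half of \<open>\<Omega> \<tau>\<close> is covered by at most
  \<open>W\<close> events \<open>E \<tau> i \<kappa>\<close>.\<close>

lemma (in prob_space) exists_uniform_structure:
  fixes L :: real and E :: "'p \<Rightarrow> 'i \<Rightarrow> 'k \<Rightarrow> 'a set"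
  assumes fin: "finite \<Theta>" "finite I" "\<And>\<tau>. \<tau> \<in> \<Theta> \<Longrightarrow> finite (K \<tau>)"
    and E: "\<And>\<tau> i \<kappa>. E \<tau> i \<kappa> \<in> events"
    and g: "integrable M g" "\<And>y. y \<in> space M \<Longrightarrow> g y \<le> 1" and \<delta>: "0 < \<delta>" "2 * \<delta> \<le> (\<integral>y. g y \<partial>M)"
    and good: "\<And>y. y \<in> space M \<Longrightarrow> \<delta> \<le> g y \<Longrightarrow> \<exists>\<tau>\<in>\<Theta>. real (card {i \<in> I. \<forall>\<kappa>\<in>K \<tau>. y \<notin> E \<tau> i \<kappa>}) \<le> L"
    and W: "\<And>\<tau>. \<tau> \<in> \<Theta> \<Longrightarrow> card (K \<tau>) \<le> W" and \<Theta>W: "card \<Theta> \<le> Z" "0 < W"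
  shows "\<exists>\<tau>\<in>\<Theta>. \<exists>J\<subseteq>I. real (card I) - 2 * L \<le> real (card J) \<and>
     (\<forall>i\<in>J. \<exists>\<kappa>\<in>K \<tau>. \<delta> / (2 * real Z * real W) \<le> prob (E \<tau> i \<kappa>))"
proof -
  define F where "F \<tau> i = (\<Inter>\<kappa>\<in>K \<tau>. space M - E \<tau> i \<kappa>) \<inter> space M" for \<tau> i
  define \<Omega> where "\<Omega> \<tau> = {y \<in> space M. (\<Sum>i\<in>I. indicator (F \<tau> i) y) \<le> L}" for \<tau>
  have F[measurable]: "F \<tau> i \<in> events" if "\<tau> \<in> \<Theta>" for \<tau> i
  proof (cases "K \<tau> = {}")
    case False
    then show ?thesis
      unfolding F_def using fin(3) [OF that] E by (intro sets.Int sets.finite_INT) auto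
  qed (simp add: F_def)
  have \<Omega>: "\<Omega> \<tau> \<in> events" if [measurable]: "\<tau> \<in> \<Theta>" for \<tau>
  proof -
    have [measurable]: "(\<lambda>y. \<Sum>i\<in>I. indicator (F \<tau> i) y :: real) \<in> borel_measurable M"
      using F [OF that] by (intro borel_measurable_sum) auto
    show ?thesis unfolding \<Omega>_def by measurable
  qed
  have ind: "(\<Sum>i\<in>I. indicator (F \<tau> i) y :: real) = real (card {i \<in> I. \<forall>\<kappa>\<in>K \<tau>. y \<notin> E \<tau> i \<kappa>})"
    if "y \<in> space M" for \<tau> y
  proof -
    have "(\<Sum>i\<in>I. indicator (F \<tau> i) y :: real) = (\<Sum>i\<in>I. if (\<forall>\<kappa>\<in>K \<tau>. y \<notin> E \<tau> i \<kappa>) then 1 else 0)"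
      using that by (intro sum.cong) (auto simp: F_def indicator_def)
    then show ?thesis
      using fin(2) by (simp add: sum.If_cases Int_def)
  qed
  let ?U = "\<Union>\<tau>\<in>\<Theta>. \<Omega> \<tau>"
  have U: "?U \<in> events" using fin(1) \<Omega> by auto
  \<comment> \<open>Since \<open>g\<close> is at most 1, and below \<open>\<delta>\<close> outside
    the union, integration gives the union measure at least
    \<open>2 * \<delta> - \<delta>\<close>.\<close>
  have gU: "g y \<le> indicator ?U y + \<delta>" if "y \<in> space M" for y
  proof (cases "\<delta> \<le> g y")
    case True
    then have "y \<in> ?U" using good [OF that] that by (auto simp: \<Omega>_def ind)
    then show ?thesis using g(2) [OF that] \<delta> by (simp add: indicator_def)
  qed (simp add: indicator_def)
  have "2 * \<delta> \<le> (\<integral>y. g y \<partial>M)" by (rule \<delta>)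
  also have "\<dots> \<le> (\<integral>y. indicator ?U y + \<delta> \<partial>M)"
    using g(1) gU U by (intro integral_mono) (auto simp: less_top [symmetric])
  also have "\<dots> = prob ?U + \<delta>"
    using U by (subst Bochner_Integration.integral_add) (auto simp: prob_space less_top [symmetric] Int_absorb1 sets.sets_into_space)
  finally have "\<delta> \<le> prob ?U" by simp
  also have "prob ?U \<le> (\<Sum>\<tau>\<in>\<Theta>. prob (\<Omega> \<tau>))"
    using fin(1) \<Omega> by (intro finite_measure_subadditive_finite) auto
  finally have sum\<Omega>: "\<delta> \<le> (\<Sum>\<tau>\<in>\<Theta>. prob (\<Omega> \<tau>))" .
  have \<Theta>ne: "\<Theta> \<noteq> {}" using sum\<Omega> \<delta> by auto
  then have Z: "0 < Z" using fin(1) \<Theta>W by (metis card_gt_0_iff order_less_le_trans)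
  have "\<exists>\<tau>\<in>\<Theta>. \<delta> / real Z \<le> prob (\<Omega> \<tau>)"
  proof (rule ccontr)
    assume "\<not> ?thesis"
    then have "(\<Sum>\<tau>\<in>\<Theta>. prob (\<Omega> \<tau>)) < (\<Sum>\<tau>\<in>\<Theta>. \<delta> / real Z)"
      using fin(1) \<Theta>ne by (intro sum_strict_mono) (auto simp: not_le)
    also have "\<dots> = real (card \<Theta>) * \<delta> / real Z" by simp
    also have "\<dots> \<le> \<delta>" using \<Theta>W Z \<delta> by (simp add: divide_le_eq mult.commute)
    finally show False using sum\<Omega> by simp
  qed
  then obtain \<tau> where \<tau>: "\<tau> \<in> \<Theta>" "\<delta> / real Z \<le> prob (\<Omega> \<tau>)" by blast
  define p where "p = prob (\<Omega> \<tau>)"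
  have "0 < \<delta> / real Z" using \<delta> Z by simp
  then have p: "0 < p" "\<delta> / real Z \<le> p" using \<tau> unfolding p_def by linarith+
  \<comment> \<open>The threshold one half is the source of the factor 2 in front of
    \<open>L\<close>.\<close>
  define bad where "bad = {i \<in> I. p / 2 < prob (\<Omega> \<tau> \<inter> F \<tau> i)}"
  have OF: "\<Omega> \<tau> \<inter> F \<tau> i \<in> events" for i using \<Omega> F \<tau>(1) by auto
  have "real (card bad) * (p / 2) \<le> (\<Sum>i\<in>bad. prob (\<Omega> \<tau> \<inter> F \<tau> i))"
    using sum_mono [of bad "\<lambda>_. p / 2" "\<lambda>i. prob (\<Omega> \<tau> \<inter> F \<tau> i)"] by (auto simp: bad_def)
  also have "\<dots> \<le> (\<Sum>i\<in>I. prob (\<Omega> \<tau> \<inter> F \<tau> i))"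
    using fin(2) by (intro sum_mono2) (auto simp: bad_def)
  also have "\<dots> = (\<integral>y. (\<Sum>i\<in>I. indicator (\<Omega> \<tau> \<inter> F \<tau> i) y) \<partial>M)"
    using OF by (subst Bochner_Integration.integral_sum) (auto simp: less_top [symmetric] Int_absorb1 sets.sets_into_space)
  also have "\<dots> \<le> (\<integral>y. L * indicator (\<Omega> \<tau>) y \<partial>M)"
  proof (rule integral_mono)
    show "integrable M (\<lambda>y. \<Sum>i\<in>I. indicator (\<Omega> \<tau> \<inter> F \<tau> i) y :: real)"
      using OF by (intro Bochner_Integration.integrable_sum) (auto simp: less_top [symmetric])
    show "integrable M (\<lambda>y. L * indicator (\<Omega> \<tau>) y)"
      using \<Omega> \<tau> by (auto simp: less_top [symmetric])
    show "(\<Sum>i\<in>I. indicator (\<Omega> \<tau> \<inter> F \<tau> i) y) \<le> L * indicator (\<Omega> \<tau>) y" for y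
      by (auto simp: \<Omega>_def indicator_inter_arith sum_distrib_left [symmetric] indicator_def)
  qed
  also have "\<dots> = L * p"
    using \<Omega> \<tau> by (simp add: p_def Int_absorb1 sets.sets_into_space)
  finally have "real (card bad) \<le> 2 * L" using p by (simp add: field_simps)
  moreover have "card (I - bad) = card I - card bad" "card bad \<le> card I"
    using fin(2) by (auto simp: bad_def intro!: card_Diff_subset card_mono)
  ultimately have J: "real (card I) - 2 * L \<le> real (card (I - bad))" by simp
  have "\<exists>\<kappa>\<in>K \<tau>. \<delta> / (2 * real Z * real W) \<le> prob (E \<tau> i \<kappa>)" if i: "i \<in> I - bad" for i
  proof (rule ccontr)
    assume neg: "\<not> ?thesis"
    have "prob (\<Omega> \<tau>) = prob (\<Omega> \<tau> \<inter> F \<tau> i) + prob (\<Omega> \<tau> - F \<tau> i)"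
      using \<Omega> F \<tau>(1) by (metis finite_measure_Union' Int_Diff_Un Diff_disjoint finite_measure_Diff' add.commute diff_add_cancel)
    moreover have "prob (\<Omega> \<tau> \<inter> F \<tau> i) \<le> p / 2" using i by (auto simp: bad_def)
    ultimately have "p / 2 \<le> prob (\<Omega> \<tau> - F \<tau> i)" by (simp add: p_def)
    also have "\<dots> \<le> prob (\<Union>\<kappa>\<in>K \<tau>. E \<tau> i \<kappa>)"
      using fin(3) [OF \<tau>(1)] E by (intro finite_measure_mono) (auto simp: F_def \<Omega>_def)
    also have "\<dots> \<le> (\<Sum>\<kappa>\<in>K \<tau>. prob (E \<tau> i \<kappa>))"
      using fin(3) [OF \<tau>(1)] E by (intro finite_measure_subadditive_finite) auto
    finally have le: "p / 2 \<le> (\<Sum>\<kappa>\<in>K \<tau>. prob (E \<tau> i \<kappa>))" .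
    then have "K \<tau> \<noteq> {}" using p by auto
    then have "(\<Sum>\<kappa>\<in>K \<tau>. prob (E \<tau> i \<kappa>)) < (\<Sum>\<kappa>\<in>K \<tau>. \<delta> / (2 * real Z * real W))"
      using neg fin(3) [OF \<tau>(1)] by (intro sum_strict_mono) (auto simp: not_le)
    also have "\<dots> = real (card (K \<tau>)) * (\<delta> / (2 * real Z * real W))" by simp
    also have "\<dots> \<le> real W * (\<delta> / (2 * real Z * real W))"
      using W [OF \<tau>(1)] \<delta> by (intro mult_right_mono) auto
    also have "\<dots> = \<delta> / real Z / 2" using \<Theta>W by simp
    finally show False using le p by simp
  qed
  then show ?thesis
    using \<tau>(1) J by (intro bexI [of _ \<tau>] exI [of _ "I - bad"]) auto
qed

lemma card_small_subsets_le:
  "finite {T. T \<subseteq> {1..n} \<and> card T \<le> C}" "card {T. T \<subseteq> {1..n::nat} \<and> card T \<le> C} \<le> (n + 1) ^ C"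
proof -
  let ?L = "{xs. set xs \<subseteq> {0..n} \<and> length xs = C}"
  show "finite {T. T \<subseteq> {1..n} \<and> card T \<le> C}"
    by (rule finite_subset [of _ "Pow {1..n}"]) auto
  have "{T. T \<subseteq> {1..n} \<and> card T \<le> C} \<subseteq> (\<lambda>xs. set xs - {0}) ` ?L"
  proof
    fix T assume T: "T \<in> {T. T \<subseteq> {1..n} \<and> card T \<le> C}"
    then have fin: "finite T" using finite_subset by auto
    have "0 \<notin> T" using T by auto
    \<comment> \<open>Sets of size at most \<open>C\<close> are coded by lists of length exactly
      \<open>C\<close>, with 0 as padding.\<close>
    then have "T = set (sorted_list_of_set T @ replicate (C - card T) 0) - {0}"
      using fin by (auto simp: set_replicate_conv_if)
    then show "T \<in> (\<lambda>xs. set xs - {0}) ` ?L"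
      by (rule image_eqI) (use T fin in \<open>auto simp: set_replicate_conv_if split: if_splits\<close>)
  qed
  then have "card {T. T \<subseteq> {1..n} \<and> card T \<le> C} \<le> card ?L"
    using finite_lists_length_eq [of "{0..n}" C] by (intro surj_card_le) auto
  also have "\<dots> = (n + 1) ^ C"
    by (subst card_lists_length_eq) auto
  finally show "card {T. T \<subseteq> {1..n} \<and> card T \<le> C} \<le> (n + 1) ^ C" .
qed

text \<open>After rescaling to radius 1, the vectors \<open>(\<eta> / \<beta>) *\<^sub>R v i\<close>
  form a \<open>concentrated_family\<close> for a suitable increment \<open>\<eta>\<close>. Scaling
  the conclusion back costs a factor \<open>1 / c1\<close>, because the size of
  \<open>\<eta>\<close> is at least \<open>c1\<close>.\<close>

lemma inverse_Littlewood_Offord: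
  fixes \<epsilon> c1 c2 c3 :: real and B :: nat
  assumes \<epsilon>: "0 < \<epsilon>" "\<epsilon> < 1" and c1: "0 < c1" and c3: "0 < c3"
  shows "\<exists>C. eventually (\<lambda>n. \<forall>\<mu> \<beta> a. \<forall>v :: nat \<Rightarrow> 'a::euclidean_space.
    real_distribution \<mu> \<longrightarrow> anti_concentrated c1 c2 c3 \<mu> \<longrightarrow> 0 < \<beta> \<longrightarrow>
    1 / real n ^ B \<le> \<P>(x in iid_copies \<mu> n. norm ((\<Sum>i\<in>{1..n}. x i *\<^sub>R v i) - a) \<le> \<beta>) \<longrightarrow>
    (\<exists>k T. 0 < k \<and> k \<le> n ^ C \<and> T \<subseteq> {1..n} \<and> card T \<le> C \<and>
      real (card {i \<in> {1..n}. \<not> (\<exists>\<kappa> :: nat \<Rightarrow> int. (\<forall>t\<in>T. \<bar>\<kappa> t\<bar> \<le> int (n ^ C)) \<and>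
        norm (real k *\<^sub>R v i + (\<Sum>t\<in>T. of_int (\<kappa> t) *\<^sub>R v t)) \<le> \<beta> * real (n ^ C))}) \<le> real n powr \<epsilon>)) sequentially"
proof -
  obtain q where ev: "eventually (\<lambda>n. \<exists>k N S. 16 \<le> n \<and> 64 \<le> k \<and> k \<le> n \<and> n \<le> k ^ q \<and> 0 < N \<and>
      4 * n ^ (B + 1) < 8 ^ S \<and> S + 3 \<le> n \<and>
      real S * exp (- (c3 / 2 * real N) / (8 * (real k)\<^sup>2)) * 4 ^ S \<le> 1 / (2 * real n ^ (B + 1)) \<and>
      exp (- (real n)\<^sup>2 / 2) \<le> 1 / (4 * 4 ^ S * real n ^ (B + 1)) \<and>
      real (2 * S * N) \<le> real n powr \<epsilon>) sequentially"
    using eventually_parameters [OF \<epsilon>, of "c3 / 2" "B + 1"] c3 by auto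
  define e where "e = exponent_bound (B + 1) q"
  define X where "X = (2 * (B + 1) + 1) * (q * e)"
  \<comment> \<open>\<open>X\<close> bounds the exponent of the denominator and \<open>e\<close>
    that of the error; the 1 absorbs \<open>fact 63\<close> and \<open>1 / c1\<close>, and the rank
    bound lets the same \<open>C\<close> bound \<open>card T\<close>.\<close>
  define C where "C = X + e + 1 + rank_bound (B + 1) q"
  have ev2: "eventually (\<lambda>n. nat \<lceil>fact 63 * max 1 (1 / c1)\<rceil> \<le> n) sequentially"
    by (rule eventually_ge_at_top)
  show ?thesis
  proof (rule exI [of _ C], use ev ev2 in eventually_elim, intro allI impI)
    fix n :: nat and \<mu> :: "real measure" and \<beta> :: real and a :: 'a and v :: "nat \<Rightarrow> 'a"
    assume "\<exists>k N S. 16 \<le> n \<and> 64 \<le> k \<and> k \<le> n \<and> n \<le> k ^ q \<and> 0 < N \<and>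
      4 * n ^ (B + 1) < 8 ^ S \<and> S + 3 \<le> n \<and>
      real S * exp (- (c3 / 2 * real N) / (8 * (real k)\<^sup>2)) * 4 ^ S \<le> 1 / (2 * real n ^ (B + 1)) \<and>
      exp (- (real n)\<^sup>2 / 2) \<le> 1 / (4 * 4 ^ S * real n ^ (B + 1)) \<and>
      real (2 * S * N) \<le> real n powr \<epsilon>"
    then obtain k N S where par: "16 \<le> n" "64 \<le> k" "k \<le> n" "n \<le> k ^ q" "0 < N"
      "4 * n ^ (B + 1) < 8 ^ S" "S + 3 \<le> n"
      "real S * exp (- (c3 / 2 * real N) / (8 * (real k)\<^sup>2)) * 4 ^ S \<le> 1 / (2 * real n ^ (B + 1))"
      "exp (- (real n)\<^sup>2 / 2) \<le> 1 / (4 * 4 ^ S * real n ^ (B + 1))"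
      and SN: "real (2 * S * N) \<le> real n powr \<epsilon>"
      by blast
    assume "nat \<lceil>fact 63 * max 1 (1 / c1)\<rceil> \<le> n"
    then have nbig: "fact 63 * max 1 (1 / c1) \<le> real n" by linarith
    assume \<mu>: "real_distribution \<mu>" and ac: "anti_concentrated c1 c2 c3 \<mu>" and \<beta>: "0 < \<beta>"
      and prob: "1 / real n ^ B \<le> \<P>(x in iid_copies \<mu> n. norm ((\<Sum>i\<in>{1..n}. x i *\<^sub>R v i) - a) \<le> \<beta>)"
    have n0: "0 < real n" using par(1) by simp
    define w where "w i = (1 / \<beta>) *\<^sub>R v i" for i
    have "norm ((\<Sum>i\<in>{1..n}. x i *\<^sub>R w i) - (1 / \<beta>) *\<^sub>R a) = norm ((\<Sum>i\<in>{1..n}. x i *\<^sub>R v i) - a) / \<beta>" for x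
    proof -
      have "(\<Sum>i\<in>{1..n}. x i *\<^sub>R w i) - (1 / \<beta>) *\<^sub>R a = (1 / \<beta>) *\<^sub>R ((\<Sum>i\<in>{1..n}. x i *\<^sub>R v i) - a)"
        by (simp add: w_def scaleR_diff_right scaleR_sum_right mult.commute)
      then show ?thesis using \<beta> by simp
    qed
    then have "1 / real n ^ B \<le> \<P>(x in (\<Pi>\<^sub>M i\<in>{1..n}. \<mu>). norm ((\<Sum>i\<in>{1..n}. x i *\<^sub>R w i) - (1 / \<beta>) *\<^sub>R a) \<le> 1)"
      using prob \<beta> by (simp add: iid_copies_def)
    also have "\<dots> \<le> exp (1/2) * (\<integral>t. (\<Prod>i\<in>{1..n}. cmod (char \<mu> (pairing t (w i)))) \<partial>gauss)"
      by (rule prob_ball_le_integral_char [OF \<mu>]) simp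
    finally have "1 / real n ^ B / exp (1/2) \<le> (\<integral>t. (\<Prod>i\<in>{1..n}. cmod (char \<mu> (pairing t (w i)))) \<partial>gauss)"
      by (simp only: pos_divide_le_eq [OF exp_gt_zero] mult.commute)
    moreover have "0 < 1 / real n ^ B / exp (1/2)" using n0 by simp
    ultimately obtain \<eta> where \<eta>: "c1 \<le> \<bar>\<eta>\<bar>"
      and conc: "1 / real n ^ B / exp (1/2) / 2 \<le>
        (\<integral>t. exp (- (c3/2) * (\<Sum>i\<in>{1..n}. 1 - cos (pairing t (\<eta> *\<^sub>R w i)))) \<partial>gauss)"
      using exists_common_increment [OF \<mu> ac c3, of "{1..n}" "1 / real n ^ B / exp (1/2)" w] by auto
    define u where "u i = \<eta> *\<^sub>R w i" for i
    \<comment> \<open>Smoothing and the choice of \<open>\<eta>\<close> together lose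
      \<open>2 * exp (1/2)\<close>, less than \<open>n\<close>; hence \<open>B + 1\<close> in place
      of \<open>B\<close>.\<close>
    have "exp (1/2::real) \<le> exp 1" by simp
    then have "exp (1/2::real) \<le> 3" using exp_le by linarith
    then have "1 / real n ^ B / exp (1/2) / 2 \<ge> 1 / real n ^ B / real n"
      using par(1) n0 by (simp add: divide_simps)
    then have "1 / real n ^ (B + 1) \<le> (\<integral>t. exp (- (c3/2) * (\<Sum>i\<in>{1..n}. 1 - cos (pairing t (u i)))) \<partial>gauss)"
      using conc by (simp add: u_def mult.commute)
    then interpret concentrated_family u n k "B + 1" q N S "c3 / 2"
      using par c3 by unfold_locales auto
    obtain D T where D: "0 < D" "D \<le> n ^ X" and T: "T \<subseteq> {1..n}" "card T \<le> rank_bound (B + 1) q"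
      and bad: "card {i \<in> {1..n}. \<not> approximable u T (fact 63 * D) (real (fact 63 * D) * real (n ^ e)) i} \<le> 2 * S * N"
      using inverse_theorem unfolding X_def e_def by blast
    define h where "h = real (fact 63 * D) * real (n ^ e)"
    have fact1: "fact 63 \<le> real n" "fact 63 / c1 \<le> real n"
    proof -
      have "fact 63 * 1 \<le> fact 63 * max 1 (1 / c1)" "fact 63 * (1 / c1) \<le> fact 63 * max 1 (1 / c1)"
        by (intro mult_left_mono; simp)+
      moreover have "fact 63 * (1 / c1) = fact 63 / c1" by simp
      ultimately show "fact 63 \<le> real n" "fact 63 / c1 \<le> real n"
        using nbig by linarith+
    qed
    have nX: "real n * (real (n ^ X) * real (n ^ e)) \<le> real (n ^ C)"
    proof -
      have "n * (n ^ X * n ^ e) = n ^ (X + e + 1)" by (simp add: power_add)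
      also have "\<dots> \<le> n ^ C" using par(1) unfolding C_def by (intro power_increasing) auto
      finally show ?thesis by (metis of_nat_le_iff of_nat_mult)
    qed
    have DX: "real D \<le> real (n ^ X)" using D by (simp only: of_nat_le_iff)
    have hC: "h \<le> real (n ^ C)"
    proof -
      have "h = fact 63 * (real D * real (n ^ e))" by (simp add: h_def)
      also have "\<dots> \<le> real n * (real (n ^ X) * real (n ^ e))"
        using fact1 DX by (intro mult_mono) auto
      finally show ?thesis using nX by linarith
    qed
    have hC1: "h / c1 \<le> real (n ^ C)"
    proof -
      have "h / c1 = (fact 63 / c1) * (real D * real (n ^ e))" by (simp add: h_def)
      also have "\<dots> \<le> real n * (real (n ^ X) * real (n ^ e))"
        using fact1 DX by (intro mult_mono) auto
      finally show ?thesis using nX by linarith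
    qed
    have good: "\<exists>\<kappa> :: nat \<Rightarrow> int. (\<forall>t\<in>T. \<bar>\<kappa> t\<bar> \<le> int (n ^ C)) \<and>
        norm (real (fact 63 * D) *\<^sub>R v i + (\<Sum>t\<in>T. of_int (\<kappa> t) *\<^sub>R v t)) \<le> \<beta> * real (n ^ C)"
      if "approximable u T (fact 63 * D) h i" for i
    proof -
      obtain \<kappa> :: "nat \<Rightarrow> int" where \<kappa>: "\<forall>t\<in>T. real_of_int \<bar>\<kappa> t\<bar> \<le> h"
        "norm (real (fact 63 * D) *\<^sub>R u i - (\<Sum>t\<in>T. of_int (\<kappa> t) *\<^sub>R u t)) \<le> h"
        using \<open>approximable u T (fact 63 * D) h i\<close> unfolding approximable_def by blast
      have "real_of_int \<bar>\<kappa> t\<bar> \<le> real_of_int (int (n ^ C))" if "t \<in> T" for t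
        using \<kappa>(1) that hC by fastforce
      then have 1: "\<bar>- \<kappa> t\<bar> \<le> int (n ^ C)" if "t \<in> T" for t
        using that by (simp only: of_int_le_iff abs_minus_cancel)
      let ?z = "real (fact 63 * D) *\<^sub>R v i + (\<Sum>t\<in>T. of_int (- \<kappa> t) *\<^sub>R v t)"
      have "real (fact 63 * D) *\<^sub>R u i - (\<Sum>t\<in>T. of_int (\<kappa> t) *\<^sub>R u t) = (\<eta> / \<beta>) *\<^sub>R ?z"
        by (simp add: u_def w_def scaleR_diff_right scaleR_sum_right sum_negf mult_ac)
      then have "norm ((\<eta> / \<beta>) *\<^sub>R ?z) \<le> h"
        using \<kappa>(2) by (simp only:)
      then have "\<bar>\<eta>\<bar> / \<beta> * norm ?z \<le> h"
        using \<beta> by (simp only: norm_scaleR abs_divide abs_of_pos)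
      then have "\<bar>\<eta>\<bar> * norm ?z \<le> \<beta> * h"
        using \<beta> by (simp only: times_divide_eq_left pos_divide_le_eq mult.commute)
      moreover have "c1 * norm ?z \<le> \<bar>\<eta>\<bar> * norm ?z"
        using \<eta> by (rule mult_right_mono) simp
      ultimately have "norm ?z \<le> \<beta> * (h / c1)"
        using c1 by (simp only: times_divide_eq_right pos_le_divide_eq mult.commute)
      also have "\<dots> \<le> \<beta> * real (n ^ C)"
        using hC1 \<beta> by (intro mult_left_mono) auto
      finally show ?thesis
        using 1 by (intro exI [of _ "\<lambda>t. - \<kappa> t"]) blast
    qed
    have kC: "fact 63 * D \<le> n ^ C"
    proof -
      have "1 \<le> real (n ^ e)" using par(1) by simp
      then have "real (fact 63 * D) * 1 \<le> h" unfolding h_def by (intro mult_left_mono) auto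
      then have "real (fact 63 * D) \<le> real (n ^ C)" using hC by linarith
      then show ?thesis by (simp only: of_nat_le_iff)
    qed
    have "card {i \<in> {1..n}. \<not> (\<exists>\<kappa> :: nat \<Rightarrow> int. (\<forall>t\<in>T. \<bar>\<kappa> t\<bar> \<le> int (n ^ C)) \<and>
        norm (real (fact 63 * D) *\<^sub>R v i + (\<Sum>t\<in>T. of_int (\<kappa> t) *\<^sub>R v t)) \<le> \<beta> * real (n ^ C))}
      \<le> card {i \<in> {1..n}. \<not> approximable u T (fact 63 * D) h i}"
      by (rule card_mono) (simp, use good in blast)
    also have "\<dots> \<le> 2 * S * N" using bad by (simp only: h_def)
    finally have "real (card {i \<in> {1..n}. \<not> (\<exists>\<kappa> :: nat \<Rightarrow> int. (\<forall>t\<in>T. \<bar>\<kappa> t\<bar> \<le> int (n ^ C)) \<and>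
        norm (real (fact 63 * D) *\<^sub>R v i + (\<Sum>t\<in>T. of_int (\<kappa> t) *\<^sub>R v t)) \<le> \<beta> * real (n ^ C))}) \<le> real n powr \<epsilon>"
      using SN by (meson of_nat_le_iff order_trans)
    then show "\<exists>k T. 0 < k \<and> k \<le> n ^ C \<and> T \<subseteq> {1..n} \<and> card T \<le> C \<and>
      real (card {i \<in> {1..n}. \<not> (\<exists>\<kappa> :: nat \<Rightarrow> int. (\<forall>t\<in>T. \<bar>\<kappa> t\<bar> \<le> int (n ^ C)) \<and>
        norm (real k *\<^sub>R v i + (\<Sum>t\<in>T. of_int (\<kappa> t) *\<^sub>R v t)) \<le> \<beta> * real (n ^ C))}) \<le> real n powr \<epsilon>"
      using D kC T by (intro exI [of _ "fact 63 * D"] exI [of _ T]) (auto simp: C_def)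
  qed
qed

section \<open>The bilinear theorem\<close>

text \<open>\<open>n ^ b\<close> is the reciprocal of a lower bound for the initial probability, the
  2 comes from averaging over indices, and the other factors count the pairs \<open>(k, T)\<close>
  and the coefficient vectors.\<close>

lemma parameter_count_le:
  fixes n C b :: nat
  assumes "4 \<le> n"
  shows "n ^ b * (2 * (n ^ C * (n + 1) ^ C) * (2 * n ^ C + 1) ^ C) \<le> n ^ (b + 1 + C + 2 * C + (C + 2) * C)"
proof -
  have n1: "n + 1 \<le> n ^ 2"
    unfolding power2_eq_square using mult_le_mono1 [OF assms, of n] assms by linarith
  have "2 * n ^ C + 1 \<le> 3 * n ^ C" using assms by simp
  also have "\<dots> \<le> n ^ 2 * n ^ C"
    using n1 assms by (intro mult_le_mono1) linarith
  also have "\<dots> = n ^ (C + 2)" by (simp only: power_add mult.commute)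
  finally have n2: "2 * n ^ C + 1 \<le> n ^ (C + 2)" .
  have "n ^ b * (2 * (n ^ C * (n + 1) ^ C) * (2 * n ^ C + 1) ^ C) \<le>
      n ^ b * (n ^ 1 * (n ^ C * (n ^ 2) ^ C) * (n ^ (C + 2)) ^ C)"
    using n1 n2 assms by (intro mult_le_mono order_refl power_mono) auto
  also have "\<dots> = n ^ (b + 1 + C + 2 * C + (C + 2) * C)"
    by (simp only: power_add power_mult mult.assoc)
  finally show ?thesis .
qed

theorem theorem3p2:
  fixes \<epsilon> B c1 c2 c3 :: real
  assumes "0 < \<epsilon>" and "\<epsilon> < 1" and "B > 0"
    and "0 < c1" and "c1 < c2" and "c3 > 0"
  shows "\<exists>C::real. \<exists>n0::nat. C > 0 \<and> n0 > 0 \<and>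
    (\<forall>\<mu>. real_distribution \<mu> \<and> anti_concentrated c1 c2 c3 \<mu> \<longrightarrow>
      (\<forall>n\<ge>n0. \<forall>\<beta>::real. \<forall>A :: nat \<Rightarrow> nat \<Rightarrow> real ^ 'd.
        \<beta> > 0 \<longrightarrow>
        (SUP a. \<P>((x, y) in iid_copies \<mu> n \<Otimes>\<^sub>M iid_copies \<mu> n.
            norm ((\<Sum>i\<in>{1..n}. \<Sum>j\<in>{1..n}. (x i * y j) *\<^sub>R A i j) - a) \<le> \<beta>))
          \<ge> real n powr (- B) \<longrightarrow>
        (\<exists>(k::int) (r::nat) (idx :: nat \<Rightarrow> nat) (I :: nat set).
          k \<noteq> 0 \<and> real_of_int \<bar>k\<bar> \<le> real n powr C \<and>
          real r \<le> C \<and> (\<forall>l\<in>{1..r}. idx l \<in> {1..n}) \<and>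
          I \<subseteq> {1..n} \<and> real (card I) \<ge> real n - 2 * real n powr \<epsilon> \<and>
          (\<forall>i\<in>I. \<exists>\<kappa> :: nat \<Rightarrow> int.
            (\<forall>l\<in>{1..r}. real_of_int \<bar>\<kappa> (idx l)\<bar> \<le> real n powr C) \<and>
            \<P>(y in iid_copies \<mu> n.
                norm (\<Sum>j\<in>{1..n}. y j *\<^sub>R
                  (of_int k *\<^sub>R A i j + (\<Sum>l\<in>{1..r}. of_int (\<kappa> (idx l)) *\<^sub>R A (idx l) j)))
                \<le> \<beta> * real n powr C)
              \<ge> real n powr (- C)))))"
proof -
  \<comment> \<open>The added 1 pays for the 4 in the denominator of
    \<open>\<delta>\<close>.\<close>
  define B0 where "B0 = nat \<lceil>B\<rceil> + 1"
  obtain C where "eventually (\<lambda>n. \<forall>\<mu> \<beta> a. \<forall>v :: nat \<Rightarrow> real ^ 'd.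
    real_distribution \<mu> \<longrightarrow> anti_concentrated c1 c2 c3 \<mu> \<longrightarrow> 0 < \<beta> \<longrightarrow>
    1 / real n ^ B0 \<le> \<P>(x in iid_copies \<mu> n. norm ((\<Sum>i\<in>{1..n}. x i *\<^sub>R v i) - a) \<le> \<beta>) \<longrightarrow>
    (\<exists>k T. 0 < k \<and> k \<le> n ^ C \<and> T \<subseteq> {1..n} \<and> card T \<le> C \<and>
      real (card {i \<in> {1..n}. \<not> (\<exists>\<kappa> :: nat \<Rightarrow> int. (\<forall>t\<in>T. \<bar>\<kappa> t\<bar> \<le> int (n ^ C)) \<and>
        norm (real k *\<^sub>R v i + (\<Sum>t\<in>T. of_int (\<kappa> t) *\<^sub>R v t)) \<le> \<beta> * real (n ^ C))}) \<le> real n powr \<epsilon>)) sequentially"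
    using inverse_Littlewood_Offord [of \<epsilon> c1 c3 c2 B0] assms by blast
  then obtain n1 where ILO: "\<And>n \<mu> \<beta> a. \<And>v :: nat \<Rightarrow> real ^ 'd. n1 \<le> n \<Longrightarrow>
    real_distribution \<mu> \<Longrightarrow> anti_concentrated c1 c2 c3 \<mu> \<Longrightarrow> 0 < \<beta> \<Longrightarrow>
    1 / real n ^ B0 \<le> \<P>(x in iid_copies \<mu> n. norm ((\<Sum>i\<in>{1..n}. x i *\<^sub>R v i) - a) \<le> \<beta>) \<Longrightarrow>
    (\<exists>k T. 0 < k \<and> k \<le> n ^ C \<and> T \<subseteq> {1..n} \<and> card T \<le> C \<and>
      real (card {i \<in> {1..n}. \<not> (\<exists>\<kappa> :: nat \<Rightarrow> int. (\<forall>t\<in>T. \<bar>\<kappa> t\<bar> \<le> int (n ^ C)) \<and>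
        norm (real k *\<^sub>R v i + (\<Sum>t\<in>T. of_int (\<kappa> t) *\<^sub>R v t)) \<le> \<beta> * real (n ^ C))}) \<le> real n powr \<epsilon>)"
    unfolding eventually_sequentially by blast
  define C' where "C' = B0 + 1 + C + 2 * C + (C + 2) * C"
  show ?thesis
  proof (intro exI [of _ "real C'"] exI [of _ "max n1 4"] conjI allI impI; (elim conjE)?)
    have "0 < C'" by (simp add: C'_def)
    then show "0 < real C'" "0 < max n1 4" by auto
    fix \<mu> :: "real measure" and n :: nat and \<beta> :: real and A :: "nat \<Rightarrow> nat \<Rightarrow> real ^ 'd"
    assume \<mu>: "real_distribution \<mu>" and ac: "anti_concentrated c1 c2 c3 \<mu>"
      and n: "max n1 4 \<le> n" and \<beta>: "0 < \<beta>"
      and sup: "real n powr - B \<le> (SUP a. \<P>((x, y) in iid_copies \<mu> n \<Otimes>\<^sub>M iid_copies \<mu> n.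
            norm ((\<Sum>i\<in>{1..n}. \<Sum>j\<in>{1..n}. (x i * y j) *\<^sub>R A i j) - a) \<le> \<beta>))"
    have n4: "4 \<le> n" and n0: "0 < real n" using n by auto
    have powC: "real n powr real C' = real (n ^ C')" "real n powr - real C' = 1 / real (n ^ C')"
      using n0 by (simp_all add: powr_realpow powr_minus_divide)
    interpret mu: real_distribution \<mu> by fact
    define M where "M = iid_copies \<mu> n"
    interpret M: prob_space M
      unfolding M_def iid_copies_def by (intro prob_space_PiM) (rule mu.prob_space_axioms)
    interpret P: pair_prob_space M M ..
    have comp[measurable]: "(\<lambda>x. x i) \<in> borel_measurable M" if "i \<in> {1..n}" for i
      using that unfolding M_def iid_copies_def
      by (metis measurable_component_singleton measurable_cong_sets mu.events_eq_borel)
    have comp2: "(\<lambda>z. fst z i) \<in> borel_measurable (M \<Otimes>\<^sub>M M)" "(\<lambda>z. snd z i) \<in> borel_measurable (M \<Otimes>\<^sub>M M)"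
      if "i \<in> {1..n}" for i
      using measurable_compose [OF measurable_fst comp [OF that]] measurable_compose [OF measurable_snd comp [OF that]]
      by blast+
    define V where "V y i = (\<Sum>j\<in>{1..n}. y j *\<^sub>R A i j)" for y i
    have [measurable]: "(\<lambda>y. V y i) \<in> borel_measurable M" for i
      unfolding V_def by (intro borel_measurable_sum borel_measurable_scaleR) auto
    have bilinear: "(\<Sum>i\<in>{1..n}. \<Sum>j\<in>{1..n}. (x i * y j) *\<^sub>R A i j) = (\<Sum>i\<in>{1..n}. x i *\<^sub>R V y i)" for x y
      by (simp add: V_def scaleR_sum_right)
    define S where "S z = (\<Sum>i\<in>{1..n}. fst z i *\<^sub>R V (snd z) i)" for z :: "(nat \<Rightarrow> real) \<times> (nat \<Rightarrow> real)"
    have [measurable]: "S \<in> borel_measurable (M \<Otimes>\<^sub>M M)"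
      unfolding S_def V_def using comp2 by (intro borel_measurable_sum borel_measurable_scaleR) auto
    \<comment> \<open>\<open>2 * \<delta>\<close> lies strictly below the supremum, so it is
      exceeded at an actual centre \<open>a\<close>.\<close>
    define \<delta> where "\<delta> = real n powr (- B) / 4"
    have \<delta>0: "0 < \<delta>" using n0 by (simp add: \<delta>_def)
    have \<delta>B: "1 / real n ^ B0 \<le> \<delta>"
    proof -
      have "real n powr (- real (nat \<lceil>B\<rceil>)) \<le> real n powr (- B)"
        using n4 by (intro powr_mono) (auto intro: real_nat_ceiling_ge)
      then have "1 / real n ^ nat \<lceil>B\<rceil> / 4 \<le> \<delta>"
        using n0 by (simp add: \<delta>_def powr_minus_divide powr_realpow)
      moreover have "1 / real n ^ nat \<lceil>B\<rceil> / real n \<le> 1 / real n ^ nat \<lceil>B\<rceil> / 4"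
        using n4 by (intro divide_left_mono) auto
      ultimately show ?thesis by (simp add: B0_def mult.commute)
    qed
    have "\<exists>a. 2 * \<delta> < P.prob {z \<in> space (M \<Otimes>\<^sub>M M). norm (S z - a) \<le> \<beta>}"
    proof -
      have "2 * \<delta> < real n powr - B" using n0 by (simp add: \<delta>_def)
      also have "\<dots> \<le> (SUP a. P.prob {z \<in> space (M \<Otimes>\<^sub>M M). norm (S z - a) \<le> \<beta>})"
        using sup unfolding bilinear M_def [symmetric] by (simp add: S_def split_def)
      finally have "2 * \<delta> < (SUP a. P.prob {z \<in> space (M \<Otimes>\<^sub>M M). norm (S z - a) \<le> \<beta>})" .
      then show ?thesis
        by (subst (asm) less_cSUP_iff) (auto intro!: bdd_aboveI [of _ 1] P.prob_le_1)
    qed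
    then obtain a where a: "2 * \<delta> < P.prob {z \<in> space (M \<Otimes>\<^sub>M M). norm (S z - a) \<le> \<beta>}" by blast
    define G where "G = {z \<in> space (M \<Otimes>\<^sub>M M). norm (S z - a) \<le> \<beta>}"
    have [measurable]: "G \<in> sets (M \<Otimes>\<^sub>M M)" unfolding G_def by measurable
    \<comment> \<open>For fixed \<open>y\<close>, the probability over \<open>x\<close> alone. Where
      it is at least \<open>\<delta>\<close>, the inverse theorem applies to the vectors
      \<open>V y i\<close>.\<close>
    define g :: "(nat \<Rightarrow> real) \<Rightarrow> real" where "g y = (\<integral>x. indicator G (x, y) \<partial>M)" for y
    have iG: "integrable (M \<Otimes>\<^sub>M M) (\<lambda>(x, y). indicator G (x, y) :: real)"
      by (simp add: split_def less_top [symmetric])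
    have g_int: "integrable M g"
      unfolding g_def using P.integrable_snd [OF iG] .
    have g_total: "(\<integral>y. g y \<partial>M) = P.prob G"
      unfolding g_def using P.integral_snd [OF iG] by (simp add: split_def Int_absorb1 sets.sets_into_space)
    have g_eq: "g y = M.prob {x \<in> space M. norm ((\<Sum>i\<in>{1..n}. x i *\<^sub>R V y i) - a) \<le> \<beta>}" if y: "y \<in> space M" for y
    proof -
      have "g y = (\<integral>x. indicator {x \<in> space M. norm ((\<Sum>i\<in>{1..n}. x i *\<^sub>R V y i) - a) \<le> \<beta>} x \<partial>M)"
        unfolding g_def using y
        by (intro Bochner_Integration.integral_cong) (auto simp: G_def S_def space_pair_measure indicator_def)
      then show ?thesis by (simp add: Int_absorb1)
    qed
    define \<Theta> where "\<Theta> = {1..n ^ C} \<times> {T. T \<subseteq> {1..n} \<and> card T \<le> C}"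
    \<comment> \<open>Extensional functions on \<open>T\<close>, so that the admissible coefficient
      vectors form a finite set.\<close>
    define K where "K \<tau> = PiE (snd \<tau>) (\<lambda>_. {- int (n ^ C)..int (n ^ C)})" for \<tau> :: "nat \<times> nat set"
    define E where "E \<tau> i \<kappa> = {y \<in> space M. norm (real (fst \<tau>) *\<^sub>R V y i + (\<Sum>t\<in>snd \<tau>. of_int (\<kappa> t) *\<^sub>R V y t)) \<le> \<beta> * real (n ^ C)}"
      for \<tau> :: "nat \<times> nat set" and i and \<kappa> :: "nat \<Rightarrow> int"
    define W where "W = (2 * n ^ C + 1) ^ C"
    define Z where "Z = n ^ C * (n + 1) ^ C"
    have fin: "finite (snd \<tau>)" if "\<tau> \<in> \<Theta>" for \<tau>
      by (rule finite_subset [of _ "{1..n}"]) (use that in \<open>auto simp: \<Theta>_def\<close>)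
    have "\<exists>\<tau>\<in>\<Theta>. \<exists>J\<subseteq>{1..n}. real (card {1..n}) - 2 * real n powr \<epsilon> \<le> real (card J) \<and>
       (\<forall>i\<in>J. \<exists>\<kappa>\<in>K \<tau>. \<delta> / (2 * real Z * real W) \<le> M.prob (E \<tau> i \<kappa>))"
    proof (rule M.exists_uniform_structure [where g = g])
      show "finite \<Theta>" unfolding \<Theta>_def by (intro finite_cartesian_product card_small_subsets_le) simp
      show "finite (K \<tau>)" if "\<tau> \<in> \<Theta>" for \<tau>
        unfolding K_def using fin [OF that] by (intro finite_PiE) auto
      show "E \<tau> i \<kappa> \<in> M.events" for \<tau> i \<kappa>
        unfolding E_def by measurable
      show "g y \<le> 1" if "y \<in> space M" for y
        using g_eq [OF that] by simp
      show "2 * \<delta> \<le> (\<integral>y. g y \<partial>M)" using a g_total by (simp add: G_def)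
      show "card (K \<tau>) \<le> W" if "\<tau> \<in> \<Theta>" for \<tau>
      proof -
        have "card (K \<tau>) = (2 * n ^ C + 1) ^ card (snd \<tau>)"
          unfolding K_def using fin [OF that] by (simp add: card_PiE nat_add_distrib nat_mult_distrib nat_power_eq)
        also have "\<dots> \<le> W"
          unfolding W_def using that by (intro power_increasing) (auto simp: \<Theta>_def)
        finally show ?thesis .
      qed
      show "card \<Theta> \<le> Z"
        unfolding \<Theta>_def Z_def card_cartesian_product using card_small_subsets_le(2) [of n C] by simp
      show "\<exists>\<tau>\<in>\<Theta>. real (card {i \<in> {1..n}. \<forall>\<kappa>\<in>K \<tau>. y \<notin> E \<tau> i \<kappa>}) \<le> real n powr \<epsilon>"
        if y: "y \<in> space M" and gy: "\<delta> \<le> g y" for y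
      proof -
        have "1 / real n ^ B0 \<le> \<P>(x in iid_copies \<mu> n. norm ((\<Sum>i\<in>{1..n}. x i *\<^sub>R V y i) - a) \<le> \<beta>)"
          using \<delta>B gy g_eq [OF y] by (simp add: M_def)
        from ILO [OF _ \<mu> ac \<beta> this] n
        obtain k T where kT: "0 < k" "k \<le> n ^ C" "T \<subseteq> {1..n}" "card T \<le> C"
          and bad: "real (card {i \<in> {1..n}. \<not> (\<exists>\<kappa> :: nat \<Rightarrow> int. (\<forall>t\<in>T. \<bar>\<kappa> t\<bar> \<le> int (n ^ C)) \<and>
            norm (real k *\<^sub>R V y i + (\<Sum>t\<in>T. of_int (\<kappa> t) *\<^sub>R V y t)) \<le> \<beta> * real (n ^ C))}) \<le> real n powr \<epsilon>"
          by (auto simp del: of_nat_power)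
        have "\<exists>\<kappa>\<in>K (k, T). y \<in> E (k, T) i \<kappa>"
          if "\<forall>t\<in>T. \<bar>\<kappa> t\<bar> \<le> int (n ^ C)"
            "norm (real k *\<^sub>R V y i + (\<Sum>t\<in>T. of_int (\<kappa> t) *\<^sub>R V y t)) \<le> \<beta> * real (n ^ C)" for i and \<kappa> :: "nat \<Rightarrow> int"
        proof (rule bexI [of _ "restrict \<kappa> T"])
          show "restrict \<kappa> T \<in> K (k, T)"
            using that(1) unfolding K_def by (simp add: PiE_iff abs_le_iff minus_le_iff del: of_nat_power)
          show "y \<in> E (k, T) i (restrict \<kappa> T)"
            using that(2) y by (simp add: E_def)
        qed
        then have "card {i \<in> {1..n}. \<forall>\<kappa>\<in>K (k, T). y \<notin> E (k, T) i \<kappa>} \<le>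
          card {i \<in> {1..n}. \<not> (\<exists>\<kappa> :: nat \<Rightarrow> int. (\<forall>t\<in>T. \<bar>\<kappa> t\<bar> \<le> int (n ^ C)) \<and>
            norm (real k *\<^sub>R V y i + (\<Sum>t\<in>T. of_int (\<kappa> t) *\<^sub>R V y t)) \<le> \<beta> * real (n ^ C))}"
          by (intro card_mono) (simp, blast)
        then have "real (card {i \<in> {1..n}. \<forall>\<kappa>\<in>K (k, T). y \<notin> E (k, T) i \<kappa>}) \<le> real n powr \<epsilon>"
          using bad by (meson of_nat_le_iff order_trans)
        moreover have "(k, T) \<in> \<Theta>" using kT by (simp add: \<Theta>_def)
        ultimately show ?thesis by blast
      qed
    qed (use g_int \<delta>0 in \<open>auto simp: W_def\<close>)
    then obtain k T J where kT: "(k, T) \<in> \<Theta>" and J: "J \<subseteq> {1..n}" "real n - 2 * real n powr \<epsilon> \<le> real (card J)"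
      and ex: "\<And>i. i \<in> J \<Longrightarrow> \<exists>\<kappa>\<in>K (k, T). \<delta> / (2 * real Z * real W) \<le> M.prob (E (k, T) i \<kappa>)"
      by auto
    have k: "0 < k" "k \<le> n ^ C" and T: "T \<subseteq> {1..n}" "card T \<le> C" using kT by (auto simp: \<Theta>_def)
    have finT: "finite T" using T finite_subset by auto
    obtain idx where idx: "bij_betw idx {1..card T} T"
      using ex_bij_betw_nat_finite_1 [OF finT] by blast
    have "C \<le> C'" by (simp add: C'_def)
    then have CC': "C \<le> C'" "n ^ C \<le> n ^ C'"
      using n4 by (auto intro: power_increasing)
    have small: "1 / real (n ^ C') \<le> \<delta> / (2 * real Z * real W)"
    proof -
      have "n ^ B0 * (2 * Z * W) \<le> n ^ C'"
        using parameter_count_le [OF n4, of B0 C] by (simp only: Z_def W_def C'_def)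
      then have "real (n ^ B0 * (2 * Z * W)) \<le> real (n ^ C')" by (simp only: of_nat_le_iff)
      moreover have ZW: "0 < Z" "0 < W" using n4 by (auto simp: Z_def W_def)
      ultimately have "1 / real (n ^ C') \<le> 1 / real (n ^ B0 * (2 * Z * W))"
        using n4 by (intro divide_left_mono) auto
      also have "\<dots> = 1 / real n ^ B0 / (2 * real Z * real W)" by simp
      also have "\<dots> \<le> \<delta> / (2 * real Z * real W)"
        using \<delta>B by (intro divide_right_mono) auto
      finally show ?thesis .
    qed
    show "\<exists>(k::int) (r::nat) (idx :: nat \<Rightarrow> nat) (I :: nat set).
          k \<noteq> 0 \<and> real_of_int \<bar>k\<bar> \<le> real n powr real C' \<and>
          real r \<le> real C' \<and> (\<forall>l\<in>{1..r}. idx l \<in> {1..n}) \<and>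
          I \<subseteq> {1..n} \<and> real (card I) \<ge> real n - 2 * real n powr \<epsilon> \<and>
          (\<forall>i\<in>I. \<exists>\<kappa> :: nat \<Rightarrow> int.
            (\<forall>l\<in>{1..r}. real_of_int \<bar>\<kappa> (idx l)\<bar> \<le> real n powr real C') \<and>
            \<P>(y in iid_copies \<mu> n.
                norm (\<Sum>j\<in>{1..n}. y j *\<^sub>R
                  (of_int k *\<^sub>R A i j + (\<Sum>l\<in>{1..r}. of_int (\<kappa> (idx l)) *\<^sub>R A (idx l) j)))
                \<le> \<beta> * real n powr real C')
              \<ge> real n powr (- real C'))"
    proof (intro exI [of _ "int k"] exI [of _ "card T"] exI [of _ idx] exI [of _ J] conjI ballI)
      show "int k \<noteq> 0" using k by simp
      have "k \<le> n ^ C'" using k CC' by linarith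
      then have "real k \<le> real (n ^ C')" by (simp only: of_nat_le_iff)
      then show "real_of_int \<bar>int k\<bar> \<le> real n powr real C'" unfolding powC by simp
      show "real (card T) \<le> real C'" using T CC' by simp
      show "idx l \<in> {1..n}" if "l \<in> {1..card T}" for l
        using bij_betwE [OF idx] that T by blast
      fix i assume "i \<in> J"
      then obtain \<kappa> where \<kappa>: "\<kappa> \<in> K (k, T)" "\<delta> / (2 * real Z * real W) \<le> M.prob (E (k, T) i \<kappa>)"
        using ex by blast
      show "\<exists>\<kappa> :: nat \<Rightarrow> int.
            (\<forall>l\<in>{1..card T}. real_of_int \<bar>\<kappa> (idx l)\<bar> \<le> real n powr real C') \<and>
            \<P>(y in iid_copies \<mu> n.
                norm (\<Sum>j\<in>{1..n}. y j *\<^sub>R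
                  (of_int (int k) *\<^sub>R A i j + (\<Sum>l\<in>{1..card T}. of_int (\<kappa> (idx l)) *\<^sub>R A (idx l) j)))
                \<le> \<beta> * real n powr real C')
              \<ge> real n powr (- real C')"
      proof (intro exI [of _ \<kappa>] conjI ballI)
        fix l assume "l \<in> {1..card T}"
        then have "idx l \<in> T" using bij_betwE [OF idx] by blast
        then have "\<kappa> (idx l) \<in> {- int (n ^ C)..int (n ^ C)}" using \<kappa>(1) by (auto simp: K_def)
        then have "\<bar>\<kappa> (idx l)\<bar> \<le> int (n ^ C')" using CC' by (auto simp del: of_nat_power)
        then have "real_of_int \<bar>\<kappa> (idx l)\<bar> \<le> real_of_int (int (n ^ C'))" by (simp only: of_int_le_iff)
        then show "real_of_int \<bar>\<kappa> (idx l)\<bar> \<le> real n powr real C'"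
          unfolding powC by (simp only: of_int_of_nat_eq)
      next
        have eq: "(\<Sum>j\<in>{1..n}. y j *\<^sub>R (of_int (int k) *\<^sub>R A i j + (\<Sum>l\<in>{1..card T}. of_int (\<kappa> (idx l)) *\<^sub>R A (idx l) j)))
          = real k *\<^sub>R V y i + (\<Sum>t\<in>T. of_int (\<kappa> t) *\<^sub>R V y t)" for y
        proof -
          have "(\<Sum>l\<in>{1..card T}. of_int (\<kappa> (idx l)) *\<^sub>R A (idx l) j) = (\<Sum>t\<in>T. of_int (\<kappa> t) *\<^sub>R A t j)" for j
            by (rule sum.reindex_bij_betw [OF idx])
          then have "(\<Sum>j\<in>{1..n}. y j *\<^sub>R (of_int (int k) *\<^sub>R A i j + (\<Sum>l\<in>{1..card T}. of_int (\<kappa> (idx l)) *\<^sub>R A (idx l) j)))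
            = (\<Sum>j\<in>{1..n}. real k *\<^sub>R y j *\<^sub>R A i j + (\<Sum>t\<in>T. of_int (\<kappa> t) *\<^sub>R y j *\<^sub>R A t j))"
            by (simp add: scaleR_add_right scaleR_sum_right mult.commute)
          also have "\<dots> = real k *\<^sub>R V y i + (\<Sum>t\<in>T. of_int (\<kappa> t) *\<^sub>R V y t)"
            by (simp add: V_def sum.distrib scaleR_sum_right) (rule sum.swap)
          finally show ?thesis .
        qed
        have "\<beta> * real (n ^ C) \<le> \<beta> * real (n ^ C')"
          using CC' \<beta> by (intro mult_left_mono) (simp_all only: of_nat_le_iff)
        then have "M.prob (E (k, T) i \<kappa>) \<le>
          M.prob {y \<in> space M. norm (real k *\<^sub>R V y i + (\<Sum>t\<in>T. of_int (\<kappa> t) *\<^sub>R V y t)) \<le> \<beta> * real (n ^ C')}"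
          by (intro M.finite_measure_mono) (auto simp: E_def)
        then show "real n powr - real C' \<le> \<P>(y in iid_copies \<mu> n.
                norm (\<Sum>j\<in>{1..n}. y j *\<^sub>R
                  (of_int (int k) *\<^sub>R A i j + (\<Sum>l\<in>{1..card T}. of_int (\<kappa> (idx l)) *\<^sub>R A (idx l) j)))
                \<le> \<beta> * real n powr real C')"
          unfolding eq powC M_def [symmetric] using \<kappa>(2) small by linarith
      qed
    qed (use J in auto)
  qed
qed

end
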